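(* Assume that for every $i\in I$ the right $A$-module $P_i=e_iP$ is finitely generated and projective, with finite dual basis $E_i=\sum z_i\otimes_Az_i^*\in P_i\otimes_AP_i^*$. Then $\mathcal{G}=P^\dagger\otimes_BP$ is an $A$-coring, with comultiplication $\Delta$ and counit $\varepsilon$ given, for all $i\in I$, $\varphi_i\in P_i^*$ and $p_i\in P_i$, by $$\Delta\big((\varphi_i\circ\tau_i)\otimes_B\sigma_i(p_i)\big)=\sum \big((\varphi_i\circ\tau_i)\otimes_B\sigma_i(z_i)\big)\otimes_A\big((z_i^*\circ\tau_i)\otimes_B\sigma_i(p_i)\big),$$ $$\varepsilon\big((\varphi_i\circ\tau_i)\otimes_B\sigma_i(p_i)\big)=\varphi_i(p_i).$$
   Context: $k$ is a commutative ring and $A$ is a $k$-algebra with unit. An $A$-coring is a coalgebra in the monoidal category of $A$-bimodules (with $\otimes_A$). A (not necessarily unital) $k$-algebra $B$ has idempotent local units if there is a set of idempotents $\{e_i\mid i\in I\}\subset B$ (indexed without repetition) such that for every finite $F\subset B$ there is $i\in I$ with $e_ib=be_i=b$ for all $b\in F$. Fix such a $B$. The index set $I$ is partially ordered by $i\le j$ iff $e_ie_j=e_je_i=e_i$; this order is directed. Put $B_i=e_iBe_i$, a $k$-algebra with unit $e_i$. A left $B$-module $N$ is firm if the canonical map $B\otimes_BN\to N$ is an isomorphism. $P$ is a firm $(B,A)$-bimodule, i.e. a $(B,A)$-bimodule firm as left $B$-module and unital as right $A$-module. Put $P_i=e_iP$, a $(B_i,A)$-bimodule; $\sigma_i:P_i\to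 P$ is the inclusion and $\tau_i:P\to P_i$, $\tau_i(p)=e_ip$. $P^*=\operatorname{Hom}_A(P,A)$ and $P_i^*=\operatorname{Hom}_A(P_i,A)$ (right $A$-linear maps), with $(a\varphi b)(p)=a\varphi(bp)$. $P^\dagger=\{\varphi\in P^*\mid \exists i\in I:\ \varphi=\varphi\circ\sigma_i\circ\tau_i\}$, an $(A,B)$-bimodule via $(a\varphi b)(p)=a\varphi(bp)$. The finite dual basis $E_i=\sum z_i\otimes_Az_i^*$ (summation index omitted) is the unique element of $P_i\otimes_AP_i^*$ with $p_i=\sum z_iz_i^*(p_i)$ and $\varphi_i=\sum\varphi_i(z_i)z_i^*$ for all $p_i\in P_i$, $\varphi_i\in P_i^*$. *)

theory Defs
  imports "HOL-Algebra.Module" "HOL-Algebra.Generated_Groups" "HOL-Algebra.Free_Abelian_Groups"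
begin

section \<open>Algebras without commutativity, possibly without unit\<close>

text \<open>The locale \<^locale>\<open>algebra\<close> of the library is about commutative unital algebras. In
  \<open>assoc_algebra\<close> the field \<open>one\<close> of the record carries no meaning.\<close>

locale assoc_algebra = module k A for k (structure) and A (structure) +
  assumes alg_m_closed: "\<lbrakk>x \<in> carrier A; y \<in> carrier A\<rbrakk> \<Longrightarrow> x \<otimes>\<^bsub>A\<^esub> y \<in> carrier A"
    and alg_m_assoc: "\<lbrakk>x \<in> carrier A; y \<in> carrier A; z \<in> carrier A\<rbrakk>
      \<Longrightarrow> (x \<otimes>\<^bsub>A\<^esub> y) \<otimes>\<^bsub>A\<^esub> z = x \<otimes>\<^bsub>A\<^esub> (y \<otimes>\<^bsub>A\<^esub> z)"
    and alg_l_distr: "\<lbrakk>x \<in> carrier A; y \<in> carrier A; z \<in> carrier A\<rbrakk>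
      \<Longrightarrow> (x \<oplus>\<^bsub>A\<^esub> y) \<otimes>\<^bsub>A\<^esub> z = x \<otimes>\<^bsub>A\<^esub> z \<oplus>\<^bsub>A\<^esub> y \<otimes>\<^bsub>A\<^esub> z"
    and alg_r_distr: "\<lbrakk>x \<in> carrier A; y \<in> carrier A; z \<in> carrier A\<rbrakk>
      \<Longrightarrow> x \<otimes>\<^bsub>A\<^esub> (y \<oplus>\<^bsub>A\<^esub> z) = x \<otimes>\<^bsub>A\<^esub> y \<oplus>\<^bsub>A\<^esub> x \<otimes>\<^bsub>A\<^esub> z"
    and alg_smult_l: "\<lbrakk>c \<in> carrier k; x \<in> carrier A; y \<in> carrier A\<rbrakk>
      \<Longrightarrow> (c \<odot>\<^bsub>A\<^esub> x) \<otimes>\<^bsub>A\<^esub> y = c \<odot>\<^bsub>A\<^esub> (x \<otimes>\<^bsub>A\<^esub> y)"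
    and alg_smult_r: "\<lbrakk>c \<in> carrier k; x \<in> carrier A; y \<in> carrier A\<rbrakk>
      \<Longrightarrow> x \<otimes>\<^bsub>A\<^esub> (c \<odot>\<^bsub>A\<^esub> y) = c \<odot>\<^bsub>A\<^esub> (x \<otimes>\<^bsub>A\<^esub> y)"

locale unital_algebra = assoc_algebra k A + monoid A for k (structure) and A (structure)

text \<open>The family \<open>(e i)\<close>, \<open>i \<in> I\<close>, is a set of idempotents indexed without repetition.\<close>

locale idempotent_local_units =
  fixes B :: "('b, 'm) ring_scheme" (structure) and I :: "'i set" and e :: "'i \<Rightarrow> 'b"
  assumes unit_closed: "i \<in> I \<Longrightarrow> e i \<in> carrier B"
    and unit_idem: "i \<in> I \<Longrightarrow> e i \<otimes> e i = e i"
    and unit_inj: "inj_on e I"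
    and local_units: "\<lbrakk>finite F; F \<subseteq> carrier B\<rbrakk> \<Longrightarrow> \<exists>i\<in>I. \<forall>b\<in>F. e i \<otimes> b = b \<and> b \<otimes> e i = b"


section \<open>Bimodules\<close>

text \<open>A bimodule is a \<open>k\<close>-module with a left and a right action. The inherited record fields
  \<open>mult\<close> and \<open>one\<close> are unused for bimodules; the constructions below fill them with
  \<^term>\<open>undefined\<close>.\<close>

record ('k, 'l, 'r, 'm) bimodule = "('k, 'm) module" +
  lsmult :: "['l, 'm] \<Rightarrow> 'm" (infixl \<open>\<triangleright>\<index>\<close> 70)
  rsmult :: "['m, 'r] \<Rightarrow> 'm" (infixl \<open>\<triangleleft>\<index>\<close> 70)

locale bimodule = L: assoc_algebra k L + R: assoc_algebra k R + module k M
  for k :: "('k, 'u) ring_scheme" (structure)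
    and L :: "('k, 'l, 'v) module_scheme" (structure)
    and R :: "('k, 'r, 'w) module_scheme" (structure)
    and M :: "('k, 'l, 'r, 'm, 'x) bimodule_scheme" (structure) +
  assumes lsmult_closed: "\<lbrakk>a \<in> carrier L; x \<in> carrier M\<rbrakk> \<Longrightarrow> a \<triangleright>\<^bsub>M\<^esub> x \<in> carrier M"
    and lsmult_l_distr: "\<lbrakk>a \<in> carrier L; b \<in> carrier L; x \<in> carrier M\<rbrakk>
      \<Longrightarrow> (a \<oplus>\<^bsub>L\<^esub> b) \<triangleright>\<^bsub>M\<^esub> x = (a \<triangleright>\<^bsub>M\<^esub> x) \<oplus>\<^bsub>M\<^esub> (b \<triangleright>\<^bsub>M\<^esub> x)"
    and lsmult_r_distr: "\<lbrakk>a \<in> carrier L; x \<in> carrier M; y \<in> carrier M\<rbrakk>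
      \<Longrightarrow> a \<triangleright>\<^bsub>M\<^esub> (x \<oplus>\<^bsub>M\<^esub> y) = (a \<triangleright>\<^bsub>M\<^esub> x) \<oplus>\<^bsub>M\<^esub> (a \<triangleright>\<^bsub>M\<^esub> y)"
    and lsmult_assoc: "\<lbrakk>a \<in> carrier L; b \<in> carrier L; x \<in> carrier M\<rbrakk>
      \<Longrightarrow> (a \<otimes>\<^bsub>L\<^esub> b) \<triangleright>\<^bsub>M\<^esub> x = a \<triangleright>\<^bsub>M\<^esub> (b \<triangleright>\<^bsub>M\<^esub> x)"
    and lsmult_smult_l: "\<lbrakk>c \<in> carrier k; a \<in> carrier L; x \<in> carrier M\<rbrakk>
      \<Longrightarrow> (c \<odot>\<^bsub>L\<^esub> a) \<triangleright>\<^bsub>M\<^esub> x = c \<odot>\<^bsub>M\<^esub> (a \<triangleright>\<^bsub>M\<^esub> x)"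
    and lsmult_smult_r: "\<lbrakk>c \<in> carrier k; a \<in> carrier L; x \<in> carrier M\<rbrakk>
      \<Longrightarrow> a \<triangleright>\<^bsub>M\<^esub> (c \<odot>\<^bsub>M\<^esub> x) = c \<odot>\<^bsub>M\<^esub> (a \<triangleright>\<^bsub>M\<^esub> x)"
    and rsmult_closed: "\<lbrakk>r \<in> carrier R; x \<in> carrier M\<rbrakk> \<Longrightarrow> x \<triangleleft>\<^bsub>M\<^esub> r \<in> carrier M"
    and rsmult_r_distr: "\<lbrakk>r \<in> carrier R; s \<in> carrier R; x \<in> carrier M\<rbrakk>
      \<Longrightarrow> x \<triangleleft>\<^bsub>M\<^esub> (r \<oplus>\<^bsub>R\<^esub> s) = (x \<triangleleft>\<^bsub>M\<^esub> r) \<oplus>\<^bsub>M\<^esub> (x \<triangleleft>\<^bsub>M\<^esub> s)"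
    and rsmult_l_distr: "\<lbrakk>r \<in> carrier R; x \<in> carrier M; y \<in> carrier M\<rbrakk>
      \<Longrightarrow> (x \<oplus>\<^bsub>M\<^esub> y) \<triangleleft>\<^bsub>M\<^esub> r = (x \<triangleleft>\<^bsub>M\<^esub> r) \<oplus>\<^bsub>M\<^esub> (y \<triangleleft>\<^bsub>M\<^esub> r)"
    and rsmult_assoc: "\<lbrakk>r \<in> carrier R; s \<in> carrier R; x \<in> carrier M\<rbrakk>
      \<Longrightarrow> x \<triangleleft>\<^bsub>M\<^esub> (r \<otimes>\<^bsub>R\<^esub> s) = (x \<triangleleft>\<^bsub>M\<^esub> r) \<triangleleft>\<^bsub>M\<^esub> s"
    and rsmult_smult_r: "\<lbrakk>c \<in> carrier k; r \<in> carrier R; x \<in> carrier M\<rbrakk>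
      \<Longrightarrow> x \<triangleleft>\<^bsub>M\<^esub> (c \<odot>\<^bsub>R\<^esub> r) = c \<odot>\<^bsub>M\<^esub> (x \<triangleleft>\<^bsub>M\<^esub> r)"
    and rsmult_smult_l: "\<lbrakk>c \<in> carrier k; r \<in> carrier R; x \<in> carrier M\<rbrakk>
      \<Longrightarrow> (c \<odot>\<^bsub>M\<^esub> x) \<triangleleft>\<^bsub>M\<^esub> r = c \<odot>\<^bsub>M\<^esub> (x \<triangleleft>\<^bsub>M\<^esub> r)"
    and lsmult_rsmult: "\<lbrakk>a \<in> carrier L; x \<in> carrier M; r \<in> carrier R\<rbrakk>
      \<Longrightarrow> (a \<triangleright>\<^bsub>M\<^esub> x) \<triangleleft>\<^bsub>M\<^esub> r = a \<triangleright>\<^bsub>M\<^esub> (x \<triangleleft>\<^bsub>M\<^esub> r)"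

definition left_unital :: "('k, 'l) module \<Rightarrow> ('k, 'l, 'r, 'm) bimodule \<Rightarrow> bool" where
  "left_unital L M \<longleftrightarrow> (\<forall>x\<in>carrier M. \<one>\<^bsub>L\<^esub> \<triangleright>\<^bsub>M\<^esub> x = x)"

definition right_unital :: "('k, 'r) module \<Rightarrow> ('k, 'l, 'r, 'm) bimodule \<Rightarrow> bool" where
  "right_unital R M \<longleftrightarrow> (\<forall>x\<in>carrier M. x \<triangleleft>\<^bsub>M\<^esub> \<one>\<^bsub>R\<^esub> = x)"

definition regular_bimodule :: "('k, 'a) module \<Rightarrow> ('k, 'a, 'a, 'a) bimodule" where
  "regular_bimodule A = \<lparr>carrier = carrier A, monoid.mult = undefined, one = undefined,
     ring.zero = \<zero>\<^bsub>A\<^esub>, ring.add = (\<oplus>\<^bsub>A\<^esub>), smult = (\<odot>\<^bsub>A\<^esub>),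
     lsmult = (\<otimes>\<^bsub>A\<^esub>), rsmult = (\<otimes>\<^bsub>A\<^esub>)\<rparr>"

definition bimodule_hom ::
  "'k ring \<Rightarrow> ('k, 'l) module \<Rightarrow> ('k, 'r) module \<Rightarrow> ('k, 'l, 'r, 'm) bimodule
    \<Rightarrow> ('k, 'l, 'r, 'n) bimodule \<Rightarrow> ('m \<Rightarrow> 'n) set" where
  "bimodule_hom k L R M N = {h \<in> hom (add_monoid M) (add_monoid N).
     (\<forall>c\<in>carrier k. \<forall>x\<in>carrier M. h (c \<odot>\<^bsub>M\<^esub> x) = c \<odot>\<^bsub>N\<^esub> h x) \<and>
     (\<forall>a\<in>carrier L. \<forall>x\<in>carrier M. h (a \<triangleright>\<^bsub>M\<^esub> x) = a \<triangleright>\<^bsub>N\<^esub> h x) \<and>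
     (\<forall>a\<in>carrier R. \<forall>x\<in>carrier M. h (x \<triangleleft>\<^bsub>M\<^esub> a) = h x \<triangleleft>\<^bsub>N\<^esub> a)}"

definition right_hom ::
  "('k, 'r) module \<Rightarrow> ('k, 'l, 'r, 'm) bimodule \<Rightarrow> ('k, 'l', 'r, 'n) bimodule \<Rightarrow> ('m \<Rightarrow> 'n) set"
where
  "right_hom R M N = {h \<in> carrier M \<rightarrow>\<^sub>E carrier N.
     (\<forall>x\<in>carrier M. \<forall>y\<in>carrier M. h (x \<oplus>\<^bsub>M\<^esub> y) = h x \<oplus>\<^bsub>N\<^esub> h y) \<and>
     (\<forall>a\<in>carrier R. \<forall>x\<in>carrier M. h (x \<triangleleft>\<^bsub>M\<^esub> a) = h x \<triangleleft>\<^bsub>N\<^esub> a)}"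

text \<open>\<open>Hom\<^sub>R(M, R)\<close> for an \<open>(L, R)\<close>-bimodule \<open>M\<close>, with its \<open>(R, L)\<close>-bimodule structure
  \<open>(a \<phi> b)(x) = a \<phi>(b x)\<close>.\<close>

definition dual ::
  "('k, 'r) module \<Rightarrow> ('k, 'l, 'r, 'm) bimodule \<Rightarrow> ('k, 'r, 'l, 'm \<Rightarrow> 'r) bimodule" where
  "dual R M = \<lparr>carrier = right_hom R M (regular_bimodule R),
     monoid.mult = undefined, one = undefined,
     ring.zero = (\<lambda>x\<in>carrier M. \<zero>\<^bsub>R\<^esub>),
     ring.add = (\<lambda>\<phi> \<psi>. \<lambda>x\<in>carrier M. \<phi> x \<oplus>\<^bsub>R\<^esub> \<psi> x),
     smult = (\<lambda>c \<phi>. \<lambda>x\<in>carrier M. c \<odot>\<^bsub>R\<^esub> \<phi> x),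
     lsmult = (\<lambda>a \<phi>. \<lambda>x\<in>carrier M. a \<otimes>\<^bsub>R\<^esub> \<phi> x),
     rsmult = (\<lambda>\<phi> b. \<lambda>x\<in>carrier M. \<phi> (b \<triangleright>\<^bsub>M\<^esub> x))\<rparr>"


section \<open>Finitely generated projective right modules\<close>

definition fin_gen_right :: "('k, 'r) module \<Rightarrow> ('k, 'l, 'r, 'm) bimodule \<Rightarrow> bool" where
  "fin_gen_right R M \<longleftrightarrow> (\<exists>X. finite X \<and> X \<subseteq> carrier M \<and>
     (\<forall>m\<in>carrier M. \<exists>f \<in> X \<rightarrow> carrier R. m = (\<Oplus>\<^bsub>M\<^esub>x\<in>X. x \<triangleleft>\<^bsub>M\<^esub> f x)))"

definition free_module :: "('k, 'r) module \<Rightarrow> 's set \<Rightarrow> ('k, 'r, 'r, 's \<Rightarrow> 'r) bimodule" where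
  "free_module R S = \<lparr>carrier = {f \<in> S \<rightarrow>\<^sub>E carrier R. finite {s \<in> S. f s \<noteq> \<zero>\<^bsub>R\<^esub>}},
     monoid.mult = undefined, one = undefined,
     ring.zero = (\<lambda>s\<in>S. \<zero>\<^bsub>R\<^esub>),
     ring.add = (\<lambda>f g. \<lambda>s\<in>S. f s \<oplus>\<^bsub>R\<^esub> g s),
     smult = (\<lambda>c f. \<lambda>s\<in>S. c \<odot>\<^bsub>R\<^esub> f s),
     lsmult = (\<lambda>a f. \<lambda>s\<in>S. a \<otimes>\<^bsub>R\<^esub> f s),
     rsmult = (\<lambda>f a. \<lambda>s\<in>S. f s \<otimes>\<^bsub>R\<^esub> a)\<rparr>"

text \<open>Projective means direct summand of a free module. Taking the basis to be a set \<open>S\<close> of elements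
  of type \<open>'m\<close> is no restriction: a projective \<open>M\<close> is a summand of the free module on
  \<open>carrier M\<close>.\<close>

definition projective_right :: "('k, 'r) module \<Rightarrow> ('k, 'l, 'r, 'm) bimodule \<Rightarrow> bool" where
  "projective_right R M \<longleftrightarrow> (\<exists>S :: 'm set. \<exists>s \<in> right_hom R M (free_module R S).
     \<exists>r \<in> right_hom R (free_module R S) M. \<forall>m\<in>carrier M. r (s m) = m)"


section \<open>Tensor products\<close>

text \<open>For an \<open>(L, R)\<close>-bimodule \<open>M\<close> and an \<open>(R, S)\<close>-bimodule \<open>N\<close>, the tensor product over \<open>R\<close>
  in the category of \<open>k\<close>-modules is the free abelian group on \<open>M \<times> N\<close> modulo \<open>tensor_rels\<close>. The
  relations that make it \<open>k\<close>-balanced are included because \<open>R\<close> need not have a unit.\<close>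

abbreviation pairs_group ::
  "('k, 'l, 'r, 'm) bimodule \<Rightarrow> ('k, 'r, 's, 'n) bimodule \<Rightarrow> ('m \<times> 'n \<Rightarrow>\<^sub>0 int) monoid" where
  "pairs_group M N \<equiv> free_Abelian_group (carrier M \<times> carrier N)"

definition tensor_rels ::
  "'k ring \<Rightarrow> ('k, 'r) module \<Rightarrow> ('k, 'l, 'r, 'm) bimodule \<Rightarrow> ('k, 'r, 's, 'n) bimodule
    \<Rightarrow> ('m \<times> 'n \<Rightarrow>\<^sub>0 int) set" where
  "tensor_rels k R M N = generate (pairs_group M N)
    ({frag_of (x \<oplus>\<^bsub>M\<^esub> x', y) - frag_of (x, y) - frag_of (x', y) | x x' y.
        x \<in> carrier M \<and> x' \<in> carrier M \<and> y \<in> carrier N} \<union>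
     {frag_of (x, y \<oplus>\<^bsub>N\<^esub> y') - frag_of (x, y) - frag_of (x, y') | x y y'.
        x \<in> carrier M \<and> y \<in> carrier N \<and> y' \<in> carrier N} \<union>
     {frag_of (x \<triangleleft>\<^bsub>M\<^esub> a, y) - frag_of (x, a \<triangleright>\<^bsub>N\<^esub> y) | x a y.
        x \<in> carrier M \<and> a \<in> carrier R \<and> y \<in> carrier N} \<union>
     {frag_of (c \<odot>\<^bsub>M\<^esub> x, y) - frag_of (x, c \<odot>\<^bsub>N\<^esub> y) | c x y.
        c \<in> carrier k \<and> x \<in> carrier M \<and> y \<in> carrier N})"

text \<open>The map of cosets induced by \<open>(x, y) \<mapsto> (f x, g y)\<close>.\<close>

definition tensor_act ::
  "'k ring \<Rightarrow> ('k, 'r) module \<Rightarrow> ('k, 'l, 'r, 'm) bimodule \<Rightarrow> ('k, 'r, 's, 'n) bimodule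
    \<Rightarrow> ('m \<Rightarrow> 'm) \<Rightarrow> ('n \<Rightarrow> 'n) \<Rightarrow> ('m \<times> 'n \<Rightarrow>\<^sub>0 int) set \<Rightarrow> ('m \<times> 'n \<Rightarrow>\<^sub>0 int) set" where
  "tensor_act k R M N f g X = tensor_rels k R M N <#>\<^bsub>pairs_group M N\<^esub>
     (frag_extend (\<lambda>(x, y). frag_of (f x, g y)) ` X)"

definition tensor ::
  "'k ring \<Rightarrow> ('k, 'r) module \<Rightarrow> ('k, 'l, 'r, 'm) bimodule \<Rightarrow> ('k, 'r, 's, 'n) bimodule
    \<Rightarrow> ('k, 'l, 's, ('m \<times> 'n \<Rightarrow>\<^sub>0 int) set) bimodule" where
  "tensor k R M N = \<lparr>carrier = rcosets\<^bsub>pairs_group M N\<^esub> (tensor_rels k R M N),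
     monoid.mult = undefined, one = undefined,
     ring.zero = tensor_rels k R M N,
     ring.add = (<#>\<^bsub>pairs_group M N\<^esub>),
     smult = (\<lambda>c. tensor_act k R M N (\<lambda>x. c \<odot>\<^bsub>M\<^esub> x) (\<lambda>y. y)),
     lsmult = (\<lambda>a. tensor_act k R M N (\<lambda>x. a \<triangleright>\<^bsub>M\<^esub> x) (\<lambda>y. y)),
     rsmult = (\<lambda>X b. tensor_act k R M N (\<lambda>x. x) (\<lambda>y. y \<triangleleft>\<^bsub>N\<^esub> b) X)\<rparr>"

definition pure_tensor ::
  "'k ring \<Rightarrow> ('k, 'r) module \<Rightarrow> ('k, 'l, 'r, 'm) bimodule \<Rightarrow> ('k, 'r, 's, 'n) bimodule
    \<Rightarrow> 'm \<Rightarrow> 'n \<Rightarrow> ('m \<times> 'n \<Rightarrow>\<^sub>0 int) set" where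
  "pure_tensor k R M N x y = tensor_rels k R M N #>\<^bsub>pairs_group M N\<^esub> frag_of (x, y)"

text \<open>The additive map on \<open>M \<otimes>\<^sub>R N\<close> with \<open>x \<otimes> y \<mapsto> f x y\<close>, for a balanced biadditive \<open>f\<close>.\<close>

definition tensor_lift ::
  "'k ring \<Rightarrow> ('k, 'r) module \<Rightarrow> ('k, 'l, 'r, 'm) bimodule \<Rightarrow> ('k, 'r, 's, 'n) bimodule
    \<Rightarrow> ('q, 'z) ring_scheme \<Rightarrow> ('m \<Rightarrow> 'n \<Rightarrow> 'q) \<Rightarrow> ('m \<times> 'n \<Rightarrow>\<^sub>0 int) set \<Rightarrow> 'q" where
  "tensor_lift k R M N Q f = (THE h.
     h \<in> extensional (carrier (tensor k R M N)) \<and>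
     h \<in> hom (add_monoid (tensor k R M N)) (add_monoid Q) \<and>
     (\<forall>x\<in>carrier M. \<forall>y\<in>carrier N. h (pure_tensor k R M N x y) = f x y))"

definition tensor_map ::
  "'k ring \<Rightarrow> ('k, 'r) module \<Rightarrow> ('k, 'l, 'r, 'm) bimodule \<Rightarrow> ('k, 'r, 's, 'n) bimodule
    \<Rightarrow> ('k, 'l, 'r, 'm') bimodule \<Rightarrow> ('k, 'r, 's, 'n') bimodule \<Rightarrow> ('m \<Rightarrow> 'm') \<Rightarrow> ('n \<Rightarrow> 'n')
    \<Rightarrow> ('m \<times> 'n \<Rightarrow>\<^sub>0 int) set \<Rightarrow> ('m' \<times> 'n' \<Rightarrow>\<^sub>0 int) set" where
  "tensor_map k R M N M' N' f g =
     tensor_lift k R M N (tensor k R M' N') (\<lambda>x y. pure_tensor k R M' N' (f x) (g y))"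

text \<open>The associator \<open>(M \<otimes>\<^sub>R N) \<otimes>\<^sub>R Q \<rightarrow> M \<otimes>\<^sub>R (N \<otimes>\<^sub>R Q)\<close> of \<open>R\<close>-bimodules.\<close>

definition tensor_assoc ::
  "'k ring \<Rightarrow> ('k, 'r) module \<Rightarrow> ('k, 'r, 'r, 'm) bimodule \<Rightarrow> ('k, 'r, 'r, 'n) bimodule
    \<Rightarrow> ('k, 'r, 'r, 'q) bimodule \<Rightarrow> (('m \<times> 'n \<Rightarrow>\<^sub>0 int) set \<times> 'q \<Rightarrow>\<^sub>0 int) set
    \<Rightarrow> ('m \<times> ('n \<times> 'q \<Rightarrow>\<^sub>0 int) set \<Rightarrow>\<^sub>0 int) set" where
  "tensor_assoc k R M N Q =
     tensor_lift k R (tensor k R M N) Q (tensor k R M (tensor k R N Q))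
       (\<lambda>t z. tensor_lift k R M N (tensor k R M (tensor k R N Q))
          (\<lambda>x y. pure_tensor k R M (tensor k R N Q) x (pure_tensor k R N Q y z)) t)"

text \<open>The canonical map \<open>R \<otimes>\<^sub>R M \<rightarrow> M\<close> and its mirror image. For unital modules over a unital
  algebra they are the unitors; in general, a left module is firm when the first one is an
  isomorphism.\<close>

definition left_action_map ::
  "'k ring \<Rightarrow> ('k, 'r) module \<Rightarrow> ('k, 'r, 's, 'm) bimodule \<Rightarrow> ('r \<times> 'm \<Rightarrow>\<^sub>0 int) set \<Rightarrow> 'm" where
  "left_action_map k R M = tensor_lift k R (regular_bimodule R) M M (\<lambda>a x. a \<triangleright>\<^bsub>M\<^esub> x)"

definition right_action_map ::
  "'k ring \<Rightarrow> ('k, 'r) module \<Rightarrow> ('k, 'l, 'r, 'm) bimodule \<Rightarrow> ('m \<times> 'r \<Rightarrow>\<^sub>0 int) set \<Rightarrow> 'm" where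
  "right_action_map k R M = tensor_lift k R M (regular_bimodule R) M (\<lambda>x a. x \<triangleleft>\<^bsub>M\<^esub> a)"

definition firm_left :: "'k ring \<Rightarrow> ('k, 'r) module \<Rightarrow> ('k, 'r, 's, 'm) bimodule \<Rightarrow> bool" where
  "firm_left k R M \<longleftrightarrow>
     bij_betw (left_action_map k R M) (carrier (tensor k R (regular_bimodule R) M)) (carrier M)"


section \<open>Corings\<close>

locale coring = unital_algebra k A + bimodule k A A C
  for k :: "'k ring" and A :: "('k, 'a) module" and C :: "('k, 'a, 'a, 'c) bimodule" +
  fixes \<Delta> :: "'c \<Rightarrow> ('c \<times> 'c \<Rightarrow>\<^sub>0 int) set" and \<epsilon> :: "'c \<Rightarrow> 'a"
  assumes unital_C: "left_unital A C" "right_unital A C"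
    and comult_hom: "\<Delta> \<in> bimodule_hom k A A C (tensor k A C C)"
    and counit_hom: "\<epsilon> \<in> bimodule_hom k A A C (regular_bimodule A)"
    and coassoc: "x \<in> carrier C \<Longrightarrow>
      tensor_assoc k A C C C (tensor_map k A C C (tensor k A C C) C \<Delta> (\<lambda>y. y) (\<Delta> x)) =
      tensor_map k A C C C (tensor k A C C) (\<lambda>y. y) \<Delta> (\<Delta> x)"
    and counit_left: "x \<in> carrier C \<Longrightarrow>
      left_action_map k A C (tensor_map k A C C (regular_bimodule A) C \<epsilon> (\<lambda>y. y) (\<Delta> x)) = x"
    and counit_right: "x \<in> carrier C \<Longrightarrow>
      right_action_map k A C (tensor_map k A C C C (regular_bimodule A) (\<lambda>y. y) \<epsilon> (\<Delta> x)) = x"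


section \<open>Dual bases and the bimodule \<open>P\<^sup>\<dagger> \<otimes>\<^sub>B P\<close>\<close>

definition tensor_sum ::
  "'k ring \<Rightarrow> ('k, 'r) module \<Rightarrow> ('k, 'l, 'r, 'm) bimodule \<Rightarrow> ('k, 'r, 's, 'n) bimodule
    \<Rightarrow> nat \<Rightarrow> (nat \<Rightarrow> 'm) \<Rightarrow> (nat \<Rightarrow> 'n) \<Rightarrow> ('m \<times> 'n \<Rightarrow>\<^sub>0 int) set" where
  "tensor_sum k R M N n x y = (\<Oplus>\<^bsub>tensor k R M N\<^esub>l\<in>{..<n}. pure_tensor k R M N (x l) (y l))"

definition is_dual_basis ::
  "'k ring \<Rightarrow> ('k, 'r) module \<Rightarrow> ('k, 'l, 'r, 'm) bimodule
    \<Rightarrow> ('m \<times> ('m \<Rightarrow> 'r) \<Rightarrow>\<^sub>0 int) set \<Rightarrow> bool" where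
  "is_dual_basis k R M E \<longleftrightarrow> (\<exists>n z z'.
     z \<in> {..<n} \<rightarrow> carrier M \<and> z' \<in> {..<n} \<rightarrow> carrier (dual R M) \<and>
     E = tensor_sum k R M (dual R M) n z z' \<and>
     (\<forall>x\<in>carrier M. x = (\<Oplus>\<^bsub>M\<^esub>l\<in>{..<n}. z l \<triangleleft>\<^bsub>M\<^esub> z' l x)) \<and>
     (\<forall>\<phi>\<in>carrier (dual R M). \<phi> = (\<Oplus>\<^bsub>dual R M\<^esub>l\<in>{..<n}. \<phi> (z l) \<triangleright>\<^bsub>dual R M\<^esub> z' l)))"

definition finite_dual_basis ::
  "'k ring \<Rightarrow> ('k, 'r) module \<Rightarrow> ('k, 'l, 'r, 'm) bimodule \<Rightarrow> ('m \<times> ('m \<Rightarrow> 'r) \<Rightarrow>\<^sub>0 int) set" where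
  "finite_dual_basis k R M = (THE E. is_dual_basis k R M E)"

text \<open>For an idempotent \<open>b\<close>, the module \<open>b P\<close> with its inclusion \<open>\<sigma>\<close> into
  and projection \<open>\<tau>\<close> from \<open>P\<close>. The record inherits the left action from \<open>P\<close>; only \<open>b B b\<close> acts on \<open>b P\<close>.\<close>

definition local_part :: "('k, 'b, 'a, 'p) bimodule \<Rightarrow> 'b \<Rightarrow> ('k, 'b, 'a, 'p) bimodule" where
  "local_part P b = P\<lparr>carrier := (\<lambda>p. b \<triangleright>\<^bsub>P\<^esub> p) ` carrier P\<rparr>"

definition local_incl :: "('k, 'b, 'a, 'p) bimodule \<Rightarrow> 'b \<Rightarrow> 'p \<Rightarrow> 'p" where
  "local_incl P b = (\<lambda>p\<in>carrier (local_part P b). p)"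

definition local_proj :: "('k, 'b, 'a, 'p) bimodule \<Rightarrow> 'b \<Rightarrow> 'p \<Rightarrow> 'p" where
  "local_proj P b = (\<lambda>p\<in>carrier P. b \<triangleright>\<^bsub>P\<^esub> p)"

definition dagger ::
  "('k, 'a) module \<Rightarrow> 'i set \<Rightarrow> ('i \<Rightarrow> 'b) \<Rightarrow> ('k, 'b, 'a, 'p) bimodule
    \<Rightarrow> ('k, 'a, 'b, 'p \<Rightarrow> 'a) bimodule" where
  "dagger A I e P = (dual A P)\<lparr>carrier := {\<phi> \<in> carrier (dual A P). \<exists>i\<in>I.
     \<phi> = compose (carrier P) (compose (carrier (local_part P (e i))) \<phi> (local_incl P (e i)))
            (local_proj P (e i))}\<rparr>"

definition comatrix ::
  "'k ring \<Rightarrow> ('k, 'a) module \<Rightarrow> ('k, 'b) module \<Rightarrow> 'i set \<Rightarrow> ('i \<Rightarrow> 'b)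
    \<Rightarrow> ('k, 'b, 'a, 'p) bimodule \<Rightarrow> ('k, 'a, 'a, (('p \<Rightarrow> 'a) \<times> 'p \<Rightarrow>\<^sub>0 int) set) bimodule" where
  "comatrix k A B I e P = tensor k B (dagger A I e P) P"

text \<open>The element \<open>(\<phi> \<circ> \<tau>\<^sub>i) \<otimes>\<^sub>B \<sigma>\<^sub>i(p)\<close> of \<open>P\<^sup>\<dagger> \<otimes>\<^sub>B P\<close>.\<close>

definition comatrix_elem ::
  "'k ring \<Rightarrow> ('k, 'a) module \<Rightarrow> ('k, 'b) module \<Rightarrow> 'i set \<Rightarrow> ('i \<Rightarrow> 'b)
    \<Rightarrow> ('k, 'b, 'a, 'p) bimodule \<Rightarrow> 'i \<Rightarrow> ('p \<Rightarrow> 'a) \<Rightarrow> 'p \<Rightarrow> (('p \<Rightarrow> 'a) \<times> 'p \<Rightarrow>\<^sub>0 int) set" where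
  "comatrix_elem k A B I e P i \<phi> p = pure_tensor k B (dagger A I e P) P
     (compose (carrier P) \<phi> (local_proj P (e i))) (local_incl P (e i) p)"

end

theory Submission
  imports Defs
begin

text \<open>
  Every element \<open>b\<close> of \<open>B\<close> can be written as \<open>b p = \<Sum> z\<^sub>l f\<^sub>l(p)\<close> for all \<open>p \<in> P\<close>, with finitely many
  \<open>z\<^sub>l \<in> P\<close> and \<open>f\<^sub>l \<in> P\<^sup>\<dagger>\<close>: for \<open>b = e\<^sub>i\<close> take a dual basis of the finitely generated projective module
  \<open>e\<^sub>i P\<close> and compose its functionals with \<open>\<tau>\<^sub>i\<close>; in general, multiply this by \<open>b\<close>, where \<open>e\<^sub>i\<close> is
  neutral for \<open>b\<close>. The element \<open>E(b) = \<Sum> z\<^sub>l \<otimes>\<^sub>A f\<^sub>l\<close> of \<open>P \<otimes>\<^sub>A P\<^sup>\<dagger>\<close> depends on \<open>b\<close> only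
  (\<open>represents_sum_unique\<close>), because the functionals of one family can be expanded in a dual basis at
  a larger local unit and the coefficients moved over the tensor sign. Consequently \<open>E\<close> is a map of
  \<open>B\<close>-bimodules, \<open>b E(c) = E(b c)\<close> and \<open>E(b) c = E(b c)\<close>.

  The comultiplication inserts \<open>E\<close> in the middle: \<open>\<Delta>(\<phi> \<otimes> p) = \<phi> \<otimes> E(b) \<otimes> p\<close> for any \<open>b\<close> with \<open>b p = p\<close>.
  Such \<open>b\<close> exists, even among the local units, since \<open>P\<close> is firm (\<open>local_unit_fixes\<close>). If \<open>e\<^sub>i\<close> is neutral
  for \<open>b\<close>, then \<open>\<phi> \<otimes> E(b) \<otimes> p = \<phi> \<otimes> E(e\<^sub>i) b \<otimes> p = \<phi> \<otimes> E(e\<^sub>i) \<otimes> b p\<close>, so that the choice of \<open>b\<close> does not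
  matter; and \<open>\<phi> b \<otimes> E(e\<^sub>i) \<otimes> p = \<phi> \<otimes> E(b) \<otimes> p = \<phi> \<otimes> E(e\<^sub>i) \<otimes> b p\<close> shows that \<open>\<Delta>\<close> is well defined on
  \<open>P\<^sup>\<dagger> \<otimes>\<^sub>B P\<close> (\<open>comult0_balanced\<close>). The counit is evaluation.

  Coassociativity holds because inserting \<open>E(e\<^sub>i)\<close> twice gives the same double sum in either order, and
  the counit axioms are the two identities \<open>\<Sum> z\<^sub>l f\<^sub>l(p) = e\<^sub>i p\<close> and \<open>\<Sum> \<phi>(z\<^sub>l) f\<^sub>l = \<phi> e\<^sub>i\<close>. Finally, the dual
  basis tensor of \<open>e\<^sub>i P\<close> is unique (\<open>dual_basis_tensor_unique\<close>), and the formula for \<open>\<Delta>\<close> is its image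
  under \<open>z \<otimes> z\<^sup>* \<mapsto> (\<phi> \<circ> \<tau>\<^sub>i \<otimes> z) \<otimes> (z\<^sup>* \<circ> \<tau>\<^sub>i \<otimes> p)\<close>; hence it holds for every way of writing this tensor as a
  sum.

  Two facts about tensor products carry the formal work: the universal property
  (\<open>tensor_universal\<close>) and the fact that tensor products of bimodules are bimodules
  (\<open>bimodule_tensor\<close>).
\<close>

section \<open>Additive maps and finite sums\<close>

abbreviation additive where
  "additive M N \<equiv> hom (add_monoid M) (add_monoid N)"

lemma additiveI:
  assumes "\<And>x. x \<in> carrier M \<Longrightarrow> h x \<in> carrier N"
    and "\<And>x y. x \<in> carrier M \<Longrightarrow> y \<in> carrier M \<Longrightarrow> h (x \<oplus>\<^bsub>M\<^esub> y) = h x \<oplus>\<^bsub>N\<^esub> h y"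
  shows "h \<in> additive M N"
  using assms by (intro homI) auto

lemma additive_closed: "h \<in> additive M N \<Longrightarrow> x \<in> carrier M \<Longrightarrow> h x \<in> carrier N"
  by (drule hom_in_carrier) auto

lemma additive_add:
  "h \<in> additive M N \<Longrightarrow> x \<in> carrier M \<Longrightarrow> y \<in> carrier M \<Longrightarrow> h (x \<oplus>\<^bsub>M\<^esub> y) = h x \<oplus>\<^bsub>N\<^esub> h y"
  by (drule hom_mult) auto

lemma additive_zero:
  assumes "abelian_group M" "abelian_group N" "h \<in> additive M N"
  shows "h \<zero>\<^bsub>M\<^esub> = \<zero>\<^bsub>N\<^esub>"
proof -
  interpret M: abelian_group M by fact
  interpret N: abelian_group N by fact
  show ?thesis
    using hom_one[OF assms(3) M.a_group N.a_group] by simp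
qed

lemma additive_sum:
  assumes "abelian_group Q" "f \<in> additive U Q" "g \<in> additive U Q"
  shows "(\<lambda>t. f t \<oplus>\<^bsub>Q\<^esub> g t) \<in> additive U Q"
proof -
  interpret Q: abelian_group Q by fact
  show ?thesis
    using assms(2,3)
    by (intro additiveI) (simp_all add: additive_closed[of _ U Q] additive_add[of _ U Q] Q.a_ac)
qed

lemma additive_comp: "f \<in> additive U V \<Longrightarrow> g \<in> additive V W \<Longrightarrow> (\<lambda>t. g (f t)) \<in> additive U W"
  by (rule additiveI) (simp_all add: additive_closed[of _ U V] additive_add[of _ U V]
     additive_closed[of _ V W] additive_add[of _ V W])

lemma additive_finsum:
  assumes M: "abelian_group M" and N: "abelian_group N" and h: "h \<in> additive M N"
    and g: "g \<in> S \<rightarrow> carrier M"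
  shows "h (\<Oplus>\<^bsub>M\<^esub>i\<in>S. g i) = (\<Oplus>\<^bsub>N\<^esub>i\<in>S. h (g i))"
proof -
  interpret M: abelian_group M by fact
  interpret N: abelian_group N by fact
  show ?thesis using g
  proof (induction S rule: infinite_finite_induct)
    case (infinite S)
    then show ?case using additive_zero[OF M N h] by (simp add: M.finsum_infinite N.finsum_infinite)
  next
    case empty
    then show ?case using additive_zero[OF M N h] by simp
  next
    case (insert x F)
    then show ?case
      using additive_add[OF h] additive_closed[OF h] by (simp add: Pi_iff)
  qed
qed

lemma (in abelian_group) finsum_swap:
  assumes "finite S" "finite T" "\<And>i j. i \<in> S \<Longrightarrow> j \<in> T \<Longrightarrow> f i j \<in> carrier G"
  shows "(\<Oplus>i\<in>S. \<Oplus>j\<in>T. f i j) = (\<Oplus>j\<in>T. \<Oplus>i\<in>S. f i j)"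
  using assms(1,3)
proof (induction S rule: finite_induct)
  case empty
  then show ?case by simp
next
  case (insert x F)
  have *: "(\<lambda>i. \<Oplus>j\<in>T. f i j) \<in> F \<rightarrow> carrier G" "(\<Oplus>j\<in>T. f x j) \<in> carrier G"
    "(\<lambda>j. f x j) \<in> T \<rightarrow> carrier G" "(\<lambda>j. \<Oplus>i\<in>F. f i j) \<in> T \<rightarrow> carrier G"
    using insert.prems by (auto intro!: finsum_closed)
  have "(\<Oplus>i\<in>insert x F. \<Oplus>j\<in>T. f i j) = (\<Oplus>j\<in>T. f x j \<oplus> (\<Oplus>i\<in>F. f i j))"
    using insert * by (simp add: finsum_addf)
  also have "\<dots> = (\<Oplus>j\<in>T. \<Oplus>i\<in>insert x F. f i j)"
    using insert by (intro finsum_cong') (auto intro!: finsum_closed simp: finsum_insert Pi_iff)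
  finally show ?case .
qed

section \<open>Balanced maps and the universal property of the tensor product\<close>

definition balanced ::
  "'k ring \<Rightarrow> ('k, 'r) module \<Rightarrow> ('k, 'l, 'r, 'm) bimodule \<Rightarrow> ('k, 'r, 's, 'n) bimodule
    \<Rightarrow> ('q, 'z) ring_scheme \<Rightarrow> ('m \<Rightarrow> 'n \<Rightarrow> 'q) \<Rightarrow> bool" where
  "balanced k R M N Q f \<longleftrightarrow>
     (\<forall>x\<in>carrier M. f x \<in> additive N Q) \<and>
     (\<forall>y\<in>carrier N. (\<lambda>x. f x y) \<in> additive M Q) \<and>
     (\<forall>x\<in>carrier M. \<forall>a\<in>carrier R. \<forall>y\<in>carrier N. f (x \<triangleleft>\<^bsub>M\<^esub> a) y = f x (a \<triangleright>\<^bsub>N\<^esub> y)) \<and>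
     (\<forall>c\<in>carrier k. \<forall>x\<in>carrier M. \<forall>y\<in>carrier N. f (c \<odot>\<^bsub>M\<^esub> x) y = f x (c \<odot>\<^bsub>N\<^esub> y))"

lemma balancedI:
  assumes "\<And>x y. x \<in> carrier M \<Longrightarrow> y \<in> carrier N \<Longrightarrow> f x y \<in> carrier Q"
    and "\<And>x x' y. x \<in> carrier M \<Longrightarrow> x' \<in> carrier M \<Longrightarrow> y \<in> carrier N
      \<Longrightarrow> f (x \<oplus>\<^bsub>M\<^esub> x') y = f x y \<oplus>\<^bsub>Q\<^esub> f x' y"
    and "\<And>x y y'. x \<in> carrier M \<Longrightarrow> y \<in> carrier N \<Longrightarrow> y' \<in> carrier N
      \<Longrightarrow> f x (y \<oplus>\<^bsub>N\<^esub> y') = f x y \<oplus>\<^bsub>Q\<^esub> f x y'"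
    and "\<And>x a y. x \<in> carrier M \<Longrightarrow> a \<in> carrier R \<Longrightarrow> y \<in> carrier N
      \<Longrightarrow> f (x \<triangleleft>\<^bsub>M\<^esub> a) y = f x (a \<triangleright>\<^bsub>N\<^esub> y)"
    and "\<And>x c y. x \<in> carrier M \<Longrightarrow> c \<in> carrier k \<Longrightarrow> y \<in> carrier N
      \<Longrightarrow> f (c \<odot>\<^bsub>M\<^esub> x) y = f x (c \<odot>\<^bsub>N\<^esub> y)"
  shows "balanced k R M N Q f"
  using assms by (auto simp: balanced_def intro!: additiveI)

lemma balancedD:
  assumes "balanced k R M N Q f"
  shows "x \<in> carrier M \<Longrightarrow> f x \<in> additive N Q"
    and "y \<in> carrier N \<Longrightarrow> (\<lambda>x. f x y) \<in> additive M Q"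
    and "x \<in> carrier M \<Longrightarrow> a \<in> carrier R \<Longrightarrow> y \<in> carrier N
      \<Longrightarrow> f (x \<triangleleft>\<^bsub>M\<^esub> a) y = f x (a \<triangleright>\<^bsub>N\<^esub> y)"
    and "x \<in> carrier M \<Longrightarrow> c \<in> carrier k \<Longrightarrow> y \<in> carrier N
      \<Longrightarrow> f (c \<odot>\<^bsub>M\<^esub> x) y = f x (c \<odot>\<^bsub>N\<^esub> y)"
  using assms by (auto simp: balanced_def)

lemma balanced_closed:
  "balanced k R M N Q f \<Longrightarrow> x \<in> carrier M \<Longrightarrow> y \<in> carrier N \<Longrightarrow> f x y \<in> carrier Q"
  by (rule additive_closed[of "f x" N Q]) (auto dest: balancedD(1))

lemma balanced_add_left:
  "balanced k R M N Q f \<Longrightarrow> x \<in> carrier M \<Longrightarrow> x' \<in> carrier M \<Longrightarrow> y \<in> carrier N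
    \<Longrightarrow> f (x \<oplus>\<^bsub>M\<^esub> x') y = f x y \<oplus>\<^bsub>Q\<^esub> f x' y"
  by (rule additive_add[of "\<lambda>x. f x y" M Q]) (auto dest: balancedD(2))

lemma balanced_add_right:
  "balanced k R M N Q f \<Longrightarrow> x \<in> carrier M \<Longrightarrow> y \<in> carrier N \<Longrightarrow> y' \<in> carrier N
    \<Longrightarrow> f x (y \<oplus>\<^bsub>N\<^esub> y') = f x y \<oplus>\<^bsub>Q\<^esub> f x y'"
  by (rule additive_add[of "f x" N Q]) (auto dest: balancedD(1))

text \<open>The module \<open>e\<^sub>i P\<close> is not stable under \<open>B\<close>, but its tensor product over \<open>A\<close> with its dual
  has to be formed. So the theory of the tensor product is developed from the closure properties
  alone that make the generators of \<^const>\<open>tensor_rels\<close> elements of the free group.\<close>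

locale tensor_pair =
  fixes k :: "'k ring" and R :: "('k, 'r) module"
    and M :: "('k, 'l, 'r, 'm) bimodule" and N :: "('k, 'r, 's, 'n) bimodule"
  assumes grp_M: "abelian_group M" and grp_N: "abelian_group N"
    and act_M: "\<And>x a. x \<in> carrier M \<Longrightarrow> a \<in> carrier R \<Longrightarrow> x \<triangleleft>\<^bsub>M\<^esub> a \<in> carrier M"
    and act_N: "\<And>y a. y \<in> carrier N \<Longrightarrow> a \<in> carrier R \<Longrightarrow> a \<triangleright>\<^bsub>N\<^esub> y \<in> carrier N"
    and smult_M: "\<And>x c. x \<in> carrier M \<Longrightarrow> c \<in> carrier k \<Longrightarrow> c \<odot>\<^bsub>M\<^esub> x \<in> carrier M"
    and smult_N: "\<And>y c. y \<in> carrier N \<Longrightarrow> c \<in> carrier k \<Longrightarrow> c \<odot>\<^bsub>N\<^esub> y \<in> carrier N"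
begin

abbreviation "F \<equiv> pairs_group M N"
abbreviation "H \<equiv> tensor_rels k R M N"
abbreviation "T \<equiv> tensor k R M N"
abbreviation "pure \<equiv> pure_tensor k R M N"

sublocale M: abelian_group M by (rule grp_M)
sublocale N: abelian_group N by (rule grp_N)
sublocale F: comm_group F by (rule abelian_free_Abelian_group)

definition relators :: "('m \<times> 'n \<Rightarrow>\<^sub>0 int) set" where
  "relators =
    {frag_of (x \<oplus>\<^bsub>M\<^esub> x', y) - frag_of (x, y) - frag_of (x', y) | x x' y.
        x \<in> carrier M \<and> x' \<in> carrier M \<and> y \<in> carrier N} \<union>
     {frag_of (x, y \<oplus>\<^bsub>N\<^esub> y') - frag_of (x, y) - frag_of (x, y') | x y y'.
        x \<in> carrier M \<and> y \<in> carrier N \<and> y' \<in> carrier N} \<union>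
     {frag_of (x \<triangleleft>\<^bsub>M\<^esub> a, y) - frag_of (x, a \<triangleright>\<^bsub>N\<^esub> y) | x a y.
        x \<in> carrier M \<and> a \<in> carrier R \<and> y \<in> carrier N} \<union>
     {frag_of (c \<odot>\<^bsub>M\<^esub> x, y) - frag_of (x, c \<odot>\<^bsub>N\<^esub> y) | c x y.
        c \<in> carrier k \<and> x \<in> carrier M \<and> y \<in> carrier N}"

lemma rels_eq: "H = generate F relators"
  by (simp add: tensor_rels_def relators_def)

lemma diff_in_F: "u \<in> carrier F \<Longrightarrow> v \<in> carrier F \<Longrightarrow> u - v \<in> carrier F"
  using keys_diff[of u v] by auto

lemma add_in_F: "u \<in> carrier F \<Longrightarrow> v \<in> carrier F \<Longrightarrow> u + v \<in> carrier F"
  using keys_add[of u v] by auto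

lemma relators_closed: "relators \<subseteq> carrier F"
  unfolding relators_def using act_M act_N smult_M smult_N M.a_closed N.a_closed
  by (auto simp del: carrier_free_Abelian_group_iff intro!: diff_in_F)

lemma normal_rels: "H \<lhd> F"
  unfolding rels_eq using F.generate_is_subgroup[OF relators_closed] F.subgroup_imp_normal by blast

sublocale H: normal H F by (rule normal_rels)

lemma tensor_sel:
  "carrier T = carrier (F Mod H)" "s \<oplus>\<^bsub>T\<^esub> t = s \<otimes>\<^bsub>F Mod H\<^esub> t" "\<zero>\<^bsub>T\<^esub> = \<one>\<^bsub>F Mod H\<^esub>"
  by (simp_all add: tensor_def FactGroup_def)

lemma abelian_tensor: "abelian_group T"
proof -
  interpret Q: comm_group "F Mod H" by (rule F.abelian_FactGroup[OF H.subgroup_axioms])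
  show ?thesis
  proof (rule abelian_groupI, unfold tensor_sel)
    show "\<exists>y\<in>carrier (F Mod H). y \<otimes>\<^bsub>F Mod H\<^esub> x = \<one>\<^bsub>F Mod H\<^esub>" if "x \<in> carrier (F Mod H)" for x
      using that by (rule Q.l_inv_ex)
  qed (rule Q.m_closed Q.one_closed Q.m_assoc Q.m_comm Q.l_one; assumption)+
qed

sublocale T: abelian_group T by (rule abelian_tensor)

abbreviation coset :: "('m \<times> 'n \<Rightarrow>\<^sub>0 int) \<Rightarrow> ('m \<times> 'n \<Rightarrow>\<^sub>0 int) set" where
  "coset c \<equiv> H #>\<^bsub>F\<^esub> c"

lemma coset_hom: "coset \<in> hom F (add_monoid T)"
  using H.r_coset_hom_Mod by (auto simp: hom_def tensor_sel)

lemma coset_closed: "c \<in> carrier F \<Longrightarrow> coset c \<in> carrier T"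
  using hom_in_carrier[OF coset_hom] by simp

lemma coset_surj: "t \<in> carrier T \<Longrightarrow> \<exists>c\<in>carrier F. t = coset c"
  by (auto simp: tensor_sel carrier_FactGroup)

lemma coset_add: "c \<in> carrier F \<Longrightarrow> d \<in> carrier F \<Longrightarrow> coset (c + d) = coset c \<oplus>\<^bsub>T\<^esub> coset d"
  using hom_mult[OF coset_hom, of c d] by simp

lemma coset_eq:
  assumes "c \<in> carrier F" "d \<in> carrier F" "c - d \<in> H"
  shows "coset c = coset d"
proof -
  have cd: "c - d \<in> carrier F" using assms(3) H.subset by blast
  have "coset ((c - d) \<otimes>\<^bsub>F\<^esub> d) = coset (c - d) #>\<^bsub>F\<^esub> d"
    using F.coset_mult_assoc[OF H.subset cd assms(2)] by simp
  also have "coset (c - d) = H"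
    by (rule F.coset_join2[OF cd H.subgroup_axioms assms(3)])
  finally show ?thesis by simp
qed

lemma pure_closed: "x \<in> carrier M \<Longrightarrow> y \<in> carrier N \<Longrightarrow> pure x y \<in> carrier T"
  unfolding pure_tensor_def by (rule coset_closed) simp

lemma relator_in_rels:
  "x \<in> carrier M \<Longrightarrow> x' \<in> carrier M \<Longrightarrow> y \<in> carrier N
    \<Longrightarrow> frag_of (x \<oplus>\<^bsub>M\<^esub> x', y) - frag_of (x, y) - frag_of (x', y) \<in> H"
  "x \<in> carrier M \<Longrightarrow> y \<in> carrier N \<Longrightarrow> y' \<in> carrier N
    \<Longrightarrow> frag_of (x, y \<oplus>\<^bsub>N\<^esub> y') - frag_of (x, y) - frag_of (x, y') \<in> H"
  "x \<in> carrier M \<Longrightarrow> a \<in> carrier R \<Longrightarrow> y \<in> carrier N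
    \<Longrightarrow> frag_of (x \<triangleleft>\<^bsub>M\<^esub> a, y) - frag_of (x, a \<triangleright>\<^bsub>N\<^esub> y) \<in> H"
  "x \<in> carrier M \<Longrightarrow> c \<in> carrier k \<Longrightarrow> y \<in> carrier N
    \<Longrightarrow> frag_of (c \<odot>\<^bsub>M\<^esub> x, y) - frag_of (x, c \<odot>\<^bsub>N\<^esub> y) \<in> H"
  unfolding rels_eq
     apply (rule generate.incl, unfold relators_def)
     apply (rule UnI1, rule UnI1, rule UnI1, rule CollectI, intro exI conjI, rule refl, assumption+)
    apply (rule generate.incl, rule UnI1, rule UnI1, rule UnI2, rule CollectI, intro exI conjI, rule refl, assumption+)
   apply (rule generate.incl, rule UnI1, rule UnI2, rule CollectI, intro exI conjI, rule refl, assumption+)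
  apply (rule generate.incl, rule UnI2, rule CollectI, intro exI conjI, rule refl, assumption+)
  done

lemma pure_balanced: "balanced k R M N T pure"
proof (rule balancedI)
  fix x x' y assume *: "x \<in> carrier M" "x' \<in> carrier M" "y \<in> carrier N"
  have "coset (frag_of (x \<oplus>\<^bsub>M\<^esub> x', y)) = coset (frag_of (x, y) + frag_of (x', y))"
    using * relator_in_rels(1)[OF *] by (intro coset_eq add_in_F) (auto simp: diff_diff_eq)
  then show "pure (x \<oplus>\<^bsub>M\<^esub> x') y = pure x y \<oplus>\<^bsub>T\<^esub> pure x' y"
    using * by (simp add: pure_tensor_def coset_add)
next
  fix x y y' assume *: "x \<in> carrier M" "y \<in> carrier N" "y' \<in> carrier N"
  have "coset (frag_of (x, y \<oplus>\<^bsub>N\<^esub> y')) = coset (frag_of (x, y) + frag_of (x, y'))"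
    using * relator_in_rels(2)[OF *] by (intro coset_eq add_in_F) (auto simp: diff_diff_eq)
  then show "pure x (y \<oplus>\<^bsub>N\<^esub> y') = pure x y \<oplus>\<^bsub>T\<^esub> pure x y'"
    using * by (simp add: pure_tensor_def coset_add)
next
  fix x a y assume *: "x \<in> carrier M" "a \<in> carrier R" "y \<in> carrier N"
  show "pure (x \<triangleleft>\<^bsub>M\<^esub> a) y = pure x (a \<triangleright>\<^bsub>N\<^esub> y)"
    unfolding pure_tensor_def using * relator_in_rels(3)[OF *]
    by (intro coset_eq) (auto simp: act_M act_N)
next
  fix x c y assume *: "x \<in> carrier M" "c \<in> carrier k" "y \<in> carrier N"
  show "pure (c \<odot>\<^bsub>M\<^esub> x) y = pure x (c \<odot>\<^bsub>N\<^esub> y)"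
    unfolding pure_tensor_def using * relator_in_rels(4)[OF *]
    by (intro coset_eq) (auto simp: smult_M smult_N)
qed (rule pure_closed)

lemmas pure_add_left = balanced_add_left[OF pure_balanced]
  and pure_add_right = balanced_add_right[OF pure_balanced]
  and pure_middle = balancedD(3)[OF pure_balanced]
  and pure_smult = balancedD(4)[OF pure_balanced]
  and pure_additive_right = balancedD(1)[OF pure_balanced]
  and pure_additive_left = balancedD(2)[OF pure_balanced]

lemma pure_minus:
  assumes "x \<in> carrier M" "y \<in> carrier N"
  shows "\<ominus>\<^bsub>T\<^esub> pure x y = pure (\<ominus>\<^bsub>M\<^esub> x) y"
proof (rule T.minus_equality)
  have "pure (\<ominus>\<^bsub>M\<^esub> x) y \<oplus>\<^bsub>T\<^esub> pure x y = pure \<zero>\<^bsub>M\<^esub> y"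
    using assms by (simp add: M.l_neg flip: pure_add_left)
  then show "pure (\<ominus>\<^bsub>M\<^esub> x) y \<oplus>\<^bsub>T\<^esub> pure x y = \<zero>\<^bsub>T\<^esub>"
    using additive_zero[OF grp_M abelian_tensor pure_additive_left] assms by simp
qed (use assms in \<open>auto intro: pure_closed\<close>)

text \<open>Sums of pure tensors suffice because \<open>- (x \<otimes> y) = (- x) \<otimes> y\<close>.\<close>

lemma tensor_induct [consumes 1, case_names pure add]:
  assumes t: "t \<in> carrier T"
    and pure: "\<And>x y. x \<in> carrier M \<Longrightarrow> y \<in> carrier N \<Longrightarrow> Q (pure x y)"
    and add: "\<And>s t. s \<in> carrier T \<Longrightarrow> t \<in> carrier T \<Longrightarrow> Q s \<Longrightarrow> Q t \<Longrightarrow> Q (s \<oplus>\<^bsub>T\<^esub> t)"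
  shows "Q t"
proof -
  have Q0: "Q \<zero>\<^bsub>T\<^esub>"
    using pure[of "\<zero>\<^bsub>M\<^esub>" "\<zero>\<^bsub>N\<^esub>"]
      additive_zero[OF grp_M abelian_tensor pure_additive_left[of "\<zero>\<^bsub>N\<^esub>"]] by simp
  \<comment> \<open>The free group is generated under subtraction, so the sign has to be carried along.\<close>
  have "Q (coset c) \<and> Q (\<ominus>\<^bsub>T\<^esub> coset c)" if "Poly_Mapping.keys c \<subseteq> carrier M \<times> carrier N" for c
    using that
  proof (induction c rule: free_Abelian_group_induct[consumes 1, case_names zero diff gen])
    case zero
    have "coset 0 = \<zero>\<^bsub>T\<^esub>" using hom_one[OF coset_hom F.is_group T.a_group] by simp
    moreover have "\<ominus>\<^bsub>T\<^esub> \<zero>\<^bsub>T\<^esub> = \<zero>\<^bsub>T\<^esub>" by (rule T.minus_equality) auto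
    ultimately show ?case using Q0 by metis
  next
    case (diff c d)
    have cd: "coset c \<in> carrier T" "coset d \<in> carrier T" "coset (c - d) \<in> carrier T"
      using diff(1,2) diff_in_F[of c d] by (auto intro!: coset_closed)
    have "coset c = coset (c - d) \<oplus>\<^bsub>T\<^esub> coset d"
      using diff(1,2) diff_in_F[of c d] by (subst coset_add[symmetric]) auto
    then have eq: "coset (c - d) = coset c \<oplus>\<^bsub>T\<^esub> (\<ominus>\<^bsub>T\<^esub> coset d)"
      using cd by (simp add: T.a_assoc T.r_neg)
    show ?case unfolding eq using cd diff(3,4)
      by (auto simp: T.minus_add T.minus_minus intro!: add)
  next
    case (gen a)
    then show ?case using pure pure_minus by (auto simp: pure_tensor_def split_paired_all)
  qed
  then show ?thesis using coset_surj[OF t] by auto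
qed

lemma additive_eqI:
  assumes "g \<in> additive T Q" "h \<in> additive T Q"
    and "\<And>x y. x \<in> carrier M \<Longrightarrow> y \<in> carrier N \<Longrightarrow> g (pure x y) = h (pure x y)"
    and "t \<in> carrier T"
  shows "g t = h t"
  using assms(4) by (induction rule: tensor_induct) (auto simp: assms(3) additive_add[OF assms(1)] additive_add[OF assms(2)])

text \<open>The additive extension of a balanced map to the free group kills the generators of
  \<^const>\<open>tensor_rels\<close>, hence factors through the quotient.\<close>

lemma tensor_universal:
  assumes Q: "abelian_group Q" and f: "balanced k R M N Q f"
  shows "\<exists>h. h \<in> additive T Q \<and> (\<forall>x\<in>carrier M. \<forall>y\<in>carrier N. h (pure x y) = f x y)"
proof -
  interpret Q: abelian_group Q by fact
  obtain u where u: "u \<in> hom F (add_monoid Q)"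
    and uf: "\<And>z. z \<in> carrier M \<times> carrier N \<Longrightarrow> u (frag_of z) = (\<lambda>(x, y). f x y) z"
    by (rule comm_group.free_Abelian_group_universal[OF Q.a_comm_group, of "\<lambda>(x, y). f x y" "carrier M \<times> carrier N"])
       (use balanced_closed[OF f] in auto)
  interpret u: group_hom F "add_monoid Q" u
    using u by (intro group_hom.intro) (auto simp: group_hom_axioms_def Q.a_group)
  have diff: "u (c - d) = u c \<ominus>\<^bsub>Q\<^esub> u d" if "c \<in> carrier F" "d \<in> carrier F" for c d
  proof -
    have "u (c \<otimes>\<^bsub>F\<^esub> inv\<^bsub>F\<^esub> d) = u c \<ominus>\<^bsub>Q\<^esub> u d"
      using that by (simp only: u.hom_mult F.inv_closed u.hom_inv a_minus_def a_inv_def) simp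
    then show ?thesis using that by simp
  qed
  have uf': "u (frag_of (x, y)) = f x y" if "x \<in> carrier M" "y \<in> carrier N" for x y
    using that uf[of "(x, y)"] by simp
  have dF: "frag_of (x, y) - frag_of (x', y') \<in> carrier F"
    if "x \<in> carrier M" "y \<in> carrier N" "x' \<in> carrier M" "y' \<in> carrier N" for x y x' y'
    using that by (intro diff_in_F) auto
  have cl: "\<And>x y. x \<in> carrier M \<Longrightarrow> y \<in> carrier N \<Longrightarrow> f x y \<in> carrier Q"
    by (rule balanced_closed[OF f])
  have fr: "frag_of (x, y) \<in> carrier F" if "x \<in> carrier M" "y \<in> carrier N" for x y
    using that by simp
  have cancel: "s \<ominus>\<^bsub>Q\<^esub> a \<ominus>\<^bsub>Q\<^esub> b = \<zero>\<^bsub>Q\<^esub>"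
    if "s = a \<oplus>\<^bsub>Q\<^esub> b" "a \<in> carrier Q" "b \<in> carrier Q" for s a b
  proof -
    have "s = b \<oplus>\<^bsub>Q\<^esub> a" using that Q.a_comm by simp
    then show ?thesis using that(2,3) by (simp add: a_minus_def Q.a_assoc Q.r_neg)
  qed
  have cancel1: "a \<ominus>\<^bsub>Q\<^esub> b = \<zero>\<^bsub>Q\<^esub>" if "a = b" "b \<in> carrier Q" for a b
    using that by (simp add: a_minus_def Q.r_neg)
  have "relators \<subseteq> kernel F (add_monoid Q) u"
  proof
    fix r assume r: "r \<in> relators"
    then consider
      x x' y where "r = frag_of (x \<oplus>\<^bsub>M\<^esub> x', y) - frag_of (x, y) - frag_of (x', y)"
        "x \<in> carrier M" "x' \<in> carrier M" "y \<in> carrier N"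
      | x y y' where "r = frag_of (x, y \<oplus>\<^bsub>N\<^esub> y') - frag_of (x, y) - frag_of (x, y')"
        "x \<in> carrier M" "y \<in> carrier N" "y' \<in> carrier N"
      | x a y where "r = frag_of (x \<triangleleft>\<^bsub>M\<^esub> a, y) - frag_of (x, a \<triangleright>\<^bsub>N\<^esub> y)"
        "x \<in> carrier M" "a \<in> carrier R" "y \<in> carrier N"
      | c x y where "r = frag_of (c \<odot>\<^bsub>M\<^esub> x, y) - frag_of (x, c \<odot>\<^bsub>N\<^esub> y)"
        "x \<in> carrier M" "c \<in> carrier k" "y \<in> carrier N"
      unfolding relators_def by blast
    then have "u r = \<zero>\<^bsub>Q\<^esub>"
    proof cases
      case 1
      then show ?thesis
        by (simp only: diff dF fr uf' M.a_closed) (rule cancel, auto simp: balanced_add_left[OF f] cl)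
    next
      case 2
      then show ?thesis
        by (simp only: diff dF fr uf' N.a_closed) (rule cancel, auto simp: balanced_add_right[OF f] cl)
    next
      case 3
      then show ?thesis
        by (simp only: diff fr uf' act_M act_N) (rule cancel1, auto simp: balancedD(3)[OF f] cl act_N)
    next
      case 4
      then show ?thesis
        by (simp only: diff fr uf' smult_M smult_N) (rule cancel1, auto simp: balancedD(4)[OF f] cl smult_N)
    qed
    then show "r \<in> kernel F (add_monoid Q) u"
      using subsetD[OF relators_closed r] by (simp add: kernel_def)
  qed
  then have ker: "H \<subseteq> kernel F (add_monoid Q) u"
    unfolding rels_eq by (rule F.generate_subgroup_incl[OF _ u.subgroup_kernel])
  have "\<And>c d. c \<in> carrier F \<Longrightarrow> d \<in> carrier F \<Longrightarrow> coset c = coset d \<Longrightarrow> u c = u d"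
  proof -
    fix c d assume *: "c \<in> carrier F" "d \<in> carrier F" "coset c = coset d"
    then obtain h where "h \<in> H" "c = h \<otimes>\<^bsub>F\<^esub> d"
      using F.rcos_self[of c H] H.subgroup_axioms by (auto simp: r_coset_def)
    then show "u c = u d" using * ker u.hom_mult[of h d] u.hom_closed[of d]
      by (auto simp: kernel_def)
  qed
  then obtain h where h: "h \<in> hom (F Mod H) (add_monoid Q)"
    "\<And>c. c \<in> carrier F \<Longrightarrow> h (coset c) = u c"
    using FactGroup_universal[OF u normal_rels] by metis
  show ?thesis
    using h by (intro exI[of _ h]) (auto simp: hom_def tensor_sel pure_tensor_def uf')
qed

lemma tensor_lift:
  assumes Q: "abelian_group Q" and f: "balanced k R M N Q f"
  shows tensor_lift_additive: "tensor_lift k R M N Q f \<in> additive T Q"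
    and tensor_lift_pure: "\<And>x y. x \<in> carrier M \<Longrightarrow> y \<in> carrier N
      \<Longrightarrow> tensor_lift k R M N Q f (pure x y) = f x y"
proof -
  let ?P = "\<lambda>h. h \<in> extensional (carrier T) \<and> h \<in> additive T Q \<and>
     (\<forall>x\<in>carrier M. \<forall>y\<in>carrier N. h (pure x y) = f x y)"
  obtain h where h: "h \<in> additive T Q" "\<forall>x\<in>carrier M. \<forall>y\<in>carrier N. h (pure x y) = f x y"
    using tensor_universal[OF assms] by blast
  have "restrict h (carrier T) \<in> additive T Q"
    by (rule additiveI) (simp_all add: additive_closed[OF h(1)] additive_add[OF h(1)])
  then have "?P (restrict h (carrier T))"
    using h(2) pure_closed by simp
  moreover have "g = g'" if "?P g" "?P g'" for g g'
  proof (rule extensionalityI)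
    show "g \<in> extensional (carrier T)" "g' \<in> extensional (carrier T)" using that by blast+
    show "g t = g' t" if "t \<in> carrier T" for t
      using additive_eqI[of g Q g' t] that \<open>?P g\<close> \<open>?P g'\<close> by metis
  qed
  ultimately have "?P (tensor_lift k R M N Q f)"
    unfolding tensor_lift_def by (intro theI[of ?P "restrict h (carrier T)"]) blast+
  then show "tensor_lift k R M N Q f \<in> additive T Q"
    "\<And>x y. x \<in> carrier M \<Longrightarrow> y \<in> carrier N \<Longrightarrow> tensor_lift k R M N Q f (pure x y) = f x y"
    by auto
qed

text \<open>By definition \<^const>\<open>tensor_act\<close> maps a coset elementwise and saturates the result. This is again
  a single coset, and so a well defined map, as soon as \<^const>\<open>tensor_rels\<close> is mapped into itself;
  the latter holds because the universal property gives a map that agrees on all cosets.\<close>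

lemma tensor_act:
  assumes f: "\<And>x. x \<in> carrier M \<Longrightarrow> f x \<in> carrier M"
    and g: "\<And>y. y \<in> carrier N \<Longrightarrow> g y \<in> carrier N"
    and bal: "balanced k R M N T (\<lambda>x y. pure (f x) (g y))"
  shows tensor_act_additive: "tensor_act k R M N f g \<in> additive T T"
    and tensor_act_pure: "\<And>x y. x \<in> carrier M \<Longrightarrow> y \<in> carrier N
      \<Longrightarrow> tensor_act k R M N f g (pure x y) = pure (f x) (g y)"
proof -
  let ?E = "frag_extend (\<lambda>(x, y). frag_of (f x, g y))"
  obtain h where h: "h \<in> additive T T" "\<forall>x\<in>carrier M. \<forall>y\<in>carrier N. h (pure x y) = pure (f x) (g y)"
    using tensor_universal[OF abelian_tensor bal] by blast
  have E: "?E c \<in> carrier F" if "c \<in> carrier F" for c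
  proof -
    have "Poly_Mapping.keys (case z of (x, y) \<Rightarrow> frag_of (f x, g y)) \<subseteq> carrier M \<times> carrier N"
      if "z \<in> Poly_Mapping.keys c" for z
      using that \<open>c \<in> carrier F\<close> f g by (cases z) auto
    then show ?thesis
      using keys_frag_extend[of "\<lambda>(x, y). frag_of (f x, g y)" c]
      by (simp only: carrier_free_Abelian_group_iff) blast
  qed
  have hc: "coset (?E c) = h (coset c)" if "Poly_Mapping.keys c \<subseteq> carrier M \<times> carrier N" for c
    using that
  proof (induction c rule: free_Abelian_group_induct[consumes 1, case_names zero diff gen])
    case zero
    have "coset 0 = \<zero>\<^bsub>T\<^esub>" using hom_one[OF coset_hom F.is_group T.a_group] by simp
    then show ?case using additive_zero[OF abelian_tensor abelian_tensor h(1)] by simp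
  next
    case (diff c d)
    have F: "c \<in> carrier F" "d \<in> carrier F" "c - d \<in> carrier F" using diff(1,2) diff_in_F[of c d] by auto
    have "coset (?E (c - d)) \<oplus>\<^bsub>T\<^esub> coset (?E d) = coset (?E (c - d) + ?E d)"
      by (rule coset_add[symmetric, OF E[OF F(3)] E[OF F(2)]])
    also have "?E (c - d) + ?E d = ?E c" by (simp flip: frag_extend_add)
    finally have "coset (?E (c - d)) \<oplus>\<^bsub>T\<^esub> coset (?E d) = coset (?E c)" .
    moreover have "h (coset (c - d)) \<oplus>\<^bsub>T\<^esub> h (coset d) = h (coset (c - d) \<oplus>\<^bsub>T\<^esub> coset d)"
      by (rule additive_add[symmetric, OF h(1) coset_closed[OF F(3)] coset_closed[OF F(2)]])
    moreover have "coset (c - d) \<oplus>\<^bsub>T\<^esub> coset d = coset c"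
      using coset_add[OF F(3,2)] by simp
    ultimately show ?case using F diff(3,4)
      by (metis E T.add.right_cancel additive_closed[OF h(1)] coset_closed)
  next
    case (gen a)
    then show ?case using h(2) by (auto simp: pure_tensor_def)
  qed
  have EH: "?E c \<in> H" if "c \<in> H" for c
  proof -
    have "c \<in> carrier F" using that H.subset by blast
    then have "coset (?E c) = h (coset c)" using hc by simp
    also have "coset c = H" using that \<open>c \<in> carrier F\<close> by (simp add: F.coset_join2 H.subgroup_axioms)
    also have "h H = H" using additive_zero[OF abelian_tensor abelian_tensor h(1)] by (simp add: tensor_def)
    finally show ?thesis using E[OF \<open>c \<in> carrier F\<close>] H.subgroup_axioms F.coset_join1 H.subset by blast
  qed
  have act: "tensor_act k R M N f g t = h t" if "t \<in> carrier T" for t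
  proof -
    obtain c where c: "c \<in> carrier F" "t = coset c" using coset_surj \<open>t \<in> carrier T\<close> by blast
    have 0: "0 \<in> H" using H.one_closed by simp
    have "tensor_act k R M N f g t = {a + ?E (b + c) | a b. a \<in> H \<and> b \<in> H}"
      by (auto simp: tensor_act_def c(2) set_mult_def r_coset_def)
    also have "\<dots> = {a + ?E c | a. a \<in> H}"
    proof safe
      fix a b assume ab: "a \<in> H" "b \<in> H"
      have "a + ?E b \<in> H" using H.m_closed[OF ab(1) EH[OF ab(2)]] by simp
      then show "\<exists>a'. a + ?E (b + c) = a' + ?E c \<and> a' \<in> H"
        by (intro exI[of _ "a + ?E b"]) (simp add: frag_extend_add add.assoc)
    next
      fix a assume "a \<in> H"
      then show "\<exists>a' b. a + ?E c = a' + ?E (b + c) \<and> a' \<in> H \<and> b \<in> H"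
        using 0 by (intro exI[of _ a] exI[of _ 0]) simp
    qed
    also have "\<dots> = coset (?E c)" by (auto simp: r_coset_def)
    finally show ?thesis using hc c by simp
  qed
  show "tensor_act k R M N f g \<in> additive T T"
    using act additive_closed[OF h(1)] additive_add[OF h(1)] by (auto intro!: additiveI)
  show "\<And>x y. x \<in> carrier M \<Longrightarrow> y \<in> carrier N
      \<Longrightarrow> tensor_act k R M N f g (pure x y) = pure (f x) (g y)"
    using act h(2) pure_closed by simp
qed

end

section \<open>Tensor products of bimodules\<close>

lemma (in bimodule) abelian: "abelian_group M" by (rule M.abelian_group_axioms)

lemma bimodule_tensor_pair:
  assumes "bimodule k L R M" "bimodule k R S N"
  shows "tensor_pair k R M N"
proof -
  interpret M: bimodule k L R M by fact
  interpret N: bimodule k R S N by fact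
  show ?thesis
    by unfold_locales (auto intro: M.rsmult_closed N.lsmult_closed)
qed

text \<open>Each scalar acts by an additive map; this form of the axioms lets the universal property of the
  tensor product deliver three of them at once.\<close>

lemma bimoduleI:
  assumes "assoc_algebra k L" "assoc_algebra k R" "abelian_group M"
    and smult: "\<And>c. c \<in> carrier k \<Longrightarrow> (\<lambda>x. c \<odot>\<^bsub>M\<^esub> x) \<in> additive M M"
    and lsmult: "\<And>a. a \<in> carrier L \<Longrightarrow> (\<lambda>x. a \<triangleright>\<^bsub>M\<^esub> x) \<in> additive M M"
    and rsmult: "\<And>r. r \<in> carrier R \<Longrightarrow> (\<lambda>x. x \<triangleleft>\<^bsub>M\<^esub> r) \<in> additive M M"
    and "\<And>c d x. \<lbrakk>c \<in> carrier k; d \<in> carrier k; x \<in> carrier M\<rbrakk>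
      \<Longrightarrow> (c \<oplus>\<^bsub>k\<^esub> d) \<odot>\<^bsub>M\<^esub> x = c \<odot>\<^bsub>M\<^esub> x \<oplus>\<^bsub>M\<^esub> d \<odot>\<^bsub>M\<^esub> x"
    and "\<And>c d x. \<lbrakk>c \<in> carrier k; d \<in> carrier k; x \<in> carrier M\<rbrakk>
      \<Longrightarrow> (c \<otimes>\<^bsub>k\<^esub> d) \<odot>\<^bsub>M\<^esub> x = c \<odot>\<^bsub>M\<^esub> (d \<odot>\<^bsub>M\<^esub> x)"
    and "\<And>x. x \<in> carrier M \<Longrightarrow> \<one>\<^bsub>k\<^esub> \<odot>\<^bsub>M\<^esub> x = x"
    and "\<And>a b x. \<lbrakk>a \<in> carrier L; b \<in> carrier L; x \<in> carrier M\<rbrakk>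
      \<Longrightarrow> (a \<oplus>\<^bsub>L\<^esub> b) \<triangleright>\<^bsub>M\<^esub> x = (a \<triangleright>\<^bsub>M\<^esub> x) \<oplus>\<^bsub>M\<^esub> (b \<triangleright>\<^bsub>M\<^esub> x)"
    and "\<And>a b x. \<lbrakk>a \<in> carrier L; b \<in> carrier L; x \<in> carrier M\<rbrakk>
      \<Longrightarrow> (a \<otimes>\<^bsub>L\<^esub> b) \<triangleright>\<^bsub>M\<^esub> x = a \<triangleright>\<^bsub>M\<^esub> (b \<triangleright>\<^bsub>M\<^esub> x)"
    and "\<And>c a x. \<lbrakk>c \<in> carrier k; a \<in> carrier L; x \<in> carrier M\<rbrakk>
      \<Longrightarrow> (c \<odot>\<^bsub>L\<^esub> a) \<triangleright>\<^bsub>M\<^esub> x = c \<odot>\<^bsub>M\<^esub> (a \<triangleright>\<^bsub>M\<^esub> x)"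
    and "\<And>c a x. \<lbrakk>c \<in> carrier k; a \<in> carrier L; x \<in> carrier M\<rbrakk>
      \<Longrightarrow> a \<triangleright>\<^bsub>M\<^esub> (c \<odot>\<^bsub>M\<^esub> x) = c \<odot>\<^bsub>M\<^esub> (a \<triangleright>\<^bsub>M\<^esub> x)"
    and "\<And>r s x. \<lbrakk>r \<in> carrier R; s \<in> carrier R; x \<in> carrier M\<rbrakk>
      \<Longrightarrow> x \<triangleleft>\<^bsub>M\<^esub> (r \<oplus>\<^bsub>R\<^esub> s) = (x \<triangleleft>\<^bsub>M\<^esub> r) \<oplus>\<^bsub>M\<^esub> (x \<triangleleft>\<^bsub>M\<^esub> s)"
    and "\<And>r s x. \<lbrakk>r \<in> carrier R; s \<in> carrier R; x \<in> carrier M\<rbrakk>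
      \<Longrightarrow> x \<triangleleft>\<^bsub>M\<^esub> (r \<otimes>\<^bsub>R\<^esub> s) = (x \<triangleleft>\<^bsub>M\<^esub> r) \<triangleleft>\<^bsub>M\<^esub> s"
    and "\<And>c r x. \<lbrakk>c \<in> carrier k; r \<in> carrier R; x \<in> carrier M\<rbrakk>
      \<Longrightarrow> x \<triangleleft>\<^bsub>M\<^esub> (c \<odot>\<^bsub>R\<^esub> r) = c \<odot>\<^bsub>M\<^esub> (x \<triangleleft>\<^bsub>M\<^esub> r)"
    and "\<And>c r x. \<lbrakk>c \<in> carrier k; r \<in> carrier R; x \<in> carrier M\<rbrakk>
      \<Longrightarrow> (c \<odot>\<^bsub>M\<^esub> x) \<triangleleft>\<^bsub>M\<^esub> r = c \<odot>\<^bsub>M\<^esub> (x \<triangleleft>\<^bsub>M\<^esub> r)"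
    and "\<And>a x r. \<lbrakk>a \<in> carrier L; x \<in> carrier M; r \<in> carrier R\<rbrakk>
      \<Longrightarrow> (a \<triangleright>\<^bsub>M\<^esub> x) \<triangleleft>\<^bsub>M\<^esub> r = a \<triangleright>\<^bsub>M\<^esub> (x \<triangleleft>\<^bsub>M\<^esub> r)"
  shows "bimodule k L R M"
proof -
  interpret L: assoc_algebra k L by fact
  interpret R: assoc_algebra k R by fact
  have "module k M"
    by (rule moduleI) (use assms in \<open>auto intro: L.R.cring_axioms simp: additive_closed[OF smult] additive_add[OF smult]\<close>)
  then show ?thesis
    by (intro bimodule.intro bimodule_axioms.intro assms(1,2))
      (auto intro: assms simp: additive_closed[OF lsmult] additive_add[OF lsmult]
        additive_closed[OF rsmult] additive_add[OF rsmult])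
qed

locale bimodule_pair = M: bimodule k L R M + N: bimodule k R S N
  for k :: "'k ring" and L :: "('k, 'l) module" and R :: "('k, 'r) module"
    and S :: "('k, 's) module"
    and M :: "('k, 'l, 'r, 'm) bimodule" and N :: "('k, 'r, 's, 'n) bimodule"
begin

sublocale tensor_pair k R M N
  by (rule bimodule_tensor_pair) (rule M.bimodule_axioms N.bimodule_axioms)+

lemma action_balanced:
  "c \<in> carrier k \<Longrightarrow> balanced k R M N T (\<lambda>x y. pure (c \<odot>\<^bsub>M\<^esub> x) y)"
  "a \<in> carrier L \<Longrightarrow> balanced k R M N T (\<lambda>x y. pure (a \<triangleright>\<^bsub>M\<^esub> x) y)"
  "b \<in> carrier S \<Longrightarrow> balanced k R M N T (\<lambda>x y. pure x (y \<triangleleft>\<^bsub>N\<^esub> b))"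
proof -
  assume c: "c \<in> carrier k"
  show "balanced k R M N T (\<lambda>x y. pure (c \<odot>\<^bsub>M\<^esub> x) y)"
  proof (rule balancedI)
    fix x a y assume *: "x \<in> carrier M" "a \<in> carrier R" "y \<in> carrier N"
    then show "pure (c \<odot>\<^bsub>M\<^esub> (x \<triangleleft>\<^bsub>M\<^esub> a)) y = pure (c \<odot>\<^bsub>M\<^esub> x) (a \<triangleright>\<^bsub>N\<^esub> y)"
      using c by (simp flip: M.rsmult_smult_l pure_middle)
  next
    fix x d y assume *: "x \<in> carrier M" "d \<in> carrier k" "y \<in> carrier N"
    have "c \<odot>\<^bsub>M\<^esub> (d \<odot>\<^bsub>M\<^esub> x) = d \<odot>\<^bsub>M\<^esub> (c \<odot>\<^bsub>M\<^esub> x)"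
      using c * by (simp add: M.L.R.m_comm flip: M.smult_assoc1)
    then show "pure (c \<odot>\<^bsub>M\<^esub> (d \<odot>\<^bsub>M\<^esub> x)) y = pure (c \<odot>\<^bsub>M\<^esub> x) (d \<odot>\<^bsub>N\<^esub> y)"
      using c * by (simp flip: pure_smult)
  qed (use c in \<open>simp_all add: pure_closed pure_add_left pure_add_right M.smult_r_distr\<close>)
next
  assume a: "a \<in> carrier L"
  show "balanced k R M N T (\<lambda>x y. pure (a \<triangleright>\<^bsub>M\<^esub> x) y)"
  proof (rule balancedI)
    fix x b y assume *: "x \<in> carrier M" "b \<in> carrier R" "y \<in> carrier N"
    then show "pure (a \<triangleright>\<^bsub>M\<^esub> (x \<triangleleft>\<^bsub>M\<^esub> b)) y = pure (a \<triangleright>\<^bsub>M\<^esub> x) (b \<triangleright>\<^bsub>N\<^esub> y)"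
      using a by (simp add: M.lsmult_closed flip: M.lsmult_rsmult pure_middle)
  next
    fix x d y assume *: "x \<in> carrier M" "d \<in> carrier k" "y \<in> carrier N"
    then show "pure (a \<triangleright>\<^bsub>M\<^esub> (d \<odot>\<^bsub>M\<^esub> x)) y = pure (a \<triangleright>\<^bsub>M\<^esub> x) (d \<odot>\<^bsub>N\<^esub> y)"
      using a by (simp add: M.lsmult_smult_r M.lsmult_closed flip: pure_smult)
  qed (use a in \<open>simp_all add: pure_closed pure_add_left pure_add_right M.lsmult_closed M.lsmult_r_distr\<close>)
next
  assume b: "b \<in> carrier S"
  show "balanced k R M N T (\<lambda>x y. pure x (y \<triangleleft>\<^bsub>N\<^esub> b))"
  proof (rule balancedI)
    fix x a y assume *: "x \<in> carrier M" "a \<in> carrier R" "y \<in> carrier N"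
    then show "pure (x \<triangleleft>\<^bsub>M\<^esub> a) (y \<triangleleft>\<^bsub>N\<^esub> b) = pure x ((a \<triangleright>\<^bsub>N\<^esub> y) \<triangleleft>\<^bsub>N\<^esub> b)"
      using b by (simp add: N.lsmult_rsmult N.rsmult_closed pure_middle)
  next
    fix x d y assume *: "x \<in> carrier M" "d \<in> carrier k" "y \<in> carrier N"
    then show "pure (d \<odot>\<^bsub>M\<^esub> x) (y \<triangleleft>\<^bsub>N\<^esub> b) = pure x ((d \<odot>\<^bsub>N\<^esub> y) \<triangleleft>\<^bsub>N\<^esub> b)"
      using b by (simp add: N.rsmult_smult_l N.rsmult_closed pure_smult)
  qed (use b in \<open>simp_all add: pure_closed pure_add_left pure_add_right N.rsmult_closed N.rsmult_l_distr\<close>)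
qed

lemma action_eq:
  "c \<odot>\<^bsub>T\<^esub> t = tensor_act k R M N (\<lambda>x. c \<odot>\<^bsub>M\<^esub> x) (\<lambda>y. y) t"
  "a \<triangleright>\<^bsub>T\<^esub> t = tensor_act k R M N (\<lambda>x. a \<triangleright>\<^bsub>M\<^esub> x) (\<lambda>y. y) t"
  "t \<triangleleft>\<^bsub>T\<^esub> b = tensor_act k R M N (\<lambda>x. x) (\<lambda>y. y \<triangleleft>\<^bsub>N\<^esub> b) t"
  by (simp_all add: tensor_def)

lemma action_additive:
  "c \<in> carrier k \<Longrightarrow> (\<lambda>t. c \<odot>\<^bsub>T\<^esub> t) \<in> additive T T"
  "a \<in> carrier L \<Longrightarrow> (\<lambda>t. a \<triangleright>\<^bsub>T\<^esub> t) \<in> additive T T"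
  "b \<in> carrier S \<Longrightarrow> (\<lambda>t. t \<triangleleft>\<^bsub>T\<^esub> b) \<in> additive T T"
  unfolding action_eq
    by ((rule tensor_act_additive; (rule action_balanced)?), simp_all add: M.lsmult_closed N.rsmult_closed)+

lemma action_pure:
  "c \<in> carrier k \<Longrightarrow> x \<in> carrier M \<Longrightarrow> y \<in> carrier N \<Longrightarrow> c \<odot>\<^bsub>T\<^esub> pure x y = pure (c \<odot>\<^bsub>M\<^esub> x) y"
  "a \<in> carrier L \<Longrightarrow> x \<in> carrier M \<Longrightarrow> y \<in> carrier N \<Longrightarrow> a \<triangleright>\<^bsub>T\<^esub> pure x y = pure (a \<triangleright>\<^bsub>M\<^esub> x) y"
  "b \<in> carrier S \<Longrightarrow> x \<in> carrier M \<Longrightarrow> y \<in> carrier N \<Longrightarrow> pure x y \<triangleleft>\<^bsub>T\<^esub> b = pure x (y \<triangleleft>\<^bsub>N\<^esub> b)"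
  unfolding action_eq
    by ((rule tensor_act_pure; (rule action_balanced)?), simp_all add: M.lsmult_closed N.rsmult_closed)+

lemmas action_closed =
    action_additive[THEN additive_closed]
lemmas action_add =
    action_additive[THEN additive_add]

text \<open>All axioms are equations between maps that are additive in the tensor, so that they need to be
  checked on pure tensors only.\<close>

theorem bimodule_tensor: "bimodule k L S T"
proof (rule bimoduleI)
  note [simp] = action_closed action_add action_pure M.lsmult_closed N.rsmult_closed pure_closed
  show "(c \<oplus>\<^bsub>k\<^esub> d) \<odot>\<^bsub>T\<^esub> t = c \<odot>\<^bsub>T\<^esub> t \<oplus>\<^bsub>T\<^esub> d \<odot>\<^bsub>T\<^esub> t"
    if "c \<in> carrier k" "d \<in> carrier k" "t \<in> carrier T" for c d t
    using that(3) by (induction rule: tensor_induct) (simp_all add: that M.smult_l_distr pure_add_left T.a_ac)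
  show "(c \<otimes>\<^bsub>k\<^esub> d) \<odot>\<^bsub>T\<^esub> t = c \<odot>\<^bsub>T\<^esub> (d \<odot>\<^bsub>T\<^esub> t)"
    if "c \<in> carrier k" "d \<in> carrier k" "t \<in> carrier T" for c d t
    using that(3) by (induction rule: tensor_induct) (simp_all add: that M.smult_assoc1 T.a_ac)
  show "\<one>\<^bsub>k\<^esub> \<odot>\<^bsub>T\<^esub> t = t" if "t \<in> carrier T" for t
    using that(1) by (induction rule: tensor_induct) (simp_all add: that)
  show "(c \<oplus>\<^bsub>L\<^esub> d) \<triangleright>\<^bsub>T\<^esub> t = (c \<triangleright>\<^bsub>T\<^esub> t) \<oplus>\<^bsub>T\<^esub> (d \<triangleright>\<^bsub>T\<^esub> t)"
    if "c \<in> carrier L" "d \<in> carrier L" "t \<in> carrier T" for c d t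
    using that(3) by (induction rule: tensor_induct) (simp_all add: that M.lsmult_l_distr pure_add_left T.a_ac)
  show "(c \<otimes>\<^bsub>L\<^esub> d) \<triangleright>\<^bsub>T\<^esub> t = c \<triangleright>\<^bsub>T\<^esub> (d \<triangleright>\<^bsub>T\<^esub> t)"
    if "c \<in> carrier L" "d \<in> carrier L" "t \<in> carrier T" for c d t
    using that(3) by (induction rule: tensor_induct) (simp_all add: that M.lsmult_assoc M.L.alg_m_closed T.a_ac)
  show "(c \<odot>\<^bsub>L\<^esub> d) \<triangleright>\<^bsub>T\<^esub> t = c \<odot>\<^bsub>T\<^esub> (d \<triangleright>\<^bsub>T\<^esub> t)"
    if "c \<in> carrier k" "d \<in> carrier L" "t \<in> carrier T" for c d t
    using that(3) by (induction rule: tensor_induct) (simp_all add: that M.lsmult_smult_l T.a_ac)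
  show "d \<triangleright>\<^bsub>T\<^esub> (c \<odot>\<^bsub>T\<^esub> t) = c \<odot>\<^bsub>T\<^esub> (d \<triangleright>\<^bsub>T\<^esub> t)"
    if "c \<in> carrier k" "d \<in> carrier L" "t \<in> carrier T" for c d t
    using that(3) by (induction rule: tensor_induct) (simp_all add: that M.lsmult_smult_r T.a_ac)
  show "t \<triangleleft>\<^bsub>T\<^esub> (c \<oplus>\<^bsub>S\<^esub> d) = (t \<triangleleft>\<^bsub>T\<^esub> c) \<oplus>\<^bsub>T\<^esub> (t \<triangleleft>\<^bsub>T\<^esub> d)"
    if "c \<in> carrier S" "d \<in> carrier S" "t \<in> carrier T" for c d t
    using that(3) by (induction rule: tensor_induct) (simp_all add: that N.rsmult_r_distr pure_add_right T.a_ac)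
  show "t \<triangleleft>\<^bsub>T\<^esub> (c \<otimes>\<^bsub>S\<^esub> d) = (t \<triangleleft>\<^bsub>T\<^esub> c) \<triangleleft>\<^bsub>T\<^esub> d"
    if "c \<in> carrier S" "d \<in> carrier S" "t \<in> carrier T" for c d t
    using that(3) by (induction rule: tensor_induct) (simp_all add: that N.rsmult_assoc N.R.alg_m_closed T.a_ac)
  show "t \<triangleleft>\<^bsub>T\<^esub> (c \<odot>\<^bsub>S\<^esub> d) = c \<odot>\<^bsub>T\<^esub> (t \<triangleleft>\<^bsub>T\<^esub> d)"
    if "c \<in> carrier k" "d \<in> carrier S" "t \<in> carrier T" for c d t
    using that(3) by (induction rule: tensor_induct) (simp_all add: that N.rsmult_smult_r pure_smult T.a_ac)
  show "(c \<odot>\<^bsub>T\<^esub> t) \<triangleleft>\<^bsub>T\<^esub> d = c \<odot>\<^bsub>T\<^esub> (t \<triangleleft>\<^bsub>T\<^esub> d)"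
    if "c \<in> carrier k" "d \<in> carrier S" "t \<in> carrier T" for c d t
    using that(3) by (induction rule: tensor_induct) (simp_all add: that)
  show "(a \<triangleright>\<^bsub>T\<^esub> t) \<triangleleft>\<^bsub>T\<^esub> d = a \<triangleright>\<^bsub>T\<^esub> (t \<triangleleft>\<^bsub>T\<^esub> d)"
    if "a \<in> carrier L" "t \<in> carrier T" "d \<in> carrier S" for a d t
    using that(2) by (induction rule: tensor_induct) (simp_all add: that)
qed (rule M.L.assoc_algebra_axioms N.R.assoc_algebra_axioms abelian_tensor action_additive; assumption?)+

end

lemma bimodule_homI:
  assumes "h \<in> additive M N"
    and "\<And>c x. c \<in> carrier k \<Longrightarrow> x \<in> carrier M \<Longrightarrow> h (c \<odot>\<^bsub>M\<^esub> x) = c \<odot>\<^bsub>N\<^esub> h x"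
    and "\<And>a x. a \<in> carrier L \<Longrightarrow> x \<in> carrier M \<Longrightarrow> h (a \<triangleright>\<^bsub>M\<^esub> x) = a \<triangleright>\<^bsub>N\<^esub> h x"
    and "\<And>a x. a \<in> carrier R \<Longrightarrow> x \<in> carrier M \<Longrightarrow> h (x \<triangleleft>\<^bsub>M\<^esub> a) = h x \<triangleleft>\<^bsub>N\<^esub> a"
  shows "h \<in> bimodule_hom k L R M N"
  using assms by (simp add: bimodule_hom_def)

lemma bimodule_homD:
  assumes "h \<in> bimodule_hom k L R M N"
  shows "h \<in> additive M N"
    and "c \<in> carrier k \<Longrightarrow> x \<in> carrier M \<Longrightarrow> h (c \<odot>\<^bsub>M\<^esub> x) = c \<odot>\<^bsub>N\<^esub> h x"
    and "a \<in> carrier L \<Longrightarrow> x \<in> carrier M \<Longrightarrow> h (a \<triangleright>\<^bsub>M\<^esub> x) = a \<triangleright>\<^bsub>N\<^esub> h x"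
    and "b \<in> carrier R \<Longrightarrow> x \<in> carrier M \<Longrightarrow> h (x \<triangleleft>\<^bsub>M\<^esub> b) = h x \<triangleleft>\<^bsub>N\<^esub> b"
  using assms by (simp_all add: bimodule_hom_def)

lemma bimodule_hom_id: "(\<lambda>x. x) \<in> bimodule_hom k L R M M"
  by (auto intro: bimodule_homI additiveI)

lemma tensor_map:
  assumes MN: "tensor_pair k R M N" and MN': "tensor_pair k R M' N'"
    and f: "f \<in> bimodule_hom k L R M M'" and g: "g \<in> bimodule_hom k R S N N'"
  shows tensor_map_additive: "tensor_map k R M N M' N' f g \<in> additive (tensor k R M N) (tensor k R M' N')"
    and tensor_map_pure: "\<And>x y. x \<in> carrier M \<Longrightarrow> y \<in> carrier N \<Longrightarrow>
      tensor_map k R M N M' N' f g (pure_tensor k R M N x y) = pure_tensor k R M' N' (f x) (g y)"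
proof -
  interpret MN: tensor_pair k R M N by fact
  interpret MN': tensor_pair k R M' N' by fact
  note [simp] = additive_closed[OF bimodule_homD(1)[OF f]] additive_add[OF bimodule_homD(1)[OF f]]
    additive_closed[OF bimodule_homD(1)[OF g]] additive_add[OF bimodule_homD(1)[OF g]]
    bimodule_homD(2-4)[OF f] bimodule_homD(2-4)[OF g]
  have "balanced k R M N MN'.T (\<lambda>x y. MN'.pure (f x) (g y))"
    by (rule balancedI)
      (simp_all add: MN'.pure_closed MN'.pure_add_left MN'.pure_add_right MN'.pure_middle MN'.pure_smult)
  note * = MN.tensor_lift[OF MN'.abelian_tensor this]
  show "tensor_map k R M N M' N' f g \<in> additive (tensor k R M N) (tensor k R M' N')"
    and "\<And>x y. x \<in> carrier M \<Longrightarrow> y \<in> carrier N \<Longrightarrow>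
      tensor_map k R M N M' N' f g (pure_tensor k R M N x y) = pure_tensor k R M' N' (f x) (g y)"
    unfolding tensor_map_def using * by blast+
qed

text \<open>The associator is a lift of a lift: \<open>(x, y) \<mapsto> x \<otimes> (y \<otimes> z)\<close> is balanced for each \<open>z\<close>, and the
  resulting maps \<open>t \<mapsto> g z t\<close> are balanced in the pair \<open>(t, z)\<close>.\<close>

lemma tensor_assoc:
  assumes M: "bimodule k R R M" and N: "bimodule k R R N" and Q: "bimodule k R R Q"
  shows tensor_assoc_additive: "tensor_assoc k R M N Q \<in>
      additive (tensor k R (tensor k R M N) Q) (tensor k R M (tensor k R N Q))"
    and tensor_assoc_pure: "\<And>x y z. x \<in> carrier M \<Longrightarrow> y \<in> carrier N \<Longrightarrow> z \<in> carrier Q \<Longrightarrow>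
      tensor_assoc k R M N Q (pure_tensor k R (tensor k R M N) Q (pure_tensor k R M N x y) z)
        = pure_tensor k R M (tensor k R N Q) x (pure_tensor k R N Q y z)"
proof -
  interpret M: bimodule k R R M by fact
  interpret N: bimodule k R R N by fact
  interpret Q: bimodule k R R Q by fact
  interpret MN: bimodule_pair k R R R M N by (intro bimodule_pair.intro M N)
  interpret NQ: bimodule_pair k R R R N Q by (intro bimodule_pair.intro N Q)
  interpret MN_Q: bimodule_pair k R R R MN.T Q by (intro bimodule_pair.intro MN.bimodule_tensor Q)
  interpret M_NQ: bimodule_pair k R R R M NQ.T by (intro bimodule_pair.intro NQ.bimodule_tensor M)
  let ?g = "\<lambda>z. tensor_lift k R M N M_NQ.T (\<lambda>x y. M_NQ.pure x (NQ.pure y z))"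
  have bal: "balanced k R M N M_NQ.T (\<lambda>x y. M_NQ.pure x (NQ.pure y z))" if z: "z \<in> carrier Q" for z
  proof (rule balancedI)
    fix x a y assume *: "x \<in> carrier M" "a \<in> carrier R" "y \<in> carrier N"
    then show "M_NQ.pure (x \<triangleleft>\<^bsub>M\<^esub> a) (NQ.pure y z) = M_NQ.pure x (NQ.pure (a \<triangleright>\<^bsub>N\<^esub> y) z)"
      using z by (simp add: M_NQ.pure_middle NQ.pure_closed NQ.action_pure)
  next
    fix x a y assume *: "x \<in> carrier M" "a \<in> carrier k" "y \<in> carrier N"
    then show "M_NQ.pure (a \<odot>\<^bsub>M\<^esub> x) (NQ.pure y z) = M_NQ.pure x (NQ.pure (a \<odot>\<^bsub>N\<^esub> y) z)"
      using z by (simp add: M_NQ.pure_smult NQ.pure_closed NQ.action_pure)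
  qed (use z in \<open>simp_all add: M_NQ.pure_closed NQ.pure_closed M_NQ.pure_add_left M_NQ.pure_add_right
      NQ.pure_add_left\<close>)
  note g = MN.tensor_lift[OF M_NQ.abelian_tensor bal]
  have "balanced k R MN.T Q M_NQ.T (\<lambda>t z. ?g z t)"
  proof (rule balancedI)
    fix t z z' assume *: "t \<in> carrier MN.T" "z \<in> carrier Q" "z' \<in> carrier Q"
    show "?g (z \<oplus>\<^bsub>Q\<^esub> z') t = ?g z t \<oplus>\<^bsub>M_NQ.T\<^esub> ?g z' t"
      using * by (intro MN.additive_eqI[OF g(1) additive_sum[OF M_NQ.abelian_tensor g(1) g(1)] _ *(1)])
        (simp_all add: g(2) NQ.pure_add_right M_NQ.pure_add_right NQ.pure_closed)
  next
    fix t a z assume *: "t \<in> carrier MN.T" "a \<in> carrier R" "z \<in> carrier Q"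
    show "?g z (t \<triangleleft>\<^bsub>MN.T\<^esub> a) = ?g (a \<triangleright>\<^bsub>Q\<^esub> z) t"
      using * Q.lsmult_closed N.rsmult_closed
      by (intro MN.additive_eqI[OF additive_comp[OF MN.action_additive(3) g(1)] g(1) _ *(1)])
        (simp_all add: MN.action_pure g(2) NQ.pure_middle)
  next
    fix t a z assume *: "t \<in> carrier MN.T" "a \<in> carrier k" "z \<in> carrier Q"
    show "?g z (a \<odot>\<^bsub>MN.T\<^esub> t) = ?g (a \<odot>\<^bsub>Q\<^esub> z) t"
      using *
      by (intro MN.additive_eqI[OF additive_comp[OF MN.action_additive(1) g(1)] g(1) _ *(1)])
        (simp_all add: MN.action_pure g(2) M_NQ.pure_smult NQ.pure_closed NQ.action_pure NQ.pure_smult)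
  qed (simp_all add: additive_closed[OF g(1)] additive_add[OF g(1)])
  note h = MN_Q.tensor_lift[OF M_NQ.abelian_tensor this]
  show "tensor_assoc k R M N Q \<in>
      additive (tensor k R (tensor k R M N) Q) (tensor k R M (tensor k R N Q))"
    and "\<And>x y z. x \<in> carrier M \<Longrightarrow> y \<in> carrier N \<Longrightarrow> z \<in> carrier Q \<Longrightarrow>
      tensor_assoc k R M N Q (pure_tensor k R (tensor k R M N) Q (pure_tensor k R M N x y) z)
        = pure_tensor k R M (tensor k R N Q) x (pure_tensor k R N Q y z)"
    unfolding tensor_assoc_def using h(1) by (auto simp: h(2) MN.pure_closed g(2))
qed

section \<open>Regular bimodules and sub-bimodules\<close>

lemma regular_bimodule_sel [simp]:
  "carrier (regular_bimodule A) = carrier A" "\<zero>\<^bsub>regular_bimodule A\<^esub> = \<zero>\<^bsub>A\<^esub>"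
  "x \<oplus>\<^bsub>regular_bimodule A\<^esub> y = x \<oplus>\<^bsub>A\<^esub> y" "c \<odot>\<^bsub>regular_bimodule A\<^esub> x = c \<odot>\<^bsub>A\<^esub> x"
  "x \<triangleright>\<^bsub>regular_bimodule A\<^esub> y = x \<otimes>\<^bsub>A\<^esub> y" "x \<triangleleft>\<^bsub>regular_bimodule A\<^esub> y = x \<otimes>\<^bsub>A\<^esub> y"
  by (simp_all add: regular_bimodule_def)

lemma bimodule_regular:
  assumes "assoc_algebra k A"
  shows "bimodule k A A (regular_bimodule A)"
proof -
  interpret A: assoc_algebra k A by fact
  show ?thesis
  proof (rule bimoduleI)
    show "abelian_group (regular_bimodule A)"
      by (rule abelian_groupI) (use A.add.l_inv_ex in \<open>auto simp: A.a_ac\<close>)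
    show "(\<lambda>x. c \<odot>\<^bsub>regular_bimodule A\<^esub> x) \<in> additive (regular_bimodule A) (regular_bimodule A)"
      if "c \<in> carrier k" for c
      using that by (intro additiveI) (simp_all add: A.smult_r_distr)
    show "(\<lambda>x. a \<triangleright>\<^bsub>regular_bimodule A\<^esub> x) \<in> additive (regular_bimodule A) (regular_bimodule A)"
      if "a \<in> carrier A" for a
      using that by (intro additiveI) (simp_all add: A.alg_m_closed A.alg_r_distr)
    show "(\<lambda>x. x \<triangleleft>\<^bsub>regular_bimodule A\<^esub> a) \<in> additive (regular_bimodule A) (regular_bimodule A)"
      if "a \<in> carrier A" for a
      using that by (intro additiveI) (simp_all add: A.alg_m_closed A.alg_l_distr)
  qed (auto intro!: assms simp: A.alg_m_closed A.alg_m_assoc A.alg_l_distr A.alg_r_distr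
      A.alg_smult_l A.alg_smult_r A.smult_l_distr A.smult_r_distr A.smult_assoc1)
qed

lemma (in module) module_sub:
  assumes S: "S \<subseteq> carrier M" and zero: "\<zero>\<^bsub>M\<^esub> \<in> S"
    and add: "\<And>x y. x \<in> S \<Longrightarrow> y \<in> S \<Longrightarrow> x \<oplus>\<^bsub>M\<^esub> y \<in> S"
    and smult: "\<And>c x. c \<in> carrier R \<Longrightarrow> x \<in> S \<Longrightarrow> c \<odot>\<^bsub>M\<^esub> x \<in> S"
  shows "module R (M\<lparr>carrier := S\<rparr>)"
proof (intro submodule.submodule_is_module submoduleI module_axioms)
  show "\<ominus>\<^bsub>M\<^esub> x \<in> S" if "x \<in> S" for x
    using smult[of "\<ominus> \<one>" x] S that smult_l_minus[of \<one> x] by auto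
qed (use assms in auto)

lemma (in assoc_algebra) alg_l_null:
  assumes "a \<in> carrier A"
  shows "\<zero>\<^bsub>A\<^esub> \<otimes>\<^bsub>A\<^esub> a = \<zero>\<^bsub>A\<^esub>"
  using assms alg_l_distr[of "\<zero>\<^bsub>A\<^esub>" "\<zero>\<^bsub>A\<^esub>" a] alg_m_closed[of "\<zero>\<^bsub>A\<^esub>" a]
  by (simp add: M.add.l_cancel_one')

lemma sub_bimodule:
  assumes "bimodule k L R M" and S: "S \<subseteq> carrier M" and zero: "\<zero>\<^bsub>M\<^esub> \<in> S"
    and add: "\<And>x y. x \<in> S \<Longrightarrow> y \<in> S \<Longrightarrow> x \<oplus>\<^bsub>M\<^esub> y \<in> S"
    and smult: "\<And>c x. c \<in> carrier k \<Longrightarrow> x \<in> S \<Longrightarrow> c \<odot>\<^bsub>M\<^esub> x \<in> S"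
    and lsmult: "\<And>a x. a \<in> carrier L \<Longrightarrow> x \<in> S \<Longrightarrow> a \<triangleright>\<^bsub>M\<^esub> x \<in> S"
    and rsmult: "\<And>a x. a \<in> carrier R \<Longrightarrow> x \<in> S \<Longrightarrow> x \<triangleleft>\<^bsub>M\<^esub> a \<in> S"
  shows "bimodule k L R (M\<lparr>carrier := S\<rparr>)"
proof -
  interpret bimodule k L R M by fact
  have "module k (M\<lparr>carrier := S\<rparr>)" by (rule module_sub[OF S zero add smult])
  then show ?thesis
    by (intro bimodule.intro bimodule_axioms.intro L.assoc_algebra_axioms R.assoc_algebra_axioms)
      (use S in \<open>auto intro: lsmult rsmult lsmult_l_distr lsmult_r_distr lsmult_assoc lsmult_smult_l
        lsmult_smult_r rsmult_r_distr rsmult_l_distr rsmult_assoc rsmult_smult_r rsmult_smult_l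
        lsmult_rsmult\<close>)
qed

section \<open>Duals and dual bases\<close>

context tensor_pair
begin

text \<open>A matrix \<open>c\<close> moves across a balanced map. This is the computation behind every independence
  statement below: expanding the second entries of a family in another family turns the one sum
  into the other.\<close>

lemma balanced_finsum_exchange:
  assumes Q: "abelian_group Q" and \<beta>: "balanced k R M N Q \<beta>" and fin: "finite S" "finite U"
    and x: "\<And>i. i \<in> S \<Longrightarrow> x i \<in> carrier M" and y: "\<And>j. j \<in> U \<Longrightarrow> y j \<in> carrier N"
    and c: "\<And>i j. i \<in> S \<Longrightarrow> j \<in> U \<Longrightarrow> c i j \<in> carrier R"
  shows "(\<Oplus>\<^bsub>Q\<^esub>i\<in>S. \<beta> (x i) (\<Oplus>\<^bsub>N\<^esub>j\<in>U. c i j \<triangleright>\<^bsub>N\<^esub> y j)) =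
    (\<Oplus>\<^bsub>Q\<^esub>j\<in>U. \<beta> (\<Oplus>\<^bsub>M\<^esub>i\<in>S. x i \<triangleleft>\<^bsub>M\<^esub> c i j) (y j))"
proof -
  interpret Q: abelian_group Q by fact
  have cl: "\<beta> (x i) (c i j \<triangleright>\<^bsub>N\<^esub> y j) \<in> carrier Q" if "i \<in> S" "j \<in> U" for i j
    using that x y c by (intro balanced_closed[OF \<beta>] act_N) auto
  have "(\<Oplus>\<^bsub>Q\<^esub>i\<in>S. \<beta> (x i) (\<Oplus>\<^bsub>N\<^esub>j\<in>U. c i j \<triangleright>\<^bsub>N\<^esub> y j)) = (\<Oplus>\<^bsub>Q\<^esub>i\<in>S. \<Oplus>\<^bsub>Q\<^esub>j\<in>U. \<beta> (x i) (c i j \<triangleright>\<^bsub>N\<^esub> y j))"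
    using x y c cl
    by (intro Q.finsum_cong' additive_finsum[OF grp_N Q balancedD(1)[OF \<beta>]])
       (auto intro!: Q.finsum_closed act_N)
  also have "\<dots> = (\<Oplus>\<^bsub>Q\<^esub>j\<in>U. \<Oplus>\<^bsub>Q\<^esub>i\<in>S. \<beta> (x i) (c i j \<triangleright>\<^bsub>N\<^esub> y j))"
    using cl by (intro Q.finsum_swap fin)
  also have "\<dots> = (\<Oplus>\<^bsub>Q\<^esub>j\<in>U. \<Oplus>\<^bsub>Q\<^esub>i\<in>S. \<beta> (x i \<triangleleft>\<^bsub>M\<^esub> c i j) (y j))"
    using x y c cl
    by (intro Q.finsum_cong' Q.finsum_closed) (auto simp: balancedD(3)[OF \<beta>] intro!: Q.finsum_cong')
  also have "\<dots> = (\<Oplus>\<^bsub>Q\<^esub>j\<in>U. \<beta> (\<Oplus>\<^bsub>M\<^esub>i\<in>S. x i \<triangleleft>\<^bsub>M\<^esub> c i j) (y j))"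
    using x y c
    by (intro Q.finsum_cong' additive_finsum[OF grp_M Q balancedD(2)[OF \<beta>], symmetric])
       (auto intro!: M.finsum_closed balanced_closed[OF \<beta>] act_M)
  finally show ?thesis .
qed

end

text \<open>The compatibility with the right action is a property of the functionals in the dual; the module
  itself enters through the closure of its carrier.\<close>

locale right_module = A: unital_algebra k A
  for k :: "'k ring" and A :: "('k, 'a) module" and M :: "('k, 'l, 'a, 'm) bimodule" +
  assumes mod_M: "module k M"
    and rs_closed: "\<And>x a. x \<in> carrier M \<Longrightarrow> a \<in> carrier A \<Longrightarrow> x \<triangleleft>\<^bsub>M\<^esub> a \<in> carrier M"
begin

sublocale M: module k M by (rule mod_M)

abbreviation "D \<equiv> dual A M"

lemma dual_iff:
  "\<phi> \<in> carrier D \<longleftrightarrow> \<phi> \<in> extensional (carrier M) \<and> \<phi> \<in> additive M A \<and>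
    (\<forall>a\<in>carrier A. \<forall>x\<in>carrier M. \<phi> (x \<triangleleft>\<^bsub>M\<^esub> a) = \<phi> x \<otimes>\<^bsub>A\<^esub> a)"
  by (auto simp: dual_def right_hom_def PiE_iff hom_def Pi_iff)

lemma dualI:
  assumes "\<phi> \<in> extensional (carrier M)" "\<And>x. x \<in> carrier M \<Longrightarrow> \<phi> x \<in> carrier A"
    and "\<And>x y. x \<in> carrier M \<Longrightarrow> y \<in> carrier M \<Longrightarrow> \<phi> (x \<oplus>\<^bsub>M\<^esub> y) = \<phi> x \<oplus>\<^bsub>A\<^esub> \<phi> y"
    and "\<And>x a. x \<in> carrier M \<Longrightarrow> a \<in> carrier A \<Longrightarrow> \<phi> (x \<triangleleft>\<^bsub>M\<^esub> a) = \<phi> x \<otimes>\<^bsub>A\<^esub> a"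
  shows "\<phi> \<in> carrier D"
  unfolding dual_iff using assms by (auto intro: additiveI)

lemma dualD:
  assumes "\<phi> \<in> carrier D"
  shows "\<phi> \<in> extensional (carrier M)" "\<phi> \<in> additive M A"
    "x \<in> carrier M \<Longrightarrow> \<phi> x \<in> carrier A"
    "x \<in> carrier M \<Longrightarrow> y \<in> carrier M \<Longrightarrow> \<phi> (x \<oplus>\<^bsub>M\<^esub> y) = \<phi> x \<oplus>\<^bsub>A\<^esub> \<phi> y"
    "x \<in> carrier M \<Longrightarrow> a \<in> carrier A \<Longrightarrow> \<phi> (x \<triangleleft>\<^bsub>M\<^esub> a) = \<phi> x \<otimes>\<^bsub>A\<^esub> a"
  using assms additive_closed[of \<phi> M A x] additive_add[of \<phi> M A x y] unfolding dual_iff by auto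

lemma dual_eqI:
  "\<phi> \<in> carrier D \<Longrightarrow> \<psi> \<in> carrier D \<Longrightarrow> (\<And>x. x \<in> carrier M \<Longrightarrow> \<phi> x = \<psi> x) \<Longrightarrow> \<phi> = \<psi>"
  by (rule extensionalityI[OF dualD(1) dualD(1)])

lemma dual_sel:
  "\<zero>\<^bsub>D\<^esub> = (\<lambda>x\<in>carrier M. \<zero>\<^bsub>A\<^esub>)" "\<phi> \<oplus>\<^bsub>D\<^esub> \<psi> = (\<lambda>x\<in>carrier M. \<phi> x \<oplus>\<^bsub>A\<^esub> \<psi> x)"
  "c \<odot>\<^bsub>D\<^esub> \<phi> = (\<lambda>x\<in>carrier M. c \<odot>\<^bsub>A\<^esub> \<phi> x)" "a \<triangleright>\<^bsub>D\<^esub> \<phi> = (\<lambda>x\<in>carrier M. a \<otimes>\<^bsub>A\<^esub> \<phi> x)"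
  "\<phi> \<triangleleft>\<^bsub>D\<^esub> b = (\<lambda>x\<in>carrier M. \<phi> (b \<triangleright>\<^bsub>M\<^esub> x))"
  by (simp_all add: dual_def)

lemma dual_closed:
  "\<zero>\<^bsub>D\<^esub> \<in> carrier D"
  "\<phi> \<in> carrier D \<Longrightarrow> \<psi> \<in> carrier D \<Longrightarrow> \<phi> \<oplus>\<^bsub>D\<^esub> \<psi> \<in> carrier D"
  "\<phi> \<in> carrier D \<Longrightarrow> c \<in> carrier k \<Longrightarrow> c \<odot>\<^bsub>D\<^esub> \<phi> \<in> carrier D"
  "\<phi> \<in> carrier D \<Longrightarrow> a \<in> carrier A \<Longrightarrow> a \<triangleright>\<^bsub>D\<^esub> \<phi> \<in> carrier D"
proof -
  show "\<zero>\<^bsub>D\<^esub> \<in> carrier D"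
    by (rule dualI) (auto simp: dual_sel A.alg_l_null rs_closed)
  show "\<phi> \<in> carrier D \<Longrightarrow> \<psi> \<in> carrier D \<Longrightarrow> \<phi> \<oplus>\<^bsub>D\<^esub> \<psi> \<in> carrier D"
    by (rule dualI) (auto simp: dual_sel dualD(3-) rs_closed A.M.a_ac A.alg_l_distr)
  show "\<phi> \<in> carrier D \<Longrightarrow> c \<in> carrier k \<Longrightarrow> c \<odot>\<^bsub>D\<^esub> \<phi> \<in> carrier D"
    by (rule dualI) (auto simp: dual_sel dualD(3-) rs_closed A.smult_r_distr A.alg_smult_l)
  show "\<phi> \<in> carrier D \<Longrightarrow> a \<in> carrier A \<Longrightarrow> a \<triangleright>\<^bsub>D\<^esub> \<phi> \<in> carrier D"
    by (rule dualI) (auto simp: dual_sel dualD(3-) rs_closed A.alg_r_distr A.alg_m_assoc A.alg_m_closed)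
qed

lemma abelian_dual: "abelian_group D"
proof (rule abelian_groupI)
  show "\<exists>\<psi>\<in>carrier D. \<psi> \<oplus>\<^bsub>D\<^esub> \<phi> = \<zero>\<^bsub>D\<^esub>" if "\<phi> \<in> carrier D" for \<phi>
  proof
    show "(\<ominus>\<^bsub>k\<^esub> \<one>\<^bsub>k\<^esub>) \<odot>\<^bsub>D\<^esub> \<phi> \<in> carrier D" using that by (simp add: dual_closed)
    show "(\<ominus>\<^bsub>k\<^esub> \<one>\<^bsub>k\<^esub>) \<odot>\<^bsub>D\<^esub> \<phi> \<oplus>\<^bsub>D\<^esub> \<phi> = \<zero>\<^bsub>D\<^esub>"
      using that by (auto simp: dual_sel dualD(3) A.smult_l_minus A.M.l_neg intro!: restrict_ext)
  qed
  show "(\<phi> \<oplus>\<^bsub>D\<^esub> \<psi>) \<oplus>\<^bsub>D\<^esub> \<chi> = \<phi> \<oplus>\<^bsub>D\<^esub> (\<psi> \<oplus>\<^bsub>D\<^esub> \<chi>)"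
    if "\<phi> \<in> carrier D" "\<psi> \<in> carrier D" "\<chi> \<in> carrier D" for \<phi> \<psi> \<chi>
    using that by (intro dual_eqI dual_closed) (simp_all add: dual_sel dualD(3) A.M.a_assoc)
  show "\<phi> \<oplus>\<^bsub>D\<^esub> \<psi> = \<psi> \<oplus>\<^bsub>D\<^esub> \<phi>" if "\<phi> \<in> carrier D" "\<psi> \<in> carrier D" for \<phi> \<psi>
    using that by (intro dual_eqI dual_closed) (simp_all add: dual_sel dualD(3) A.M.a_comm)
  show "\<zero>\<^bsub>D\<^esub> \<oplus>\<^bsub>D\<^esub> \<phi> = \<phi>" if "\<phi> \<in> carrier D" for \<phi>
    using that by (intro dual_eqI dual_closed) (simp_all add: dual_sel dualD(3))
qed (rule dual_closed; assumption?)+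

sublocale D: abelian_group D by (rule abelian_dual)

lemma dual_eval_additive: "x \<in> carrier M \<Longrightarrow> (\<lambda>\<phi>. \<phi> x) \<in> additive D A"
  by (rule additiveI) (auto simp: dualD(3) dual_sel)

lemma dual_finsum_eval:
  assumes "x \<in> carrier M" "\<And>i. i \<in> S \<Longrightarrow> \<phi> i \<in> carrier D"
  shows "(\<Oplus>\<^bsub>D\<^esub>i\<in>S. \<phi> i) x = (\<Oplus>\<^bsub>A\<^esub>i\<in>S. \<phi> i x)"
  using assms
  by (intro additive_finsum[OF abelian_dual A.M.abelian_group_axioms dual_eval_additive[OF assms(1)]]) auto

lemma dual_finsum:
  assumes \<phi>: "\<phi> \<in> carrier D" and x: "\<And>i. i \<in> S \<Longrightarrow> x i \<in> carrier M" and a: "\<And>i. i \<in> S \<Longrightarrow> a i \<in> carrier A"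
  shows "\<phi> (\<Oplus>\<^bsub>M\<^esub>i\<in>S. x i \<triangleleft>\<^bsub>M\<^esub> a i) = (\<Oplus>\<^bsub>A\<^esub>i\<in>S. \<phi> (x i) \<otimes>\<^bsub>A\<^esub> a i)"
proof -
  have "\<phi> (\<Oplus>\<^bsub>M\<^esub>i\<in>S. x i \<triangleleft>\<^bsub>M\<^esub> a i) = (\<Oplus>\<^bsub>A\<^esub>i\<in>S. \<phi> (x i \<triangleleft>\<^bsub>M\<^esub> a i))"
    using x a by (intro additive_finsum[OF M.abelian_group_axioms A.M.abelian_group_axioms dualD(2)[OF \<phi>]])
      (auto intro: rs_closed)
  also have "\<dots> = (\<Oplus>\<^bsub>A\<^esub>i\<in>S. \<phi> (x i) \<otimes>\<^bsub>A\<^esub> a i)"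
    using x a by (intro A.M.finsum_cong') (auto simp: dualD[OF \<phi>] intro!: A.alg_m_closed)
  finally show ?thesis .
qed

lemma tensor_pair_dual: "tensor_pair k A M D"
  by (intro tensor_pair.intro M.abelian_group_axioms abelian_dual rs_closed dual_closed M.smult_closed)

definition dual_basis :: "nat \<Rightarrow> (nat \<Rightarrow> 'm) \<Rightarrow> (nat \<Rightarrow> 'm \<Rightarrow> 'a) \<Rightarrow> bool" where
  "dual_basis n z z' \<longleftrightarrow> z \<in> {..<n} \<rightarrow> carrier M \<and> z' \<in> {..<n} \<rightarrow> carrier D \<and>
     (\<forall>x\<in>carrier M. x = (\<Oplus>\<^bsub>M\<^esub>l\<in>{..<n}. z l \<triangleleft>\<^bsub>M\<^esub> z' l x))"

text \<open>Apply \<open>\<phi>\<close> to the expansion of \<open>x\<close>. The second condition in \<^const>\<open>is_dual_basis\<close> therefore follows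
  from the first.\<close>

lemma dual_basis_expansion:
  assumes b: "dual_basis n z z'" and \<phi>: "\<phi> \<in> carrier D"
  shows "\<phi> = (\<Oplus>\<^bsub>D\<^esub>l\<in>{..<n}. \<phi> (z l) \<triangleright>\<^bsub>D\<^esub> z' l)"
proof (rule dual_eqI)
  have z: "z l \<in> carrier M" "z' l \<in> carrier D" if "l < n" for l
    using b that by (auto simp: dual_basis_def)
  show "(\<Oplus>\<^bsub>D\<^esub>l\<in>{..<n}. \<phi> (z l) \<triangleright>\<^bsub>D\<^esub> z' l) \<in> carrier D"
    by (intro D.finsum_closed) (auto intro!: dual_closed dualD[OF \<phi>] z)
  fix x assume x: "x \<in> carrier M"
  have "\<phi> x = \<phi> (\<Oplus>\<^bsub>M\<^esub>l\<in>{..<n}. z l \<triangleleft>\<^bsub>M\<^esub> z' l x)"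
    using b x unfolding dual_basis_def by metis
  also have "\<dots> = (\<Oplus>\<^bsub>A\<^esub>l\<in>{..<n}. \<phi> (z l) \<otimes>\<^bsub>A\<^esub> z' l x)"
    by (rule dual_finsum[OF \<phi>]) (auto intro: z dualD[OF z(2)] x)
  also have "\<dots> = (\<Oplus>\<^bsub>A\<^esub>l\<in>{..<n}. (\<phi> (z l) \<triangleright>\<^bsub>D\<^esub> z' l) x)"
    using x by (intro A.M.finsum_cong') (auto simp: dual_sel intro!: A.alg_m_closed dualD[OF \<phi>] dualD[OF z(2)] z)
  also have "\<dots> = (\<Oplus>\<^bsub>D\<^esub>l\<in>{..<n}. \<phi> (z l) \<triangleright>\<^bsub>D\<^esub> z' l) x"
    by (intro dual_finsum_eval[symmetric] x) (auto intro!: dual_closed dualD[OF \<phi>] z)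
  finally show "\<phi> x = (\<Oplus>\<^bsub>D\<^esub>l\<in>{..<n}. \<phi> (z l) \<triangleright>\<^bsub>D\<^esub> z' l) x" .
qed fact

lemma is_dual_basis_iff:
  "is_dual_basis k A M E \<longleftrightarrow> (\<exists>n z z'. dual_basis n z z' \<and> E = tensor_sum k A M D n z z')"
proof
  show "is_dual_basis k A M E \<Longrightarrow> \<exists>n z z'. dual_basis n z z' \<and> E = tensor_sum k A M D n z z'"
    unfolding is_dual_basis_def dual_basis_def by blast
next
  assume "\<exists>n z z'. dual_basis n z z' \<and> E = tensor_sum k A M D n z z'"
  then obtain n z z' where b: "dual_basis n z z'" and E: "E = tensor_sum k A M D n z z'" by blast
  show "is_dual_basis k A M E"
    unfolding is_dual_basis_def
  proof (intro exI conjI ballI)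
    show "\<phi> = (\<Oplus>\<^bsub>D\<^esub>l\<in>{..<n}. \<phi> (z l) \<triangleright>\<^bsub>D\<^esub> z' l)" if "\<phi> \<in> carrier D" for \<phi>
      by (rule dual_basis_expansion[OF b that])
    show "x = (\<Oplus>\<^bsub>M\<^esub>l\<in>{..<n}. z l \<triangleleft>\<^bsub>M\<^esub> z' l x)" if "x \<in> carrier M" for x
      using b that unfolding dual_basis_def by blast
  qed (use b E in \<open>simp_all add: dual_basis_def\<close>)
qed

text \<open>Expand the functionals of the first dual basis in the second one and move the coefficients
  \<open>z' l (u r)\<close> across the tensor sign: what is left over there is the expansion of \<open>u r\<close> in the first.\<close>

lemma dual_basis_tensor_unique:
  assumes b: "dual_basis n z z'" and c: "dual_basis m u v"
  shows "tensor_sum k A M D n z z' = tensor_sum k A M D m u v"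
proof -
  interpret MD: tensor_pair k A M D by (rule tensor_pair_dual)
  have z: "z l \<in> carrier M" "z' l \<in> carrier D" if "l < n" for l
    using b that by (auto simp: dual_basis_def)
  have u: "u l \<in> carrier M" "v l \<in> carrier D" if "l < m" for l
    using c that by (auto simp: dual_basis_def)
  have "tensor_sum k A M D n z z' =
      (\<Oplus>\<^bsub>MD.T\<^esub>l\<in>{..<n}. MD.pure (z l) (\<Oplus>\<^bsub>D\<^esub>r\<in>{..<m}. z' l (u r) \<triangleright>\<^bsub>D\<^esub> v r))"
    unfolding tensor_sum_def
  proof (intro MD.T.finsum_cong')
    show eq: "MD.pure (z l) (z' l) = MD.pure (z l) (\<Oplus>\<^bsub>D\<^esub>r\<in>{..<m}. z' l (u r) \<triangleright>\<^bsub>D\<^esub> v r)"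
      if "l \<in> {..<n}" for l
      using that dual_basis_expansion[OF c z(2), of l] by simp
    show "(\<lambda>l. MD.pure (z l) (\<Oplus>\<^bsub>D\<^esub>r\<in>{..<m}. z' l (u r) \<triangleright>\<^bsub>D\<^esub> v r)) \<in> {..<n} \<rightarrow> carrier MD.T"
    proof (rule Pi_I)
      fix l assume l: "l \<in> {..<n}"
      show "MD.pure (z l) (\<Oplus>\<^bsub>D\<^esub>r\<in>{..<m}. z' l (u r) \<triangleright>\<^bsub>D\<^esub> v r) \<in> carrier MD.T"
        unfolding eq[OF l, symmetric] using l z by (intro MD.pure_closed) auto
    qed
  qed simp
  also have "\<dots> = (\<Oplus>\<^bsub>MD.T\<^esub>r\<in>{..<m}. MD.pure (\<Oplus>\<^bsub>M\<^esub>l\<in>{..<n}. z l \<triangleleft>\<^bsub>M\<^esub> z' l (u r)) (v r))"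
    by (rule MD.balanced_finsum_exchange[OF MD.abelian_tensor MD.pure_balanced])
       (auto intro: z u dualD[OF z(2)])
  also have "\<dots> = (\<Oplus>\<^bsub>MD.T\<^esub>r\<in>{..<m}. MD.pure (u r) (v r))"
  proof (intro MD.T.finsum_cong')
    fix r assume "r \<in> {..<m}"
    then have "u r = (\<Oplus>\<^bsub>M\<^esub>l\<in>{..<n}. z l \<triangleleft>\<^bsub>M\<^esub> z' l (u r))"
      using b u unfolding dual_basis_def by blast
    then show "MD.pure (\<Oplus>\<^bsub>M\<^esub>l\<in>{..<n}. z l \<triangleleft>\<^bsub>M\<^esub> z' l (u r)) (v r) = MD.pure (u r) (v r)"
      by simp
  qed (auto intro: MD.pure_closed u)
  finally show ?thesis by (simp add: tensor_sum_def)
qed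

lemma finite_dual_basis_eq:
  assumes "dual_basis n z z'"
  shows "finite_dual_basis k A M = tensor_sum k A M D n z z'"
  unfolding finite_dual_basis_def
proof (rule the_equality)
  show "is_dual_basis k A M (tensor_sum k A M D n z z')"
    unfolding is_dual_basis_iff using assms by blast
  show "E = tensor_sum k A M D n z z'" if "is_dual_basis k A M E" for E
    using that dual_basis_tensor_unique[OF _ assms] unfolding is_dual_basis_iff by blast
qed

text \<open>Let \<open>M\<close> be a summand of a free module by \<open>s\<close> and \<open>r\<close>. The images under \<open>s\<close> of finitely many
  generators involve only a finite set \<open>S0\<close> of coordinates, hence so does all of \<open>s(M)\<close>; the images
  under \<open>r\<close> of the unit vectors at \<open>S0\<close> and the coordinate functions at \<open>S0\<close> form a dual basis.\<close>

lemma dual_basis_exists: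
  assumes fg: "fin_gen_right A M" and proj: "projective_right A M"
  shows "\<exists>n z z'. dual_basis n z z'"
proof -
  obtain X where X: "finite X" "X \<subseteq> carrier M"
    and gen: "\<And>m. m \<in> carrier M \<Longrightarrow> \<exists>f \<in> X \<rightarrow> carrier A. m = (\<Oplus>\<^bsub>M\<^esub>x\<in>X. x \<triangleleft>\<^bsub>M\<^esub> f x)"
    using fg by (auto simp: fin_gen_right_def)
  obtain S :: "'m set" and s r where s: "s \<in> right_hom A M (free_module A S)"
    and r: "r \<in> right_hom A (free_module A S) M" and rs: "\<And>m. m \<in> carrier M \<Longrightarrow> r (s m) = m"
    using proj by (auto simp: projective_right_def)
  let ?F = "free_module A S"
  have sF: "s m \<in> carrier ?F" if "m \<in> carrier M" for m
    using s that by (auto simp: right_hom_def)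
  have s_coord: "(\<lambda>m\<in>carrier M. s m t) \<in> carrier D" if t: "t \<in> S" for t
  proof (rule dualI)
    fix x y assume "x \<in> carrier M" "y \<in> carrier M"
    then show "(\<lambda>m\<in>carrier M. s m t) (x \<oplus>\<^bsub>M\<^esub> y) = (\<lambda>m\<in>carrier M. s m t) x \<oplus>\<^bsub>A\<^esub> (\<lambda>m\<in>carrier M. s m t) y"
      using s t by (auto simp: right_hom_def free_module_def)
  next
    fix x a assume "x \<in> carrier M" "a \<in> carrier A"
    then show "(\<lambda>m\<in>carrier M. s m t) (x \<triangleleft>\<^bsub>M\<^esub> a) = (\<lambda>m\<in>carrier M. s m t) x \<otimes>\<^bsub>A\<^esub> a"
      using s t by (auto simp: right_hom_def free_module_def rs_closed)
  qed (use sF t in \<open>auto simp: free_module_def\<close>)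
  define S0 where "S0 = (\<Union>x\<in>X. {t \<in> S. s x t \<noteq> \<zero>\<^bsub>A\<^esub>})"
  have S0: "finite S0" "S0 \<subseteq> S"
    unfolding S0_def using X sF by (auto simp: free_module_def)
  have outside: "s m t = \<zero>\<^bsub>A\<^esub>" if m: "m \<in> carrier M" and t: "t \<in> S - S0" for m t
  proof -
    obtain f where f: "f \<in> X \<rightarrow> carrier A" "m = (\<Oplus>\<^bsub>M\<^esub>x\<in>X. x \<triangleleft>\<^bsub>M\<^esub> f x)" using gen[OF m] by blast
    have "s m t = (\<lambda>m\<in>carrier M. s m t) m" using m by simp
    also have "\<dots> = (\<Oplus>\<^bsub>A\<^esub>x\<in>X. (\<lambda>m\<in>carrier M. s m t) x \<otimes>\<^bsub>A\<^esub> f x)"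
      unfolding f(2) using t f(1) X(2) by (intro dual_finsum[OF s_coord]) auto
    also have "\<dots> = (\<Oplus>\<^bsub>A\<^esub>x\<in>X. \<zero>\<^bsub>A\<^esub>)"
    proof (intro A.M.finsum_cong')
      fix x assume x: "x \<in> X"
      have "s x t = \<zero>\<^bsub>A\<^esub>" using x t by (auto simp: S0_def)
      moreover have "\<zero>\<^bsub>A\<^esub> \<otimes>\<^bsub>A\<^esub> f x = \<zero>\<^bsub>A\<^esub>"
        using f(1) x by (intro A.alg_l_null) auto
      ultimately show "(\<lambda>m\<in>carrier M. s m t) x \<otimes>\<^bsub>A\<^esub> f x = \<zero>\<^bsub>A\<^esub>" using x X(2) by auto
    qed auto
    finally show ?thesis by simp
  qed
  define \<delta> where "\<delta> t = (\<lambda>u\<in>S. if u = t then \<one>\<^bsub>A\<^esub> else \<zero>\<^bsub>A\<^esub>)" for t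
  have \<delta>: "\<delta> t \<in> carrier ?F" for t
    by (auto simp: free_module_def \<delta>_def)
  have r_closed: "r g \<in> carrier M" if "g \<in> carrier ?F" for g
    using r that by (auto simp: right_hom_def)
  have r_add: "r (g \<oplus>\<^bsub>?F\<^esub> h) = r g \<oplus>\<^bsub>M\<^esub> r h" if "g \<in> carrier ?F" "h \<in> carrier ?F" for g h
    using r that by (auto simp: right_hom_def)
  have r_act: "r (g \<triangleleft>\<^bsub>?F\<^esub> a) = r g \<triangleleft>\<^bsub>M\<^esub> a" if "g \<in> carrier ?F" "a \<in> carrier A" for g a
    using r that by (auto simp: right_hom_def)
  have expand: "r g = (\<Oplus>\<^bsub>M\<^esub>t\<in>U. r (\<delta> t) \<triangleleft>\<^bsub>M\<^esub> g t)"
    if "finite U" "U \<subseteq> S" "g \<in> carrier ?F" "\<forall>t\<in>S - U. g t = \<zero>\<^bsub>A\<^esub>" for U g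
    using that
  proof (induction U arbitrary: g rule: finite_induct)
    case empty
    \<comment> \<open>The vanishing of \<open>r\<close> at \<open>0\<close> comes from additivity alone: \<open>g = g + g\<close> for \<open>g = 0\<close>.\<close>
    have "g \<oplus>\<^bsub>?F\<^esub> g = g"
      using empty by (auto simp: free_module_def PiE_iff extensional_def fun_eq_iff)
    then have "r g \<oplus>\<^bsub>M\<^esub> r g = r g" using r_add empty.prems(2) by metis
    then show ?case using r_closed[OF empty.prems(2)] by (simp add: M.add.l_cancel_one')
  next
    case (insert t U)
    have gA: "g u \<in> carrier A" if "u \<in> S" for u
      using insert.prems(2) that by (auto simp: free_module_def)
    \<comment> \<open>Splitting off the coordinate \<open>t\<close> as \<open>g = g' + \<delta> t g(t)\<close>.\<close>
    define g' where "g' = (\<lambda>u\<in>S. if u = t then \<zero>\<^bsub>A\<^esub> else g u)"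
    have g': "g' \<in> carrier ?F"
    proof -
      have "{u \<in> S. g' u \<noteq> \<zero>\<^bsub>A\<^esub>} \<subseteq> {u \<in> S. g u \<noteq> \<zero>\<^bsub>A\<^esub>}" by (auto simp: g'_def)
      moreover have "finite {u \<in> S. g u \<noteq> \<zero>\<^bsub>A\<^esub>}"
        using insert.prems(2) by (simp add: free_module_def)
      ultimately have "finite {u \<in> S. g' u \<noteq> \<zero>\<^bsub>A\<^esub>}" by (rule finite_subset)
      moreover have "g' \<in> S \<rightarrow>\<^sub>E carrier A" using gA by (auto simp: g'_def)
      ultimately show ?thesis by (simp add: free_module_def)
    qed
    have t: "t \<in> S" using insert.prems(1) by auto
    have da: "\<delta> t \<triangleleft>\<^bsub>?F\<^esub> g t \<in> carrier ?F"
    proof -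
      have "{u \<in> S. (\<delta> t \<triangleleft>\<^bsub>?F\<^esub> g t) u \<noteq> \<zero>\<^bsub>A\<^esub>} \<subseteq> {t}"
        using gA[OF t] by (auto simp: free_module_def \<delta>_def A.alg_l_null)
      then have "finite {u \<in> S. (\<delta> t \<triangleleft>\<^bsub>?F\<^esub> g t) u \<noteq> \<zero>\<^bsub>A\<^esub>}" by (rule finite_subset) simp
      moreover have "\<delta> t \<triangleleft>\<^bsub>?F\<^esub> g t \<in> S \<rightarrow>\<^sub>E carrier A"
        using gA[OF t] by (auto simp: free_module_def \<delta>_def A.alg_m_closed)
      ultimately show ?thesis by (simp add: free_module_def)
    qed
    have "g = g' \<oplus>\<^bsub>?F\<^esub> (\<delta> t \<triangleleft>\<^bsub>?F\<^esub> g t)"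
    proof (rule extensionalityI[of _ S])
      show "g \<in> extensional S" using insert.prems(2) by (auto simp: free_module_def PiE_iff)
      show "g' \<oplus>\<^bsub>?F\<^esub> (\<delta> t \<triangleleft>\<^bsub>?F\<^esub> g t) \<in> extensional S" by (auto simp: free_module_def)
      show "g u = (g' \<oplus>\<^bsub>?F\<^esub> (\<delta> t \<triangleleft>\<^bsub>?F\<^esub> g t)) u" if "u \<in> S" for u
        using that gA t by (auto simp: free_module_def g'_def \<delta>_def A.alg_l_null)
    qed
    then have "r g = r g' \<oplus>\<^bsub>M\<^esub> (r (\<delta> t) \<triangleleft>\<^bsub>M\<^esub> g t)"
      using r_add[OF g' da] r_act[OF \<delta> gA[OF t]] by metis
    also have "r g' = (\<Oplus>\<^bsub>M\<^esub>u\<in>U. r (\<delta> u) \<triangleleft>\<^bsub>M\<^esub> g' u)"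
      using insert.prems by (intro insert.IH g') (auto simp: g'_def)
    also have "\<dots> = (\<Oplus>\<^bsub>M\<^esub>u\<in>U. r (\<delta> u) \<triangleleft>\<^bsub>M\<^esub> g u)"
      using insert gA by (intro M.finsum_cong') (auto simp: g'_def intro!: rs_closed r_closed \<delta>)
    finally show ?case
      using insert gA t
      by (subst M.finsum_insert) (auto intro!: rs_closed r_closed \<delta> M.finsum_closed M.a_comm)
  qed
  obtain h where h: "bij_betw h {..<card S0} S0"
    using ex_bij_betw_nat_finite[OF S0(1)] by (auto simp: atLeast0LessThan)
  have hS: "h l \<in> S" if "l < card S0" for l
    using h S0(2) that by (auto simp: bij_betw_def)
  have "dual_basis (card S0) (\<lambda>l. r (\<delta> (h l))) (\<lambda>l. \<lambda>m\<in>carrier M. s m (h l))"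
    unfolding dual_basis_def
  proof (intro conjI ballI)
    fix x assume x: "x \<in> carrier M"
    have cl: "r (\<delta> t) \<triangleleft>\<^bsub>M\<^esub> s x t \<in> carrier M" if "t \<in> S0" for t
      using sF[OF x] S0(2) that by (intro rs_closed r_closed \<delta>) (auto simp: free_module_def)
    have "x = r (s x)" using rs x by simp
    also have "\<dots> = (\<Oplus>\<^bsub>M\<^esub>t\<in>S0. r (\<delta> t) \<triangleleft>\<^bsub>M\<^esub> s x t)"
      using outside x S0 sF by (intro expand) auto
    also have "\<dots> = (\<Oplus>\<^bsub>M\<^esub>t\<in>h ` {..<card S0}. r (\<delta> t) \<triangleleft>\<^bsub>M\<^esub> s x t)"
      using h by (simp add: bij_betw_def)
    also have "\<dots> = (\<Oplus>\<^bsub>M\<^esub>l\<in>{..<card S0}. r (\<delta> (h l)) \<triangleleft>\<^bsub>M\<^esub> s x (h l))"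
      using h cl by (intro M.finsum_reindex) (auto simp: bij_betw_def)
    finally show "x = (\<Oplus>\<^bsub>M\<^esub>l\<in>{..<card S0}. r (\<delta> (h l)) \<triangleleft>\<^bsub>M\<^esub> (\<lambda>m\<in>carrier M. s m (h l)) x)"
      using x by simp
  qed (use r_closed \<delta> s_coord hS in auto)
  then show ?thesis by blast
qed

end

lemma right_module_bimodule:
  fixes k :: "'k ring" and A :: "('k, 'a) module" and B :: "('k, 'b) module"
    and P :: "('k, 'b, 'a, 'p) bimodule"
  assumes "unital_algebra k A" "bimodule k B A P"
  shows "right_module k A P"
proof -
  interpret bimodule k B A P by fact
  show ?thesis
    by (intro right_module.intro right_module_axioms.intro assms(1) module_axioms rsmult_closed)
qed

lemma right_module_local_part:
  fixes k :: "'k ring" and A :: "('k, 'a) module" and B :: "('k, 'b) module"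
    and P :: "('k, 'b, 'a, 'p) bimodule"
  assumes A: "unital_algebra k A" and P: "bimodule k B A P" and b: "b \<in> carrier B"
  shows "right_module k A (local_part P b)"
proof -
  interpret bimodule k B A P by fact
  let ?S = "(\<lambda>p. b \<triangleright>\<^bsub>P\<^esub> p) ` carrier P"
  have "b \<triangleright>\<^bsub>P\<^esub> \<zero>\<^bsub>P\<^esub> = \<zero>\<^bsub>P\<^esub>"
    using additive_zero[OF abelian abelian, of "\<lambda>p. b \<triangleright>\<^bsub>P\<^esub> p"] b
    by (simp add: additiveI lsmult_closed lsmult_r_distr)
  then have zero: "\<zero>\<^bsub>P\<^esub> \<in> ?S" by (metis M.zero_closed imageI)
  have "module k (P\<lparr>carrier := ?S\<rparr>)"
  proof (rule module_sub)
    show "x \<oplus>\<^bsub>P\<^esub> y \<in> ?S" if "x \<in> ?S" "y \<in> ?S" for x y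
      using that b by (auto simp flip: lsmult_r_distr)
    show "c \<odot>\<^bsub>P\<^esub> x \<in> ?S" if "c \<in> carrier k" "x \<in> ?S" for c x
      using that b by (auto simp flip: lsmult_smult_r)
  qed (use zero lsmult_closed[OF b] in auto)
  moreover have "x \<triangleleft>\<^bsub>P\<^esub> a \<in> ?S" if "x \<in> ?S" "a \<in> carrier A" for x a
    using that b by (auto simp: lsmult_rsmult intro!: imageI rsmult_closed)
  ultimately show ?thesis
    unfolding local_part_def by (intro right_module.intro right_module_axioms.intro A) auto
qed

text \<open>Functionals are only required to be \<open>A\<close>-linear; they are \<open>k\<close>-linear since \<open>c x = x (c 1)\<close>.\<close>

lemma dual_smult:
  fixes k :: "'k ring" and A :: "('k, 'a) module" and B :: "('k, 'b) module"
    and P :: "('k, 'b, 'a, 'p) bimodule"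
  assumes A: "unital_algebra k A" and P: "bimodule k B A P" and unital: "right_unital A P"
    and \<phi>: "\<phi> \<in> carrier (dual A P)" and c: "c \<in> carrier k" and x: "x \<in> carrier P"
  shows "\<phi> (c \<odot>\<^bsub>P\<^esub> x) = c \<odot>\<^bsub>A\<^esub> \<phi> x"
proof -
  interpret P: bimodule k B A P by fact
  interpret R: right_module k A P by (rule right_module_bimodule) fact+
  have "c \<odot>\<^bsub>P\<^esub> x = x \<triangleleft>\<^bsub>P\<^esub> (c \<odot>\<^bsub>A\<^esub> \<one>\<^bsub>A\<^esub>)"
    using c x unital by (simp add: P.rsmult_smult_r right_unital_def)
  also have "\<phi> \<dots> = c \<odot>\<^bsub>A\<^esub> \<phi> x"
    using c x \<phi> by (simp add: R.dualD(3,5) P.R.alg_smult_r)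
  finally show ?thesis .
qed

lemma bimodule_dual:
  fixes k :: "'k ring" and A :: "('k, 'a) module" and B :: "('k, 'b) module"
    and P :: "('k, 'b, 'a, 'p) bimodule"
  assumes A: "unital_algebra k A" and P: "bimodule k B A P" and unital: "right_unital A P"
  shows "bimodule k A B (dual A P)"
proof -
  interpret P: bimodule k B A P by fact
  interpret R: right_module k A P by (rule right_module_bimodule) fact+
  have act: "\<phi> \<triangleleft>\<^bsub>R.D\<^esub> b \<in> carrier R.D" if "\<phi> \<in> carrier R.D" "b \<in> carrier B" for \<phi> b
    using that by (intro R.dualI)
      (auto simp: R.dual_sel R.dualD(3-) P.lsmult_closed P.rsmult_closed P.lsmult_r_distr
        simp flip: P.lsmult_rsmult)
  note smult = dual_smult[OF A P unital]
  note [simp] = R.dual_closed act smult P.L.alg_m_closed P.lsmult_closed P.rsmult_closed R.dualD(3)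
  show ?thesis
  proof (rule bimoduleI)
    show "(\<lambda>\<phi>. c \<odot>\<^bsub>R.D\<^esub> \<phi>) \<in> additive R.D R.D" if "c \<in> carrier k" for c
      using that by (intro additiveI R.dual_eqI; (simp; fail)?) (simp_all add: R.dual_sel(2-) P.R.smult_r_distr)
    show "(\<lambda>\<phi>. a \<triangleright>\<^bsub>R.D\<^esub> \<phi>) \<in> additive R.D R.D" if "a \<in> carrier A" for a
      using that by (intro additiveI R.dual_eqI; (simp; fail)?) (simp_all add: R.dual_sel(2-) P.R.alg_r_distr)
    show "(\<lambda>\<phi>. \<phi> \<triangleleft>\<^bsub>R.D\<^esub> b) \<in> additive R.D R.D" if "b \<in> carrier B" for b
      using that by (intro additiveI R.dual_eqI; (simp; fail)?) (simp_all add: R.dual_sel(2-))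
  qed ((rule P.R.assoc_algebra_axioms P.L.assoc_algebra_axioms R.abelian_dual)+,
    (rule R.dual_eqI; (simp; fail)?; simp add: R.dual_sel(2-) P.R.smult_l_distr P.R.smult_assoc1 P.R.alg_l_distr
       P.R.alg_m_assoc P.R.alg_m_closed P.R.alg_smult_l P.R.alg_smult_r P.L.alg_m_closed R.dualD(4)
       P.lsmult_l_distr P.lsmult_assoc P.lsmult_smult_l)+)
qed

section \<open>Local units and the bimodule of locally supported functionals\<close>

locale comatrix_data =
  fixes k :: "'k ring" and A :: "('k, 'a) module" and B :: "('k, 'b) module"
    and I :: "'i set" and e :: "'i \<Rightarrow> 'b" and P :: "('k, 'b, 'a, 'p) bimodule"
  assumes unital_A: "unital_algebra k A" and alg_B: "assoc_algebra k B"
    and loc_units: "idempotent_local_units B I e"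
    and bimod_P: "bimodule k B A P" and firm_P: "firm_left k B P" and unital_P: "right_unital A P"
    and fin_gen: "\<And>i. i \<in> I \<Longrightarrow> fin_gen_right A (local_part P (e i))"
    and projective: "\<And>i. i \<in> I \<Longrightarrow> projective_right A (local_part P (e i))"
begin

sublocale A: unital_algebra k A by (rule unital_A)
sublocale B: assoc_algebra k B by (rule alg_B)
sublocale U: idempotent_local_units B I e by (rule loc_units)
sublocale P: bimodule k B A P by (rule bimod_P)
sublocale RP: right_module k A P by (rule right_module_bimodule[OF unital_A bimod_P])

lemma abelian_A: "abelian_group A" by (rule A.M.abelian_group_axioms)

abbreviation "Dg \<equiv> dagger A I e P"

lemma unit_above:
  assumes "i \<in> I" "j \<in> I"
  shows "\<exists>l\<in>I. e l \<otimes>\<^bsub>B\<^esub> e i = e i \<and> e l \<otimes>\<^bsub>B\<^esub> e j = e j"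
  using U.local_units[of "{e i, e j}"] assms U.unit_closed by auto

lemma unit_fixes_above:
  assumes "i \<in> I" "l \<in> I" "e l \<otimes>\<^bsub>B\<^esub> e i = e i" "e i \<triangleright>\<^bsub>P\<^esub> p = p" "p \<in> carrier P"
  shows "e l \<triangleright>\<^bsub>P\<^esub> p = p"
  using assms P.lsmult_assoc[of "e l" "e i" p] U.unit_closed by metis

text \<open>Firmness writes \<open>p\<close> as a sum of elements \<open>b x\<close>, and some \<open>e\<^sub>i\<close> fixes the finitely many \<open>b\<close>.\<close>

lemma local_unit_fixes:
  assumes p: "p \<in> carrier P"
  shows "\<exists>i\<in>I. e i \<triangleright>\<^bsub>P\<^esub> p = p"
proof -
  interpret BP: bimodule_pair k B B A "regular_bimodule B" P
    by (intro bimodule_pair.intro bimodule_regular alg_B bimod_P)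
  have "balanced k B (regular_bimodule B) P P (\<lambda>a x. a \<triangleright>\<^bsub>P\<^esub> x)"
    by (rule balancedI) (simp_all add: P.lsmult_closed P.lsmult_l_distr P.lsmult_r_distr P.lsmult_assoc
        P.lsmult_smult_l P.lsmult_smult_r)
  note m = BP.tensor_lift[OF P.abelian this, folded left_action_map_def]
  have "\<exists>i\<in>I. e i \<triangleright>\<^bsub>P\<^esub> left_action_map k B P t = left_action_map k B P t" if "t \<in> carrier BP.T" for t
    using that
  proof (induction rule: BP.tensor_induct)
    case (pure b x)
    then obtain i where "i \<in> I" "e i \<otimes>\<^bsub>B\<^esub> b = b" using U.local_units[of "{b}"] by auto
    then show ?case
      using pure U.unit_closed by (intro bexI[of _ i]) (simp_all add: m(2) flip: P.lsmult_assoc)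
  next
    case (add s t)
    then obtain i j where ij: "i \<in> I" "e i \<triangleright>\<^bsub>P\<^esub> left_action_map k B P s = left_action_map k B P s"
      "j \<in> I" "e j \<triangleright>\<^bsub>P\<^esub> left_action_map k B P t = left_action_map k B P t" by blast
    obtain l where l: "l \<in> I" "e l \<otimes>\<^bsub>B\<^esub> e i = e i" "e l \<otimes>\<^bsub>B\<^esub> e j = e j"
      using unit_above[OF ij(1,3)] by blast
    note cl = additive_closed[OF m(1)]
    have "e l \<triangleright>\<^bsub>P\<^esub> left_action_map k B P s = left_action_map k B P s"
      "e l \<triangleright>\<^bsub>P\<^esub> left_action_map k B P t = left_action_map k B P t"
      using unit_fixes_above[OF ij(1) l(1,2) ij(2) cl] unit_fixes_above[OF ij(3) l(1,3) ij(4) cl] add by auto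
    then show ?case
      using l(1) add(1,2) U.unit_closed cl by (intro bexI[of _ l]) (simp_all add: additive_add[OF m(1)] P.lsmult_r_distr)
  qed
  note fixes_image = this
  have "p \<in> left_action_map k B P ` carrier BP.T"
    using firm_P p by (simp add: firm_left_def bij_betw_def)
  then obtain t where "p = left_action_map k B P t" "t \<in> carrier BP.T" by (rule imageE)
  then show ?thesis using fixes_image[of t] by simp
qed

lemma unit_idem_act: "e i \<triangleright>\<^bsub>P\<^esub> (e i \<triangleright>\<^bsub>P\<^esub> p) = e i \<triangleright>\<^bsub>P\<^esub> p" if "i \<in> I" "p \<in> carrier P"
  using that U.unit_closed U.unit_idem by (simp flip: P.lsmult_assoc)

lemma local_part_iff:
  assumes "i \<in> I"
  shows "p \<in> carrier (local_part P (e i)) \<longleftrightarrow> p \<in> carrier P \<and> e i \<triangleright>\<^bsub>P\<^esub> p = p"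
proof
  assume "p \<in> carrier (local_part P (e i))"
  then obtain q where "q \<in> carrier P" "p = e i \<triangleright>\<^bsub>P\<^esub> q" by (auto simp: local_part_def)
  then show "p \<in> carrier P \<and> e i \<triangleright>\<^bsub>P\<^esub> p = p"
    using assms U.unit_closed unit_idem_act P.lsmult_closed by simp
next
  assume "p \<in> carrier P \<and> e i \<triangleright>\<^bsub>P\<^esub> p = p"
  then show "p \<in> carrier (local_part P (e i))"
    unfolding local_part_def by (auto intro!: image_eqI[of p _ p])
qed

lemma dagger_iff:
  "\<phi> \<in> carrier Dg \<longleftrightarrow> \<phi> \<in> carrier RP.D \<and> (\<exists>i\<in>I. \<forall>q\<in>carrier P. \<phi> (e i \<triangleright>\<^bsub>P\<^esub> q) = \<phi> q)"
proof -
  have "\<phi> = compose (carrier P) (compose (carrier (local_part P (e i))) \<phi> (local_incl P (e i)))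
            (local_proj P (e i)) \<longleftrightarrow> (\<forall>q\<in>carrier P. \<phi> (e i \<triangleright>\<^bsub>P\<^esub> q) = \<phi> q)"
    if "\<phi> \<in> carrier RP.D" "i \<in> I" for i
  proof -
    have "compose (carrier P) (compose (carrier (local_part P (e i))) \<phi> (local_incl P (e i)))
            (local_proj P (e i)) = (\<lambda>q\<in>carrier P. \<phi> (e i \<triangleright>\<^bsub>P\<^esub> q))"
      by (auto simp: compose_def local_proj_def local_incl_def local_part_def)
    moreover have "\<phi> = (\<lambda>q\<in>carrier P. \<phi> (e i \<triangleright>\<^bsub>P\<^esub> q)) \<longleftrightarrow> (\<forall>q\<in>carrier P. \<phi> (e i \<triangleright>\<^bsub>P\<^esub> q) = \<phi> q)"
      using RP.dualD(1)[OF that(1)] by (auto simp: fun_eq_iff extensional_def restrict_def)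
    ultimately show ?thesis by simp
  qed
  then show ?thesis by (auto simp: dagger_def)
qed

lemma dagger_sel:
  "\<zero>\<^bsub>Dg\<^esub> = \<zero>\<^bsub>RP.D\<^esub>" "\<phi> \<oplus>\<^bsub>Dg\<^esub> \<psi> = \<phi> \<oplus>\<^bsub>RP.D\<^esub> \<psi>"
  "c \<odot>\<^bsub>Dg\<^esub> \<phi> = c \<odot>\<^bsub>RP.D\<^esub> \<phi>" "a \<triangleright>\<^bsub>Dg\<^esub> \<phi> = a \<triangleright>\<^bsub>RP.D\<^esub> \<phi>" "\<phi> \<triangleleft>\<^bsub>Dg\<^esub> b = \<phi> \<triangleleft>\<^bsub>RP.D\<^esub> b"
  by (simp_all add: dagger_def)

lemmas dagger_apply = dagger_sel[unfolded RP.dual_sel]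

lemma dagger_dual: "\<phi> \<in> carrier Dg \<Longrightarrow> \<phi> \<in> carrier RP.D"
  by (simp add: dagger_iff)

lemmas daggerD = RP.dualD[OF dagger_dual]

text \<open>Elements of \<open>P\<close> and of \<open>P\<^sup>\<dagger>\<close> come with a local unit each, and a unit that is neutral for all of
  these finitely many idempotents fixes the elements as well.\<close>

lemma common_unit:
  assumes F: "finite F" "F \<subseteq> carrier B" and X: "finite X" "X \<subseteq> carrier P"
    and \<Phi>: "finite \<Phi>" "\<Phi> \<subseteq> carrier Dg"
  obtains i where "i \<in> I" "\<And>b. b \<in> F \<Longrightarrow> e i \<otimes>\<^bsub>B\<^esub> b = b" "\<And>b. b \<in> F \<Longrightarrow> b \<otimes>\<^bsub>B\<^esub> e i = b"
    "\<And>p. p \<in> X \<Longrightarrow> e i \<triangleright>\<^bsub>P\<^esub> p = p"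
    "\<And>\<phi> q. \<phi> \<in> \<Phi> \<Longrightarrow> q \<in> carrier P \<Longrightarrow> \<phi> (e i \<triangleright>\<^bsub>P\<^esub> q) = \<phi> q"
proof -
  obtain ix where ix: "\<And>p. p \<in> carrier P \<Longrightarrow> ix p \<in> I \<and> e (ix p) \<triangleright>\<^bsub>P\<^esub> p = p"
    using local_unit_fixes by metis
  obtain idx where idx: "\<And>\<phi>. \<phi> \<in> carrier Dg \<Longrightarrow> idx \<phi> \<in> I \<and> (\<forall>q\<in>carrier P. \<phi> (e (idx \<phi>) \<triangleright>\<^bsub>P\<^esub> q) = \<phi> q)"
    using dagger_iff by metis
  let ?F = "F \<union> (\<lambda>p. e (ix p)) ` X \<union> (\<lambda>\<phi>. e (idx \<phi>)) ` \<Phi>"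
  have "finite ?F" "?F \<subseteq> carrier B"
    using assms ix idx U.unit_closed by auto
  then obtain i where i: "i \<in> I" "\<And>b. b \<in> ?F \<Longrightarrow> e i \<otimes>\<^bsub>B\<^esub> b = b \<and> b \<otimes>\<^bsub>B\<^esub> e i = b"
    using U.local_units by metis
  show ?thesis
  proof (rule that[OF i(1)])
    show "e i \<triangleright>\<^bsub>P\<^esub> p = p" if "p \<in> X" for p
      using that X ix[of p] i unit_fixes_above[of "ix p" i p] by auto
    show "\<phi> (e i \<triangleright>\<^bsub>P\<^esub> q) = \<phi> q" if "\<phi> \<in> \<Phi>" "q \<in> carrier P" for \<phi> q
    proof -
      have \<phi>: "idx \<phi> \<in> I" "\<And>q. q \<in> carrier P \<Longrightarrow> \<phi> (e (idx \<phi>) \<triangleright>\<^bsub>P\<^esub> q) = \<phi> q"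
        using idx that \<Phi> by blast+
      have "\<phi> (e i \<triangleright>\<^bsub>P\<^esub> q) = \<phi> ((e (idx \<phi>) \<otimes>\<^bsub>B\<^esub> e i) \<triangleright>\<^bsub>P\<^esub> q)"
        using \<phi> i(1) that(2) U.unit_closed by (simp add: P.lsmult_assoc P.lsmult_closed)
      also have "e (idx \<phi>) \<otimes>\<^bsub>B\<^esub> e i = e (idx \<phi>)" using i(2) that(1) by auto
      finally show ?thesis using \<phi> that by simp
    qed
  qed (use i in auto)
qed

text \<open>\<open>P\<^sup>\<dagger>\<close> is closed under addition because the order on the local units is directed.\<close>

lemma dagger_bimodule: "bimodule k A B Dg"
proof -
  let ?S = "carrier Dg"
  interpret D: bimodule k A B RP.D by (rule bimodule_dual[OF unital_A bimod_P unital_P])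
  have "bimodule k A B (RP.D\<lparr>carrier := ?S\<rparr>)"
  proof (rule sub_bimodule[OF D.bimodule_axioms])
    show "?S \<subseteq> carrier RP.D" using dagger_dual by blast
    obtain i where "i \<in> I" using U.local_units[of "{}"] by auto
    then show "\<zero>\<^bsub>RP.D\<^esub> \<in> ?S"
      using U.unit_closed by (auto simp: dagger_iff RP.dual_closed) (auto simp: RP.dual_sel P.lsmult_closed)
  next
    fix \<phi> \<psi> assume *: "\<phi> \<in> ?S" "\<psi> \<in> ?S"
    obtain i where i: "i \<in> I" "\<And>\<chi> q. \<chi> \<in> {\<phi>, \<psi>} \<Longrightarrow> q \<in> carrier P \<Longrightarrow> \<chi> (e i \<triangleright>\<^bsub>P\<^esub> q) = \<chi> q"
      by (rule common_unit[of "{}" "{}" "{\<phi>, \<psi>}"]) (use * in auto)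
    show "\<phi> \<oplus>\<^bsub>RP.D\<^esub> \<psi> \<in> ?S"
      unfolding dagger_iff
    proof (intro conjI bexI[OF _ i(1)] ballI)
      show "\<phi> \<oplus>\<^bsub>RP.D\<^esub> \<psi> \<in> carrier RP.D" using * dagger_dual RP.dual_closed by blast
    qed (use i(1) i(2)[of \<phi>] i(2)[of \<psi>] U.unit_closed in \<open>simp add: RP.dual_sel P.lsmult_closed\<close>)
  next
    fix c \<phi> assume *: "c \<in> carrier k" "\<phi> \<in> ?S"
    then obtain i where i: "i \<in> I" "\<And>q. q \<in> carrier P \<Longrightarrow> \<phi> (e i \<triangleright>\<^bsub>P\<^esub> q) = \<phi> q"
      by (auto simp: dagger_iff)
    show "c \<odot>\<^bsub>RP.D\<^esub> \<phi> \<in> ?S"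
      unfolding dagger_iff
    proof (intro conjI bexI[OF _ i(1)] ballI)
      show "c \<odot>\<^bsub>RP.D\<^esub> \<phi> \<in> carrier RP.D" using * dagger_dual RP.dual_closed by blast
    qed (use i U.unit_closed in \<open>auto simp: RP.dual_sel P.lsmult_closed\<close>)
  next
    fix a \<phi> assume *: "a \<in> carrier A" "\<phi> \<in> ?S"
    then obtain i where i: "i \<in> I" "\<And>q. q \<in> carrier P \<Longrightarrow> \<phi> (e i \<triangleright>\<^bsub>P\<^esub> q) = \<phi> q"
      by (auto simp: dagger_iff)
    show "a \<triangleright>\<^bsub>RP.D\<^esub> \<phi> \<in> ?S"
      unfolding dagger_iff
    proof (intro conjI bexI[OF _ i(1)] ballI)
      show "a \<triangleright>\<^bsub>RP.D\<^esub> \<phi> \<in> carrier RP.D" using * dagger_dual RP.dual_closed by blast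
    qed (use i U.unit_closed in \<open>auto simp: RP.dual_sel P.lsmult_closed\<close>)
  next
    fix b \<phi> assume *: "b \<in> carrier B" "\<phi> \<in> ?S"
    then obtain i where i: "i \<in> I" "b \<otimes>\<^bsub>B\<^esub> e i = b"
      using U.local_units[of "{b}"] by auto
    show "\<phi> \<triangleleft>\<^bsub>RP.D\<^esub> b \<in> ?S"
      unfolding dagger_iff
    proof (intro conjI bexI[OF _ i(1)] ballI)
      show "\<phi> \<triangleleft>\<^bsub>RP.D\<^esub> b \<in> carrier RP.D" using * dagger_dual D.rsmult_closed by blast
    qed (use i * U.unit_closed in \<open>auto simp: RP.dual_sel P.lsmult_closed simp flip: P.lsmult_assoc\<close>)
  qed
  then show ?thesis by (simp add: dagger_def)
qed

text \<open>The prefixes name the tensor factors: \<open>D\<close> for \<open>P\<^sup>\<dagger>\<close>, \<open>C\<close> for \<open>P\<^sup>\<dagger> \<otimes>\<^sub>B P\<close>, which is \<open>DP.T\<close>, and \<open>CC\<close> for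
  \<open>C \<otimes>\<^sub>A C\<close>; the products of \<open>P\<close> and \<open>P\<^sup>\<dagger>\<close> are taken over \<open>B\<close> in \<open>DP\<close> and over \<open>A\<close> in \<open>PD\<close>.\<close>

sublocale D: bimodule k A B Dg by (rule dagger_bimodule)
sublocale DP: bimodule_pair k A B A Dg P by (intro bimodule_pair.intro dagger_bimodule bimod_P)
sublocale PD: bimodule_pair k B A B P Dg by (intro bimodule_pair.intro dagger_bimodule bimod_P)
sublocale C: bimodule k A A DP.T by (rule DP.bimodule_tensor)
sublocale CC: bimodule_pair k A A A DP.T DP.T by (intro bimodule_pair.intro DP.bimodule_tensor)
lemma dagger_eqI:
  "\<phi> \<in> carrier Dg \<Longrightarrow> \<psi> \<in> carrier Dg \<Longrightarrow> (\<And>q. q \<in> carrier P \<Longrightarrow> \<phi> q = \<psi> q) \<Longrightarrow> \<phi> = \<psi>"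
  by (rule RP.dual_eqI[OF dagger_dual dagger_dual])

lemma dagger_finsum_eval:
  assumes "q \<in> carrier P" "\<And>i. i \<in> S \<Longrightarrow> \<phi> i \<in> carrier Dg"
  shows "(\<Oplus>\<^bsub>Dg\<^esub>i\<in>S. \<phi> i) q = (\<Oplus>\<^bsub>A\<^esub>i\<in>S. \<phi> i q)"
proof (rule additive_finsum[OF D.abelian abelian_A])
  show "(\<lambda>\<phi>. \<phi> q) \<in> additive Dg A"
    using assms(1) by (intro additiveI) (simp_all add: daggerD(3) dagger_apply)
qed (use assms(2) in auto)

section \<open>Families in \<open>P \<otimes>\<^sub>A P\<^sup>\<dagger>\<close> that represent elements of \<open>B\<close>\<close>

text \<open>The family describes the element \<open>\<Sum> z\<^sub>l \<otimes>\<^sub>A f\<^sub>l\<close> of \<open>P \<otimes>\<^sub>A P\<^sup>\<dagger>\<close> by the endomorphism \<open>p \<mapsto> \<Sum> z\<^sub>l f\<^sub>l(p)\<close> of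
  \<open>P\<close> that it induces. Families are used in place of the tensor itself since the formula in the
  theorem and the axioms of a coring are about sums over such families.\<close>

definition represents :: "nat \<Rightarrow> (nat \<Rightarrow> 'p) \<Rightarrow> (nat \<Rightarrow> 'p \<Rightarrow> 'a) \<Rightarrow> 'b \<Rightarrow> bool" where
  "represents n z f b \<longleftrightarrow> (\<forall>l<n. z l \<in> carrier P) \<and> (\<forall>l<n. f l \<in> carrier Dg) \<and>
     (\<forall>p\<in>carrier P. b \<triangleright>\<^bsub>P\<^esub> p = (\<Oplus>\<^bsub>P\<^esub>l\<in>{..<n}. z l \<triangleleft>\<^bsub>P\<^esub> f l p))"

lemma representsD:
  assumes "represents n z f b"
  shows "l < n \<Longrightarrow> z l \<in> carrier P" "l < n \<Longrightarrow> f l \<in> carrier Dg"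
    "p \<in> carrier P \<Longrightarrow> b \<triangleright>\<^bsub>P\<^esub> p = (\<Oplus>\<^bsub>P\<^esub>l\<in>{..<n}. z l \<triangleleft>\<^bsub>P\<^esub> f l p)"
  using assms by (auto simp: represents_def)

lemma represents_summand_closed:
  "represents n z f b \<Longrightarrow> p \<in> carrier P \<Longrightarrow> l < n \<Longrightarrow> z l \<triangleleft>\<^bsub>P\<^esub> f l p \<in> carrier P"
  by (rule P.rsmult_closed[OF daggerD(3)[OF representsD(2)] representsD(1)])

text \<open>Together with the next lemma and \<open>represents_sum_unique\<close>: the map \<open>b \<mapsto> \<Sum> z\<^sub>l \<otimes> f\<^sub>l\<close> is one of
  \<open>B\<close>-bimodules.\<close>

lemma represents_left:
  assumes r: "represents n z f b" and bc: "b \<in> carrier B" "c \<in> carrier B"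
  shows "represents n (\<lambda>l. c \<triangleright>\<^bsub>P\<^esub> z l) f (c \<otimes>\<^bsub>B\<^esub> b)"
  unfolding represents_def
proof (intro conjI allI impI ballI)
  fix p assume p: "p \<in> carrier P"
  have "(c \<otimes>\<^bsub>B\<^esub> b) \<triangleright>\<^bsub>P\<^esub> p = c \<triangleright>\<^bsub>P\<^esub> (\<Oplus>\<^bsub>P\<^esub>l\<in>{..<n}. z l \<triangleleft>\<^bsub>P\<^esub> f l p)"
    using bc p representsD(3)[OF r p] by (simp add: P.lsmult_assoc)
  also have "\<dots> = (\<Oplus>\<^bsub>P\<^esub>l\<in>{..<n}. c \<triangleright>\<^bsub>P\<^esub> (z l \<triangleleft>\<^bsub>P\<^esub> f l p))"
    using represents_summand_closed[OF r p] bc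
    by (intro additive_finsum[OF P.abelian P.abelian]) (auto intro!: additiveI simp: P.lsmult_closed P.lsmult_r_distr)
  also have "\<dots> = (\<Oplus>\<^bsub>P\<^esub>l\<in>{..<n}. (c \<triangleright>\<^bsub>P\<^esub> z l) \<triangleleft>\<^bsub>P\<^esub> f l p)"
    using bc p representsD(1,2)[OF r]
    by (intro P.M.finsum_cong') (auto simp: P.lsmult_rsmult P.lsmult_closed P.rsmult_closed daggerD(3))
  finally show "(c \<otimes>\<^bsub>B\<^esub> b) \<triangleright>\<^bsub>P\<^esub> p = (\<Oplus>\<^bsub>P\<^esub>l\<in>{..<n}. (c \<triangleright>\<^bsub>P\<^esub> z l) \<triangleleft>\<^bsub>P\<^esub> f l p)" .
qed (use bc representsD[OF r] P.lsmult_closed in auto)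

lemma represents_right:
  assumes r: "represents n z f b" and bc: "b \<in> carrier B" "c \<in> carrier B"
  shows "represents n z (\<lambda>l. f l \<triangleleft>\<^bsub>Dg\<^esub> c) (b \<otimes>\<^bsub>B\<^esub> c)"
  unfolding represents_def
proof (intro conjI allI impI ballI)
  fix p assume p: "p \<in> carrier P"
  have "(b \<otimes>\<^bsub>B\<^esub> c) \<triangleright>\<^bsub>P\<^esub> p = (\<Oplus>\<^bsub>P\<^esub>l\<in>{..<n}. z l \<triangleleft>\<^bsub>P\<^esub> f l (c \<triangleright>\<^bsub>P\<^esub> p))"
    using bc p representsD(3)[OF r, of "c \<triangleright>\<^bsub>P\<^esub> p"] by (simp add: P.lsmult_assoc P.lsmult_closed)
  then show "(b \<otimes>\<^bsub>B\<^esub> c) \<triangleright>\<^bsub>P\<^esub> p = (\<Oplus>\<^bsub>P\<^esub>l\<in>{..<n}. z l \<triangleleft>\<^bsub>P\<^esub> (f l \<triangleleft>\<^bsub>Dg\<^esub> c) p)"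
    using p by (simp add: dagger_apply)
qed (use bc representsD[OF r] D.rsmult_closed in auto)

text \<open>The analogue of \<open>dual_basis_expansion\<close> for \<open>P\<^sup>\<dagger>\<close>: a dual basis of \<open>e\<^sub>i P\<close> sees only the
  restriction of \<open>\<phi>\<close> to \<open>e\<^sub>i P\<close>, that is, \<open>\<phi> e\<^sub>i\<close>.\<close>

lemma dagger_unit_expansion:
  assumes r: "represents n z f (e i)" and i: "i \<in> I" and \<phi>: "\<phi> \<in> carrier Dg"
  shows "\<phi> \<triangleleft>\<^bsub>Dg\<^esub> e i = (\<Oplus>\<^bsub>Dg\<^esub>l\<in>{..<n}. \<phi> (z l) \<triangleright>\<^bsub>Dg\<^esub> f l)"
proof (rule dagger_eqI)
  show "\<phi> \<triangleleft>\<^bsub>Dg\<^esub> e i \<in> carrier Dg"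
    by (rule D.rsmult_closed[OF U.unit_closed[OF i] \<phi>])
  have cl: "\<phi> (z l) \<triangleright>\<^bsub>Dg\<^esub> f l \<in> carrier Dg" if "l < n" for l
    using that by (intro D.lsmult_closed daggerD(3)[OF \<phi>] representsD[OF r])
  then show "(\<Oplus>\<^bsub>Dg\<^esub>l\<in>{..<n}. \<phi> (z l) \<triangleright>\<^bsub>Dg\<^esub> f l) \<in> carrier Dg"
    by (intro D.M.finsum_closed) auto
  fix q assume q: "q \<in> carrier P"
  have "(\<phi> \<triangleleft>\<^bsub>Dg\<^esub> e i) q = \<phi> (\<Oplus>\<^bsub>P\<^esub>l\<in>{..<n}. z l \<triangleleft>\<^bsub>P\<^esub> f l q)"
    using q representsD(3)[OF r q] by (simp add: dagger_apply)
  also have "\<dots> = (\<Oplus>\<^bsub>A\<^esub>l\<in>{..<n}. \<phi> (z l) \<otimes>\<^bsub>A\<^esub> f l q)"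
    using q by (intro RP.dual_finsum dagger_dual \<phi>) (auto intro!: representsD[OF r] daggerD(3))
  also have "\<dots> = (\<Oplus>\<^bsub>A\<^esub>l\<in>{..<n}. (\<phi> (z l) \<triangleright>\<^bsub>Dg\<^esub> f l) q)"
    using q cl by (intro A.M.finsum_cong') (auto intro!: daggerD(3), simp add: dagger_apply)
  also have "\<dots> = (\<Oplus>\<^bsub>Dg\<^esub>l\<in>{..<n}. \<phi> (z l) \<triangleright>\<^bsub>Dg\<^esub> f l) q"
    using cl by (intro dagger_finsum_eval[symmetric] q) auto
  finally show "(\<phi> \<triangleleft>\<^bsub>Dg\<^esub> e i) q = (\<Oplus>\<^bsub>Dg\<^esub>l\<in>{..<n}. \<phi> (z l) \<triangleright>\<^bsub>Dg\<^esub> f l) q" .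
qed

lemma right_module_part: "i \<in> I \<Longrightarrow> right_module k A (local_part P (e i))"
  by (rule right_module_local_part[OF unital_A bimod_P U.unit_closed])

lemma dual_part_lift:
  assumes i: "i \<in> I" and \<psi>: "\<psi> \<in> carrier (dual A (local_part P (e i)))"
  shows "compose (carrier P) \<psi> (local_proj P (e i)) \<in> carrier Dg"
proof -
  interpret L: right_module k A "local_part P (e i)" by (rule right_module_part[OF i])
  have op: "x \<oplus>\<^bsub>local_part P (e i)\<^esub> y = x \<oplus>\<^bsub>P\<^esub> y" "x \<triangleleft>\<^bsub>local_part P (e i)\<^esub> a = x \<triangleleft>\<^bsub>P\<^esub> a" for x y a
    by (simp_all add: local_part_def)
  have eL: "e i \<triangleright>\<^bsub>P\<^esub> q \<in> carrier (local_part P (e i))" if "q \<in> carrier P" for q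
    using that by (simp add: local_part_def)
  have "compose (carrier P) \<psi> (local_proj P (e i)) \<in> carrier RP.D"
    using L.dualD(3-)[OF \<psi>, unfolded op] eL i U.unit_closed
    by (intro RP.dualI) (auto simp: compose_def local_proj_def P.lsmult_r_distr P.rsmult_closed
        simp flip: P.lsmult_rsmult)
  moreover have "compose (carrier P) \<psi> (local_proj P (e i)) (e i \<triangleright>\<^bsub>P\<^esub> q) =
      compose (carrier P) \<psi> (local_proj P (e i)) q" if "q \<in> carrier P" for q
    using that i U.unit_closed by (simp add: compose_def local_proj_def P.lsmult_closed unit_idem_act)
  ultimately show ?thesis using i unfolding dagger_iff by blast
qed

lemma represents_of_dual_basis:
  assumes i: "i \<in> I" and b: "right_module.dual_basis A (local_part P (e i)) n z z'"
  shows "represents n z (\<lambda>l. compose (carrier P) (z' l) (local_proj P (e i))) (e i)"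
  unfolding represents_def
proof (intro conjI allI impI ballI)
  interpret L: right_module k A "local_part P (e i)" by (rule right_module_part[OF i])
  have sub: "carrier (local_part P (e i)) \<subseteq> carrier P" using i by (auto simp: local_part_iff)
  have eL: "e i \<triangleright>\<^bsub>P\<^esub> q \<in> carrier (local_part P (e i))" if "q \<in> carrier P" for q
    using that by (simp add: local_part_def)
  have z: "z l \<in> carrier (local_part P (e i))" "z' l \<in> carrier L.D" if "l < n" for l
    using b that by (auto simp: L.dual_basis_def)
  show "z l \<in> carrier P" if "l < n" for l using z[OF that] sub by blast
  show "compose (carrier P) (z' l) (local_proj P (e i)) \<in> carrier Dg" if "l < n" for l
    using z[OF that] i by (intro dual_part_lift)
  fix p assume p: "p \<in> carrier P"
  have "e i \<triangleright>\<^bsub>P\<^esub> p = (\<Oplus>\<^bsub>local_part P (e i)\<^esub>l\<in>{..<n}. z l \<triangleleft>\<^bsub>local_part P (e i)\<^esub> z' l (e i \<triangleright>\<^bsub>P\<^esub> p))"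
    using b eL[OF p] unfolding L.dual_basis_def by blast
  also have "\<dots> = (\<Oplus>\<^bsub>P\<^esub>l\<in>{..<n}. z l \<triangleleft>\<^bsub>local_part P (e i)\<^esub> z' l (e i \<triangleright>\<^bsub>P\<^esub> p))"
  proof (rule additive_finsum[OF L.M.abelian_group_axioms P.abelian, of "\<lambda>x. x"])
    show "(\<lambda>x. x) \<in> additive (local_part P (e i)) P"
      using sub by (intro additiveI) (auto simp: local_part_def)
    show "(\<lambda>l. z l \<triangleleft>\<^bsub>local_part P (e i)\<^esub> z' l (e i \<triangleright>\<^bsub>P\<^esub> p)) \<in> {..<n} \<rightarrow> carrier (local_part P (e i))"
      using z eL[OF p] by (auto intro!: L.rs_closed L.dualD(3))
  qed
  also have "\<dots> = (\<Oplus>\<^bsub>P\<^esub>l\<in>{..<n}. z l \<triangleleft>\<^bsub>P\<^esub> compose (carrier P) (z' l) (local_proj P (e i)) p)"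
    using p by (simp add: compose_def local_proj_def) (simp add: local_part_def)
  finally show "e i \<triangleright>\<^bsub>P\<^esub> p = (\<Oplus>\<^bsub>P\<^esub>l\<in>{..<n}. z l \<triangleleft>\<^bsub>P\<^esub> compose (carrier P) (z' l) (local_proj P (e i)) p)" .
qed

lemma represents_unit:
  assumes i: "i \<in> I"
  obtains n z f where "represents n z f (e i)" "\<And>l. l < n \<Longrightarrow> e i \<triangleright>\<^bsub>P\<^esub> z l = z l"
proof -
  interpret L: right_module k A "local_part P (e i)" by (rule right_module_part[OF i])
  obtain n z z' where b: "L.dual_basis n z z'"
    using L.dual_basis_exists[OF fin_gen[OF i] projective[OF i]] by blast
  then have "e i \<triangleright>\<^bsub>P\<^esub> z l = z l" if "l < n" for l
    using that local_part_iff[OF i] by (auto simp: L.dual_basis_def Pi_iff)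
  then show ?thesis using that represents_of_dual_basis[OF i b] by blast
qed

text \<open>Expand the \<open>f l\<close> in the family that represents \<open>e i\<close> and move the coefficients \<open>f l (u j)\<close> across
  \<open>\<beta>\<close>: the sum \<open>\<Sum>\<^sub>l z l f l (u j)\<close> that appears in the first argument is \<open>b (u j)\<close>.\<close>

lemma represents_sum_expand:
  assumes Q: "abelian_group Q" and \<beta>: "balanced k A P Dg Q \<beta>"
    and r: "represents n z f b" and s: "represents m u v (e i)" and i: "i \<in> I"
    and fixed: "\<And>l q. l < n \<Longrightarrow> q \<in> carrier P \<Longrightarrow> f l (e i \<triangleright>\<^bsub>P\<^esub> q) = f l q"
  shows "(\<Oplus>\<^bsub>Q\<^esub>l\<in>{..<n}. \<beta> (z l) (f l)) = (\<Oplus>\<^bsub>Q\<^esub>j\<in>{..<m}. \<beta> (b \<triangleright>\<^bsub>P\<^esub> u j) (v j))"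
proof -
  interpret Q: abelian_group Q by fact
  note z = representsD(1,2)[OF r] and u = representsD(1,2)[OF s]
  have "(\<Oplus>\<^bsub>Q\<^esub>l\<in>{..<n}. \<beta> (z l) (f l)) =
      (\<Oplus>\<^bsub>Q\<^esub>l\<in>{..<n}. \<beta> (z l) (\<Oplus>\<^bsub>Dg\<^esub>j\<in>{..<m}. f l (u j) \<triangleright>\<^bsub>Dg\<^esub> v j))"
  proof (intro Q.finsum_cong')
    show eq: "\<beta> (z l) (f l) = \<beta> (z l) (\<Oplus>\<^bsub>Dg\<^esub>j\<in>{..<m}. f l (u j) \<triangleright>\<^bsub>Dg\<^esub> v j)" if "l \<in> {..<n}" for l
    proof -
      have l: "l < n" using that by simp
      have "f l \<triangleleft>\<^bsub>Dg\<^esub> e i = f l"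
        using z(2)[OF l] fixed[OF l] U.unit_closed[OF i]
        by (intro dagger_eqI D.rsmult_closed) (simp_all add: dagger_apply)
      then show ?thesis using dagger_unit_expansion[OF s i z(2)[OF l]] by simp
    qed
    show "(\<lambda>l. \<beta> (z l) (\<Oplus>\<^bsub>Dg\<^esub>j\<in>{..<m}. f l (u j) \<triangleright>\<^bsub>Dg\<^esub> v j)) \<in> {..<n} \<rightarrow> carrier Q"
    proof (rule Pi_I)
      fix l assume l: "l \<in> {..<n}"
      show "\<beta> (z l) (\<Oplus>\<^bsub>Dg\<^esub>j\<in>{..<m}. f l (u j) \<triangleright>\<^bsub>Dg\<^esub> v j) \<in> carrier Q"
        unfolding eq[OF l, symmetric] using l z by (intro balanced_closed[OF \<beta>]) auto
    qed
  qed simp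
  also have "\<dots> = (\<Oplus>\<^bsub>Q\<^esub>j\<in>{..<m}. \<beta> (\<Oplus>\<^bsub>P\<^esub>l\<in>{..<n}. z l \<triangleleft>\<^bsub>P\<^esub> f l (u j)) (v j))"
    by (rule PD.balanced_finsum_exchange[OF Q \<beta>]) (auto intro: z u daggerD(3)[OF z(2)])
  also have "\<dots> = (\<Oplus>\<^bsub>Q\<^esub>j\<in>{..<m}. \<beta> (b \<triangleright>\<^bsub>P\<^esub> u j) (v j))"
  proof (intro Q.finsum_cong')
    show eq: "\<beta> (\<Oplus>\<^bsub>P\<^esub>l\<in>{..<n}. z l \<triangleleft>\<^bsub>P\<^esub> f l (u j)) (v j) = \<beta> (b \<triangleright>\<^bsub>P\<^esub> u j) (v j)" if "j \<in> {..<m}" for j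
      using that representsD(3)[OF r u(1), of j] by simp
    show "(\<lambda>j. \<beta> (b \<triangleright>\<^bsub>P\<^esub> u j) (v j)) \<in> {..<m} \<rightarrow> carrier Q"
    proof (rule Pi_I)
      fix j assume j: "j \<in> {..<m}"
      have "(\<Oplus>\<^bsub>P\<^esub>l\<in>{..<n}. z l \<triangleleft>\<^bsub>P\<^esub> f l (u j)) \<in> carrier P"
        using j u represents_summand_closed[OF r] by (intro P.M.finsum_closed) auto
      then show "\<beta> (b \<triangleright>\<^bsub>P\<^esub> u j) (v j) \<in> carrier Q"
        unfolding eq[OF j, symmetric] using j u by (intro balanced_closed[OF \<beta>]) auto
    qed
  qed simp
  finally show ?thesis .
qed

text \<open>The key fact: \<open>\<Sum> z\<^sub>l \<otimes>\<^sub>A f\<^sub>l\<close> depends on \<open>b\<close> only, i.e. \<open>P \<otimes>\<^sub>A P\<^sup>\<dagger>\<close> acts faithfully on \<open>P\<close>. Both sums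
  are compared with the one over a dual basis at a local unit that fixes all functionals involved.\<close>

lemma represents_sum_unique:
  assumes Q: "abelian_group Q" and \<beta>: "balanced k A P Dg Q \<beta>"
    and r: "represents n z f b" and s: "represents m u v b"
  shows "(\<Oplus>\<^bsub>Q\<^esub>l\<in>{..<n}. \<beta> (z l) (f l)) = (\<Oplus>\<^bsub>Q\<^esub>j\<in>{..<m}. \<beta> (u j) (v j))"
proof -
  note z = representsD(1,2)[OF r] and u = representsD(1,2)[OF s]
  obtain i where i: "i \<in> I"
    "\<And>\<phi> q. \<phi> \<in> f ` {..<n} \<union> v ` {..<m} \<Longrightarrow> q \<in> carrier P \<Longrightarrow> \<phi> (e i \<triangleright>\<^bsub>P\<^esub> q) = \<phi> q"
    by (rule common_unit[of "{}" "{}" "f ` {..<n} \<union> v ` {..<m}"]) (use z u in auto)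
  obtain h x y where h: "represents h x y (e i)" by (rule represents_unit[OF i(1)])
  have "(\<Oplus>\<^bsub>Q\<^esub>l\<in>{..<n}. \<beta> (z l) (f l)) = (\<Oplus>\<^bsub>Q\<^esub>j\<in>{..<h}. \<beta> (b \<triangleright>\<^bsub>P\<^esub> x j) (y j))"
    by (rule represents_sum_expand[OF Q \<beta> r h i(1)]) (simp add: i(2))
  also have "\<dots> = (\<Oplus>\<^bsub>Q\<^esub>j\<in>{..<m}. \<beta> (u j) (v j))"
    by (rule represents_sum_expand[OF Q \<beta> s h i(1), symmetric]) (simp add: i(2))
  finally show ?thesis .
qed


section \<open>Comultiplication and counit\<close>

sublocale CC_C: bimodule_pair k A A A CC.T DP.T
  by (intro bimodule_pair.intro DP.bimodule_tensor CC.bimodule_tensor)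
sublocale C_CC: bimodule_pair k A A A DP.T CC.T
  by (intro bimodule_pair.intro DP.bimodule_tensor CC.bimodule_tensor)
sublocale regA: bimodule k A A "regular_bimodule A"
  by (rule bimodule_regular) (rule A.assoc_algebra_axioms)
sublocale A_C: bimodule_pair k A A A "regular_bimodule A" DP.T
  by (intro bimodule_pair.intro DP.bimodule_tensor regA.bimodule_axioms)
sublocale C_A: bimodule_pair k A A A DP.T "regular_bimodule A"
  by (intro bimodule_pair.intro DP.bimodule_tensor regA.bimodule_axioms)

text \<open>This is the map \<open>P \<otimes>\<^sub>A P\<^sup>\<dagger> \<rightarrow> C \<otimes>\<^sub>A C\<close>, \<open>z \<otimes> f \<mapsto> (\<phi> \<otimes> z) \<otimes> (f \<otimes> p)\<close>, with \<open>C = P\<^sup>\<dagger> \<otimes>\<^sub>B P\<close>.\<close>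

lemma insertion_balanced:
  assumes \<phi>: "\<phi> \<in> carrier Dg" and p: "p \<in> carrier P"
  shows "balanced k A P Dg CC.T (\<lambda>z f. CC.pure (DP.pure \<phi> z) (DP.pure f p))"
proof (rule balancedI)
  fix z a f assume *: "z \<in> carrier P" "a \<in> carrier A" "f \<in> carrier Dg"
  show "CC.pure (DP.pure \<phi> (z \<triangleleft>\<^bsub>P\<^esub> a)) (DP.pure f p) = CC.pure (DP.pure \<phi> z) (DP.pure (a \<triangleright>\<^bsub>Dg\<^esub> f) p)"
    using * \<phi> p CC.pure_middle[of "DP.pure \<phi> z" a "DP.pure f p"]
    by (simp add: DP.pure_closed DP.action_pure)
next
  fix z c f assume *: "z \<in> carrier P" "c \<in> carrier k" "f \<in> carrier Dg"
  show "CC.pure (DP.pure \<phi> (c \<odot>\<^bsub>P\<^esub> z)) (DP.pure f p) = CC.pure (DP.pure \<phi> z) (DP.pure (c \<odot>\<^bsub>Dg\<^esub> f) p)"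
    using * \<phi> p CC.pure_smult[of "DP.pure \<phi> z" c "DP.pure f p"]
    by (simp add: DP.pure_closed DP.action_pure DP.pure_smult)
qed (use \<phi> p in \<open>simp_all add: DP.pure_closed CC.pure_closed DP.pure_add_left DP.pure_add_right
    CC.pure_add_left CC.pure_add_right\<close>)

text \<open>The result of inserting \<open>\<Sum> z\<^sub>l \<otimes> f\<^sub>l\<close> between \<open>\<phi>\<close> and \<open>p\<close>.\<close>

definition split_sum :: "('p \<Rightarrow> 'a) \<Rightarrow> 'p \<Rightarrow> nat \<Rightarrow> (nat \<Rightarrow> 'p) \<Rightarrow> (nat \<Rightarrow> 'p \<Rightarrow> 'a) \<Rightarrow>
    ((('p \<Rightarrow> 'a) \<times> 'p \<Rightarrow>\<^sub>0 int) set \<times> (('p \<Rightarrow> 'a) \<times> 'p \<Rightarrow>\<^sub>0 int) set \<Rightarrow>\<^sub>0 int) set" where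
  "split_sum \<phi> p n z f = (\<Oplus>\<^bsub>CC.T\<^esub>l\<in>{..<n}. CC.pure (DP.pure \<phi> (z l)) (DP.pure (f l) p))"

lemma summand_closed:
  assumes "represents n z f b" "\<phi> \<in> carrier Dg" "p \<in> carrier P" "l < n"
  shows "CC.pure (DP.pure \<phi> (z l)) (DP.pure (f l) p) \<in> carrier CC.T"
  using assms representsD(1,2)[OF assms(1)] by (intro CC.pure_closed DP.pure_closed)

lemma split_sum_closed:
  assumes "represents n z f b" "\<phi> \<in> carrier Dg" "p \<in> carrier P"
  shows "split_sum \<phi> p n z f \<in> carrier CC.T"
  unfolding split_sum_def using summand_closed[OF assms] by (intro CC.T.finsum_closed) auto

text \<open>Writing \<open>E(b)\<close> for the tensor that represents \<open>b\<close>, the reason is \<open>E(b) = E(e\<^sub>i b) = E(e\<^sub>i) b\<close>; the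
  factor \<open>b\<close> then moves over \<open>\<otimes>\<^sub>B\<close> to \<open>p\<close>. The next lemma is the mirror image, with
  \<open>E(b) = b E(e\<^sub>i)\<close> and \<open>b\<close> moving to \<open>\<phi>\<close>.\<close>

lemma split_sum_shift_right:
  assumes r: "represents n z f b" and b: "b \<in> carrier B" and s: "represents m u v (e i)" and i: "i \<in> I"
    and eb: "e i \<otimes>\<^bsub>B\<^esub> b = b" and \<phi>: "\<phi> \<in> carrier Dg" and p: "p \<in> carrier P"
  shows "split_sum \<phi> p n z f = split_sum \<phi> (b \<triangleright>\<^bsub>P\<^esub> p) m u v"
proof -
  have s': "represents m u (\<lambda>l. v l \<triangleleft>\<^bsub>Dg\<^esub> b) b"
    using represents_right[OF s U.unit_closed[OF i] b] eb by simp
  have "split_sum \<phi> p n z f = split_sum \<phi> p m u (\<lambda>l. v l \<triangleleft>\<^bsub>Dg\<^esub> b)"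
    unfolding split_sum_def
    by (rule represents_sum_unique[OF CC.abelian_tensor insertion_balanced[OF \<phi> p] r s'])
  also have "\<dots> = split_sum \<phi> (b \<triangleright>\<^bsub>P\<^esub> p) m u v"
    unfolding split_sum_def
    using summand_closed[OF s \<phi> P.lsmult_closed[OF b p]] representsD(2)[OF s] b p
    by (intro CC.T.finsum_cong') (auto simp: DP.pure_middle)
  finally show ?thesis .
qed

lemma split_sum_shift_left:
  assumes r: "represents n z f b" and b: "b \<in> carrier B" and s: "represents m u v (e i)" and i: "i \<in> I"
    and be: "b \<otimes>\<^bsub>B\<^esub> e i = b" and \<phi>: "\<phi> \<in> carrier Dg" and p: "p \<in> carrier P"
  shows "split_sum \<phi> p n z f = split_sum (\<phi> \<triangleleft>\<^bsub>Dg\<^esub> b) p m u v"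
proof -
  have s': "represents m (\<lambda>l. b \<triangleright>\<^bsub>P\<^esub> u l) v b"
    using represents_left[OF s U.unit_closed[OF i] b] be by simp
  have "split_sum \<phi> p n z f = split_sum \<phi> p m (\<lambda>l. b \<triangleright>\<^bsub>P\<^esub> u l) v"
    unfolding split_sum_def
    by (rule represents_sum_unique[OF CC.abelian_tensor insertion_balanced[OF \<phi> p] r s'])
  also have "\<dots> = split_sum (\<phi> \<triangleleft>\<^bsub>Dg\<^esub> b) p m u v"
    unfolding split_sum_def
    using summand_closed[OF s D.rsmult_closed[OF b \<phi>] p] representsD(1)[OF s] b \<phi>
    by (intro CC.T.finsum_cong') (auto simp: DP.pure_middle)
  finally show ?thesis .
qed

text \<open>Any element \<open>b\<close> with \<open>b p = p\<close> may be inserted between \<open>\<phi>\<close> and \<open>p\<close>, in place of a local unit. This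
  freedom is what makes the balancedness of \<open>comult0\<close> a direct computation.\<close>

definition comult0 :: "('p \<Rightarrow> 'a) \<Rightarrow> 'p \<Rightarrow>
    ((('p \<Rightarrow> 'a) \<times> 'p \<Rightarrow>\<^sub>0 int) set \<times> (('p \<Rightarrow> 'a) \<times> 'p \<Rightarrow>\<^sub>0 int) set \<Rightarrow>\<^sub>0 int) set" where
  "comult0 \<phi> p = (SOME X. \<exists>n z f. \<exists>b\<in>carrier B. b \<triangleright>\<^bsub>P\<^esub> p = p \<and> represents n z f b \<and> X = split_sum \<phi> p n z f)"

text \<open>Both \<open>b\<close> and \<open>c\<close> are moved to \<open>p\<close>, which leaves the same local unit in the middle.\<close>

lemma split_sum_unique:
  assumes r: "represents n z f b" "b \<in> carrier B" "b \<triangleright>\<^bsub>P\<^esub> p = p"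
    and s: "represents m u v c" "c \<in> carrier B" "c \<triangleright>\<^bsub>P\<^esub> p = p"
    and \<phi>: "\<phi> \<in> carrier Dg" and p: "p \<in> carrier P"
  shows "split_sum \<phi> p n z f = split_sum \<phi> p m u v"
proof -
  obtain i where i: "i \<in> I" "e i \<otimes>\<^bsub>B\<^esub> b = b" "e i \<otimes>\<^bsub>B\<^esub> c = c"
    using U.local_units[of "{b, c}"] r s by auto
  obtain h x y where h: "represents h x y (e i)" by (rule represents_unit[OF i(1)])
  show ?thesis
    using split_sum_shift_right[OF r(1,2) h i(1,2) \<phi> p] split_sum_shift_right[OF s(1,2) h i(1,3) \<phi> p] r s
    by simp
qed

lemma comult0_eq:
  assumes r: "represents n z f b" "b \<in> carrier B" "b \<triangleright>\<^bsub>P\<^esub> p = p"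
    and \<phi>: "\<phi> \<in> carrier Dg" and p: "p \<in> carrier P"
  shows "comult0 \<phi> p = split_sum \<phi> p n z f"
  unfolding comult0_def
proof (rule someI2)
  show "\<exists>m u v. \<exists>c\<in>carrier B. c \<triangleright>\<^bsub>P\<^esub> p = p \<and> represents m u v c \<and> split_sum \<phi> p n z f = split_sum \<phi> p m u v"
    using r by blast
next
  fix X assume "\<exists>m u v. \<exists>c\<in>carrier B. c \<triangleright>\<^bsub>P\<^esub> p = p \<and> represents m u v c \<and> X = split_sum \<phi> p m u v"
  then obtain m u v c where "c \<in> carrier B" "c \<triangleright>\<^bsub>P\<^esub> p = p" "represents m u v c" "X = split_sum \<phi> p m u v"
    by blast
  then show "X = split_sum \<phi> p n z f" using split_sum_unique[OF _ _ _ r \<phi> p] by blast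
qed

lemma unit_system:
  assumes "finite F" "F \<subseteq> carrier B" "finite X" "X \<subseteq> carrier P"
  obtains i n z f where "i \<in> I" "represents n z f (e i)" "\<And>b. b \<in> F \<Longrightarrow> e i \<otimes>\<^bsub>B\<^esub> b = b"
    "\<And>b. b \<in> F \<Longrightarrow> b \<otimes>\<^bsub>B\<^esub> e i = b" "\<And>p. p \<in> X \<Longrightarrow> e i \<triangleright>\<^bsub>P\<^esub> p = p"
    "\<And>l. l < n \<Longrightarrow> e i \<triangleright>\<^bsub>P\<^esub> z l = z l"
proof -
  obtain i where i: "i \<in> I" "\<And>b. b \<in> F \<Longrightarrow> e i \<otimes>\<^bsub>B\<^esub> b = b" "\<And>b. b \<in> F \<Longrightarrow> b \<otimes>\<^bsub>B\<^esub> e i = b"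
    "\<And>p. p \<in> X \<Longrightarrow> e i \<triangleright>\<^bsub>P\<^esub> p = p"
    by (rule common_unit[OF assms, of "{}"]) auto
  show ?thesis
    by (rule represents_unit[OF i(1)]) (rule that[OF i(1) _ i(2-4)])
qed

text \<open>Additivity and the balancedness over \<open>k\<close> are read off a representation of a unit that fixes all elements of
  \<open>P\<close> involved. For the balancedness over \<open>B\<close>, the sums for \<open>(\<phi> b, p)\<close> and \<open>(\<phi>, b p)\<close> at a unit
  neutral for \<open>b\<close> are both equal to the sum for \<open>(\<phi>, p)\<close> with \<open>b\<close> itself represented in the middle.\<close>

lemma comult0_balanced: "balanced k B Dg P CC.T comult0"
proof (rule balancedI)
  fix \<phi> p assume *: "\<phi> \<in> carrier Dg" "p \<in> carrier P"
  obtain i n z f where i: "i \<in> I" "represents n z f (e i)" "e i \<triangleright>\<^bsub>P\<^esub> p = p"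
    by (rule unit_system[of "{}" "{p}"]) (use * in auto)
  show "comult0 \<phi> p \<in> carrier CC.T"
    using comult0_eq[OF i(2) U.unit_closed[OF i(1)] i(3) *] split_sum_closed[OF i(2) *] by simp
next
  fix \<phi> \<psi> p assume *: "\<phi> \<in> carrier Dg" "\<psi> \<in> carrier Dg" "p \<in> carrier P"
  obtain i n z f where i: "i \<in> I" "represents n z f (e i)" "e i \<triangleright>\<^bsub>P\<^esub> p = p"
    by (rule unit_system[of "{}" "{p}"]) (use * in auto)
  note c = comult0_eq[OF i(2) U.unit_closed[OF i(1)] i(3) _ *(3)]
  have "split_sum (\<phi> \<oplus>\<^bsub>Dg\<^esub> \<psi>) p n z f = (\<Oplus>\<^bsub>CC.T\<^esub>l\<in>{..<n}.
      CC.pure (DP.pure \<phi> (z l)) (DP.pure (f l) p) \<oplus>\<^bsub>CC.T\<^esub> CC.pure (DP.pure \<psi> (z l)) (DP.pure (f l) p))"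
    unfolding split_sum_def using * representsD(1,2)[OF i(2)] summand_closed[OF i(2)]
    by (intro CC.T.finsum_cong') (auto simp: DP.pure_add_left CC.pure_add_left DP.pure_closed intro!: CC.T.a_closed)
  also have "\<dots> = split_sum \<phi> p n z f \<oplus>\<^bsub>CC.T\<^esub> split_sum \<psi> p n z f"
    unfolding split_sum_def using * summand_closed[OF i(2)] by (intro CC.T.finsum_addf) auto
  finally show "comult0 (\<phi> \<oplus>\<^bsub>Dg\<^esub> \<psi>) p = comult0 \<phi> p \<oplus>\<^bsub>CC.T\<^esub> comult0 \<psi> p"
    using * by (simp add: c)
next
  fix \<phi> p q assume *: "\<phi> \<in> carrier Dg" "p \<in> carrier P" "q \<in> carrier P"
  obtain i n z f where i: "i \<in> I" "represents n z f (e i)" "e i \<triangleright>\<^bsub>P\<^esub> p = p" "e i \<triangleright>\<^bsub>P\<^esub> q = q"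
    by (rule unit_system[of "{}" "{p, q}"]) (use * in auto)
  have pq: "e i \<triangleright>\<^bsub>P\<^esub> (p \<oplus>\<^bsub>P\<^esub> q) = p \<oplus>\<^bsub>P\<^esub> q"
    using i * U.unit_closed by (simp add: P.lsmult_r_distr)
  note c = comult0_eq[OF i(2) U.unit_closed[OF i(1)] _ *(1)]
  have "split_sum \<phi> (p \<oplus>\<^bsub>P\<^esub> q) n z f = (\<Oplus>\<^bsub>CC.T\<^esub>l\<in>{..<n}.
      CC.pure (DP.pure \<phi> (z l)) (DP.pure (f l) p) \<oplus>\<^bsub>CC.T\<^esub> CC.pure (DP.pure \<phi> (z l)) (DP.pure (f l) q))"
    unfolding split_sum_def using * representsD(1,2)[OF i(2)] summand_closed[OF i(2)]
    by (intro CC.T.finsum_cong') (auto simp: DP.pure_add_right CC.pure_add_right DP.pure_closed intro!: CC.T.a_closed)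
  also have "\<dots> = split_sum \<phi> p n z f \<oplus>\<^bsub>CC.T\<^esub> split_sum \<phi> q n z f"
    unfolding split_sum_def using * summand_closed[OF i(2)] by (intro CC.T.finsum_addf) auto
  finally show "comult0 \<phi> (p \<oplus>\<^bsub>P\<^esub> q) = comult0 \<phi> p \<oplus>\<^bsub>CC.T\<^esub> comult0 \<phi> q"
    using * i pq by (simp add: c)
next
  fix \<phi> b p assume *: "\<phi> \<in> carrier Dg" "b \<in> carrier B" "p \<in> carrier P"
  obtain i n z f where i: "i \<in> I" "represents n z f (e i)" "e i \<otimes>\<^bsub>B\<^esub> b = b" "b \<otimes>\<^bsub>B\<^esub> e i = b" "e i \<triangleright>\<^bsub>P\<^esub> p = p"
    by (rule unit_system[of "{b}" "{p}"]) (use * in auto)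
  have r: "represents n (\<lambda>l. b \<triangleright>\<^bsub>P\<^esub> z l) f b"
    using represents_left[OF i(2) U.unit_closed[OF i(1)] *(2)] i(4) by simp
  have bp: "e i \<triangleright>\<^bsub>P\<^esub> (b \<triangleright>\<^bsub>P\<^esub> p) = b \<triangleright>\<^bsub>P\<^esub> p"
    using i * U.unit_closed by (simp flip: P.lsmult_assoc)
  have "comult0 (\<phi> \<triangleleft>\<^bsub>Dg\<^esub> b) p = split_sum (\<phi> \<triangleleft>\<^bsub>Dg\<^esub> b) p n z f"
    using * by (intro comult0_eq[OF i(2) U.unit_closed[OF i(1)] i(5)] D.rsmult_closed)
  also have "\<dots> = split_sum \<phi> p n (\<lambda>l. b \<triangleright>\<^bsub>P\<^esub> z l) f"
    by (rule split_sum_shift_left[OF r *(2) i(2,1,4) *(1,3), symmetric])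
  also have "\<dots> = split_sum \<phi> (b \<triangleright>\<^bsub>P\<^esub> p) n z f"
    by (rule split_sum_shift_right[OF r *(2) i(2,1,3) *(1,3)])
  also have "\<dots> = comult0 \<phi> (b \<triangleright>\<^bsub>P\<^esub> p)"
    using * by (intro comult0_eq[OF i(2) U.unit_closed[OF i(1)] bp, symmetric] P.lsmult_closed)
  finally show "comult0 (\<phi> \<triangleleft>\<^bsub>Dg\<^esub> b) p = comult0 \<phi> (b \<triangleright>\<^bsub>P\<^esub> p)" .
next
  fix \<phi> c p assume *: "\<phi> \<in> carrier Dg" "c \<in> carrier k" "p \<in> carrier P"
  obtain i n z f where i: "i \<in> I" "represents n z f (e i)" "e i \<triangleright>\<^bsub>P\<^esub> p = p"
    by (rule unit_system[of "{}" "{p}"]) (use * in auto)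
  have cp: "e i \<triangleright>\<^bsub>P\<^esub> (c \<odot>\<^bsub>P\<^esub> p) = c \<odot>\<^bsub>P\<^esub> p"
    using i * U.unit_closed by (simp add: P.lsmult_smult_r)
  have "split_sum (c \<odot>\<^bsub>Dg\<^esub> \<phi>) p n z f = split_sum \<phi> (c \<odot>\<^bsub>P\<^esub> p) n z f"
    unfolding split_sum_def
  proof (intro CC.T.finsum_cong')
    fix l assume "l \<in> {..<n}"
    then have l: "z l \<in> carrier P" "f l \<in> carrier Dg" using representsD(1,2)[OF i(2)] by auto
    have "CC.pure (DP.pure (c \<odot>\<^bsub>Dg\<^esub> \<phi>) (z l)) (DP.pure (f l) p) = CC.pure (c \<odot>\<^bsub>DP.T\<^esub> DP.pure \<phi> (z l)) (DP.pure (f l) p)"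
      using * l by (simp add: DP.action_pure)
    also have "\<dots> = CC.pure (DP.pure \<phi> (z l)) (c \<odot>\<^bsub>DP.T\<^esub> DP.pure (f l) p)"
      using * l by (intro CC.pure_smult DP.pure_closed)
    also have "c \<odot>\<^bsub>DP.T\<^esub> DP.pure (f l) p = DP.pure (f l) (c \<odot>\<^bsub>P\<^esub> p)"
      using * l by (simp add: DP.action_pure DP.pure_smult)
    finally show "CC.pure (DP.pure (c \<odot>\<^bsub>Dg\<^esub> \<phi>) (z l)) (DP.pure (f l) p) =
      CC.pure (DP.pure \<phi> (z l)) (DP.pure (f l) (c \<odot>\<^bsub>P\<^esub> p))" .
  qed (use * summand_closed[OF i(2)] in auto)
  then show "comult0 (c \<odot>\<^bsub>Dg\<^esub> \<phi>) p = comult0 \<phi> (c \<odot>\<^bsub>P\<^esub> p)"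
    using * comult0_eq[OF i(2) U.unit_closed[OF i(1)] i(3)] comult0_eq[OF i(2) U.unit_closed[OF i(1)] cp]
    by simp
qed

definition comult where "comult = tensor_lift k B Dg P CC.T comult0"
definition counit where "counit = tensor_lift k B Dg P (regular_bimodule A) (\<lambda>\<phi> p. \<phi> p)"

lemmas comult_additive = DP.tensor_lift_additive[OF CC.abelian_tensor comult0_balanced, folded comult_def]
  and comult_pure0 = DP.tensor_lift_pure[OF CC.abelian_tensor comult0_balanced, folded comult_def]

lemma comult_pure:
  assumes "represents n z f b" "b \<in> carrier B" "b \<triangleright>\<^bsub>P\<^esub> p = p" "\<phi> \<in> carrier Dg" "p \<in> carrier P"
  shows "comult (DP.pure \<phi> p) = split_sum \<phi> p n z f"
  using comult_pure0 comult0_eq assms by metis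

lemma dagger_smult:
  assumes "\<phi> \<in> carrier Dg" "c \<in> carrier k" "p \<in> carrier P"
  shows "\<phi> (c \<odot>\<^bsub>P\<^esub> p) = c \<odot>\<^bsub>A\<^esub> \<phi> p"
  using dual_smult[OF unital_A bimod_P unital_P dagger_dual[OF assms(1)] assms(2,3)] .

lemma evaluation_balanced: "balanced k B Dg P (regular_bimodule A) (\<lambda>\<phi> p. \<phi> p)"
  by (rule balancedI) (simp_all add: daggerD(3,4) dagger_apply dagger_smult)

lemmas counit_additive = DP.tensor_lift_additive[OF regA.abelian evaluation_balanced, folded counit_def]
  and counit_pure = DP.tensor_lift_pure[OF regA.abelian evaluation_balanced, folded counit_def]

lemma counit_hom: "counit \<in> bimodule_hom k A A DP.T (regular_bimodule A)"
proof (rule bimodule_homI[OF counit_additive])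
  note cl = additive_closed[OF counit_additive, simplified]
  note add = additive_add[OF counit_additive, simplified]
  note [simp] = cl add counit_pure DP.action_closed DP.action_add DP.action_pure DP.pure_closed
    dagger_apply daggerD(3,5) P.rsmult_closed D.lsmult_closed D.smult_closed
  show "counit (c \<odot>\<^bsub>DP.T\<^esub> x) = c \<odot>\<^bsub>regular_bimodule A\<^esub> counit x" if "c \<in> carrier k" "x \<in> carrier DP.T" for c x
    using that(2) by (induction rule: DP.tensor_induct) (simp_all add: that A.smult_r_distr del: dagger_apply, simp add: dagger_apply)
  show "counit (a \<triangleright>\<^bsub>DP.T\<^esub> x) = a \<triangleright>\<^bsub>regular_bimodule A\<^esub> counit x" if "a \<in> carrier A" "x \<in> carrier DP.T" for a x
    using that(2) by (induction rule: DP.tensor_induct) (simp_all add: that A.alg_r_distr del: dagger_apply, simp add: dagger_apply)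
  show "counit (x \<triangleleft>\<^bsub>DP.T\<^esub> a) = counit x \<triangleleft>\<^bsub>regular_bimodule A\<^esub> a" if "a \<in> carrier A" "x \<in> carrier DP.T" for a x
    using that(2) by (induction rule: DP.tensor_induct) (simp_all add: that A.alg_l_distr)
qed

lemma comult_hom: "comult \<in> bimodule_hom k A A DP.T CC.T"
proof (rule bimodule_homI[OF comult_additive])
  note [simp] = additive_closed[OF comult_additive] additive_add[OF comult_additive]
    DP.action_closed DP.action_add CC.action_closed CC.action_add
  show "comult (c \<odot>\<^bsub>DP.T\<^esub> x) = c \<odot>\<^bsub>CC.T\<^esub> comult x" if c: "c \<in> carrier k" and x: "x \<in> carrier DP.T" for c x
    using x
  proof (induction rule: DP.tensor_induct)
    case (pure \<phi> p)
    obtain i n z f where i: "i \<in> I" "represents n z f (e i)" "e i \<triangleright>\<^bsub>P\<^esub> p = p"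
      by (rule unit_system[of "{}" "{p}"]) (use pure in auto)
    note cm = comult_pure[OF i(2) U.unit_closed[OF i(1)] i(3)]
    have "c \<odot>\<^bsub>CC.T\<^esub> split_sum \<phi> p n z f =
        (\<Oplus>\<^bsub>CC.T\<^esub>l\<in>{..<n}. c \<odot>\<^bsub>CC.T\<^esub> CC.pure (DP.pure \<phi> (z l)) (DP.pure (f l) p))"
      unfolding split_sum_def using summand_closed[OF i(2) pure]
      by (intro additive_finsum[OF CC.abelian_tensor CC.abelian_tensor CC.action_additive(1)[OF c]]) auto
    also have "\<dots> = split_sum (c \<odot>\<^bsub>Dg\<^esub> \<phi>) p n z f"
      unfolding split_sum_def using c pure representsD(1,2)[OF i(2)] summand_closed[OF i(2)]
      by (intro CC.T.finsum_cong') (auto simp: CC.action_pure DP.action_pure DP.pure_closed)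
    finally show ?case using pure c by (simp add: cm DP.action_pure)
  qed (use c in simp)
  show "comult (a \<triangleright>\<^bsub>DP.T\<^esub> x) = a \<triangleright>\<^bsub>CC.T\<^esub> comult x" if a: "a \<in> carrier A" and x: "x \<in> carrier DP.T" for a x
    using x
  proof (induction rule: DP.tensor_induct)
    case (pure \<phi> p)
    obtain i n z f where i: "i \<in> I" "represents n z f (e i)" "e i \<triangleright>\<^bsub>P\<^esub> p = p"
      by (rule unit_system[of "{}" "{p}"]) (use pure in auto)
    note cm = comult_pure[OF i(2) U.unit_closed[OF i(1)] i(3)]
    have "a \<triangleright>\<^bsub>CC.T\<^esub> split_sum \<phi> p n z f =
        (\<Oplus>\<^bsub>CC.T\<^esub>l\<in>{..<n}. a \<triangleright>\<^bsub>CC.T\<^esub> CC.pure (DP.pure \<phi> (z l)) (DP.pure (f l) p))"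
      unfolding split_sum_def using summand_closed[OF i(2) pure]
      by (intro additive_finsum[OF CC.abelian_tensor CC.abelian_tensor CC.action_additive(2)[OF a]]) auto
    also have "\<dots> = split_sum (a \<triangleright>\<^bsub>Dg\<^esub> \<phi>) p n z f"
      unfolding split_sum_def using a pure representsD(1,2)[OF i(2)] summand_closed[OF i(2)] D.lsmult_closed
      by (intro CC.T.finsum_cong') (auto simp: CC.action_pure DP.action_pure DP.pure_closed)
    finally show ?case using pure a by (simp add: cm DP.action_pure D.lsmult_closed)
  qed (use a in simp)
  show "comult (x \<triangleleft>\<^bsub>DP.T\<^esub> a) = comult x \<triangleleft>\<^bsub>CC.T\<^esub> a" if a: "a \<in> carrier A" and x: "x \<in> carrier DP.T" for a x
    using x
  proof (induction rule: DP.tensor_induct)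
    case (pure \<phi> p)
    obtain i n z f where i: "i \<in> I" "represents n z f (e i)" "e i \<triangleright>\<^bsub>P\<^esub> p = p"
      by (rule unit_system[of "{}" "{p}"]) (use pure in auto)
    have pa: "e i \<triangleright>\<^bsub>P\<^esub> (p \<triangleleft>\<^bsub>P\<^esub> a) = p \<triangleleft>\<^bsub>P\<^esub> a"
      using i pure a U.unit_closed by (simp flip: P.lsmult_rsmult)
    note cm = comult_pure[OF i(2) U.unit_closed[OF i(1)]]
    have "split_sum \<phi> p n z f \<triangleleft>\<^bsub>CC.T\<^esub> a =
        (\<Oplus>\<^bsub>CC.T\<^esub>l\<in>{..<n}. CC.pure (DP.pure \<phi> (z l)) (DP.pure (f l) p) \<triangleleft>\<^bsub>CC.T\<^esub> a)"
      unfolding split_sum_def using summand_closed[OF i(2) pure]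
      by (intro additive_finsum[OF CC.abelian_tensor CC.abelian_tensor CC.action_additive(3)[OF a]]) auto
    also have "\<dots> = split_sum \<phi> (p \<triangleleft>\<^bsub>P\<^esub> a) n z f"
      unfolding split_sum_def using a pure representsD(1,2)[OF i(2)] summand_closed[OF i(2)] P.rsmult_closed
      by (intro CC.T.finsum_cong') (auto simp: CC.action_pure DP.action_pure DP.pure_closed)
    finally show ?case using pure a i(3) pa by (simp add: cm DP.action_pure P.rsmult_closed)
  qed (use a in simp)
qed


section \<open>The coring axioms\<close>

lemma comult_pure_unit:
  assumes "i \<in> I" "represents n z f (e i)" "e i \<triangleright>\<^bsub>P\<^esub> p = p" "\<phi> \<in> carrier Dg" "p \<in> carrier P"
  shows "comult (DP.pure \<phi> p) = split_sum \<phi> p n z f"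
  by (rule comult_pure[OF assms(2) U.unit_closed[OF assms(1)] assms(3-5)])

lemma additive_split_sum:
  assumes Q: "abelian_group Q" and h: "h \<in> additive CC.T Q"
    and r: "represents n z f b" and \<phi>: "\<phi> \<in> carrier Dg" and p: "p \<in> carrier P"
  shows "h (split_sum \<phi> p n z f) = (\<Oplus>\<^bsub>Q\<^esub>l\<in>{..<n}. h (CC.pure (DP.pure \<phi> (z l)) (DP.pure (f l) p)))"
  unfolding split_sum_def using summand_closed[OF r \<phi> p] by (intro additive_finsum[OF CC.abelian_tensor Q h]) auto

text \<open>With the same family, taken from a dual basis of \<open>e\<^sub>i P\<close>, inserted each time, both sides become
  the double sum of \<open>(\<phi> \<otimes> z\<^sub>j) \<otimes> ((f\<^sub>j \<otimes> z\<^sub>l) \<otimes> (f\<^sub>l \<otimes> p))\<close>. It may be inserted in \<open>\<phi> \<otimes> z\<^sub>l\<close> too because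
  \<open>e\<^sub>i z\<^sub>l = z\<^sub>l\<close>.\<close>

lemma comult_coassoc:
  assumes x: "x \<in> carrier DP.T"
  shows "tensor_assoc k A DP.T DP.T DP.T (tensor_map k A DP.T DP.T CC.T DP.T comult (\<lambda>y. y) (comult x)) =
      tensor_map k A DP.T DP.T DP.T CC.T (\<lambda>y. y) comult (comult x)"
proof -
  let ?G = "DP.T"
  note mL = tensor_map[OF CC.tensor_pair_axioms CC_C.tensor_pair_axioms comult_hom bimodule_hom_id]
  note mR = tensor_map[OF CC.tensor_pair_axioms C_CC.tensor_pair_axioms bimodule_hom_id comult_hom]
  note as = tensor_assoc[OF DP.bimodule_tensor DP.bimodule_tensor DP.bimodule_tensor]
  show ?thesis using x
  proof (induction rule: DP.tensor_induct)
    case (add s t)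
    then show ?case
      by (simp add: additive_closed[OF comult_additive] additive_add[OF comult_additive]
        additive_closed[OF mL(1)] additive_add[OF mL(1)] additive_add[OF mR(1)] additive_add[OF as(1)])
  next
    case (pure \<phi> p)
    obtain i n z f where i: "i \<in> I" "represents n z f (e i)" "e i \<triangleright>\<^bsub>P\<^esub> p = p"
      "\<And>l. l < n \<Longrightarrow> e i \<triangleright>\<^bsub>P\<^esub> z l = z l"
      by (rule unit_system[of "{}" "{p}"]) (use pure in auto)
    note zf = representsD(1,2)[OF i(2)]
    let ?t = "\<lambda>j l. C_CC.pure (DP.pure \<phi> (z j)) (CC.pure (DP.pure (f j) (z l)) (DP.pure (f l) p))"
    have t: "?t j l \<in> carrier C_CC.T" if "j < n" "l < n" for j l
      using that zf pure by (intro C_CC.pure_closed CC.pure_closed DP.pure_closed)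
    have L: "tensor_assoc k A ?G ?G ?G (CC_C.pure (split_sum \<phi> (z l) n z f) (DP.pure (f l) p))
        = (\<Oplus>\<^bsub>C_CC.T\<^esub>j\<in>{..<n}. ?t j l)" if l: "l < n" for l
    proof -
      have "(\<lambda>w. tensor_assoc k A ?G ?G ?G (CC_C.pure w (DP.pure (f l) p))) \<in> additive CC.T C_CC.T"
        using l zf pure CC_C.pure_closed CC_C.pure_add_left
        by (intro additiveI) (simp_all add: DP.pure_closed additive_closed[OF as(1)] additive_add[OF as(1)])
      from additive_split_sum[OF C_CC.abelian_tensor this i(2) pure(1) zf(1)[OF l]]
      have "tensor_assoc k A ?G ?G ?G (CC_C.pure (split_sum \<phi> (z l) n z f) (DP.pure (f l) p)) =
        (\<Oplus>\<^bsub>C_CC.T\<^esub>j\<in>{..<n}. tensor_assoc k A ?G ?G ?G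
          (CC_C.pure (CC.pure (DP.pure \<phi> (z j)) (DP.pure (f j) (z l))) (DP.pure (f l) p)))" .
      also have "\<dots> = (\<Oplus>\<^bsub>C_CC.T\<^esub>j\<in>{..<n}. ?t j l)"
        using l zf pure t by (intro C_CC.T.finsum_cong') (auto simp: as(2) DP.pure_closed)
      finally show ?thesis .
    qed
    have R: "C_CC.pure (DP.pure \<phi> (z l)) (split_sum (f l) p n z f) = (\<Oplus>\<^bsub>C_CC.T\<^esub>j\<in>{..<n}. ?t l j)"
      if l: "l < n" for l
      by (rule additive_split_sum[OF C_CC.abelian_tensor C_CC.pure_additive_right i(2) zf(2)[OF l] pure(2)])
        (use l zf pure in \<open>intro DP.pure_closed\<close>)
    have cz: "comult (DP.pure \<psi> (z l)) = split_sum \<psi> (z l) n z f" if "l < n" "\<psi> \<in> carrier Dg" for l \<psi>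
      using that by (intro comult_pure_unit[OF i(1,2) i(4)] zf)
    have cp: "comult (DP.pure \<psi> p) = split_sum \<psi> p n z f" if "\<psi> \<in> carrier Dg" for \<psi>
      using that pure by (intro comult_pure_unit[OF i(1,2,3)])
    have "(\<lambda>w. tensor_assoc k A ?G ?G ?G (tensor_map k A ?G ?G CC.T ?G comult (\<lambda>y. y) w)) \<in> additive CC.T C_CC.T"
      by (intro additiveI) (simp_all add: additive_closed[OF mL(1)] additive_add[OF mL(1)]
          additive_closed[OF as(1)] additive_add[OF as(1)])
    from additive_split_sum[OF C_CC.abelian_tensor this i(2) pure]
    have "tensor_assoc k A ?G ?G ?G (tensor_map k A ?G ?G CC.T ?G comult (\<lambda>y. y) (comult (DP.pure \<phi> p)))
      = (\<Oplus>\<^bsub>C_CC.T\<^esub>l\<in>{..<n}. tensor_assoc k A ?G ?G ?G (tensor_map k A ?G ?G CC.T ?G comult (\<lambda>y. y)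
          (CC.pure (DP.pure \<phi> (z l)) (DP.pure (f l) p))))"
      unfolding cp[OF pure(1)] .
    also have "\<dots> = (\<Oplus>\<^bsub>C_CC.T\<^esub>l\<in>{..<n}. \<Oplus>\<^bsub>C_CC.T\<^esub>j\<in>{..<n}. ?t j l)"
      using zf pure t L by (intro C_CC.T.finsum_cong')
        (auto simp: mL(2) DP.pure_closed cz intro!: C_CC.T.finsum_closed)
    also have "\<dots> = (\<Oplus>\<^bsub>C_CC.T\<^esub>j\<in>{..<n}. \<Oplus>\<^bsub>C_CC.T\<^esub>l\<in>{..<n}. ?t j l)"
      using t by (intro C_CC.T.finsum_swap) auto
    also have "\<dots> = (\<Oplus>\<^bsub>C_CC.T\<^esub>l\<in>{..<n}. tensor_map k A ?G ?G ?G CC.T (\<lambda>y. y) comult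
          (CC.pure (DP.pure \<phi> (z l)) (DP.pure (f l) p)))"
    proof (intro C_CC.T.finsum_cong')
      show eq: "(\<Oplus>\<^bsub>C_CC.T\<^esub>j\<in>{..<n}. ?t l j) = tensor_map k A ?G ?G ?G CC.T (\<lambda>y. y) comult
          (CC.pure (DP.pure \<phi> (z l)) (DP.pure (f l) p))" if "l \<in> {..<n}" for l
        using that zf pure R[of l] by (simp add: mR(2) DP.pure_closed cp)
      show "(\<lambda>l. tensor_map k A ?G ?G ?G CC.T (\<lambda>y. y) comult (CC.pure (DP.pure \<phi> (z l)) (DP.pure (f l) p)))
          \<in> {..<n} \<rightarrow> carrier C_CC.T"
        using additive_closed[OF mR(1)] summand_closed[OF i(2) pure] by auto
    qed simp
    also have "\<dots> = tensor_map k A ?G ?G ?G CC.T (\<lambda>y. y) comult (comult (DP.pure \<phi> p))"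
      unfolding cp[OF pure(1)] by (rule additive_split_sum[OF C_CC.abelian_tensor mR(1) i(2) pure, symmetric])
    finally show ?case .
  qed
qed

text \<open>The left-hand side is \<open>\<Sum> \<phi>(z\<^sub>l) f\<^sub>l \<otimes> p = \<phi> e\<^sub>i \<otimes> p = \<phi> \<otimes> e\<^sub>i p\<close>.\<close>

lemma comult_counit_left:
  assumes x: "x \<in> carrier DP.T"
  shows "left_action_map k A DP.T (tensor_map k A DP.T DP.T (regular_bimodule A) DP.T counit (\<lambda>y. y) (comult x)) = x"
proof -
  note m = tensor_map[OF CC.tensor_pair_axioms A_C.tensor_pair_axioms counit_hom bimodule_hom_id]
  have "balanced k A (regular_bimodule A) DP.T DP.T (\<lambda>a x. a \<triangleright>\<^bsub>DP.T\<^esub> x)"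
    by (rule balancedI) (simp_all add: C.lsmult_closed C.lsmult_l_distr C.lsmult_r_distr C.lsmult_assoc
        C.lsmult_smult_l C.lsmult_smult_r)
  note u = A_C.tensor_lift[OF DP.abelian_tensor this, folded left_action_map_def]
  let ?h = "\<lambda>w. left_action_map k A DP.T (tensor_map k A DP.T DP.T (regular_bimodule A) DP.T counit (\<lambda>y. y) w)"
  have h: "?h \<in> additive CC.T DP.T"
    by (intro additiveI) (simp_all add: additive_closed[OF m(1)] additive_add[OF m(1)]
        additive_closed[OF u(1)] additive_add[OF u(1)])
  have hp: "?h (CC.pure s t) = counit s \<triangleright>\<^bsub>DP.T\<^esub> t" if "s \<in> carrier DP.T" "t \<in> carrier DP.T" for s t
    using that additive_closed[OF counit_additive] by (simp add: m(2) u(2))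
  show ?thesis using x
  proof (induction rule: DP.tensor_induct)
    case (add s t)
    then show ?case
      by (simp add: additive_closed[OF comult_additive] additive_add[OF comult_additive] additive_add[OF h])
  next
    case (pure \<phi> p)
    obtain i n z f where i: "i \<in> I" "represents n z f (e i)" "e i \<triangleright>\<^bsub>P\<^esub> p = p"
      by (rule unit_system[of "{}" "{p}"]) (use pure in auto)
    note zf = representsD(1,2)[OF i(2)]
    have \<phi>e: "\<phi> \<triangleleft>\<^bsub>Dg\<^esub> e i = (\<Oplus>\<^bsub>Dg\<^esub>l\<in>{..<n}. \<phi> (z l) \<triangleright>\<^bsub>Dg\<^esub> f l)"
      by (rule dagger_unit_expansion[OF i(2,1) pure(1)])
    have cl: "\<phi> (z l) \<triangleright>\<^bsub>Dg\<^esub> f l \<in> carrier Dg" if "l < n" for l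
      using that zf by (intro D.lsmult_closed daggerD(3)[OF pure(1)])
    have "?h (comult (DP.pure \<phi> p)) = (\<Oplus>\<^bsub>DP.T\<^esub>l\<in>{..<n}. ?h (CC.pure (DP.pure \<phi> (z l)) (DP.pure (f l) p)))"
      unfolding comult_pure_unit[OF i pure] by (rule additive_split_sum[OF DP.abelian_tensor h i(2) pure])
    also have "\<dots> = (\<Oplus>\<^bsub>DP.T\<^esub>l\<in>{..<n}. DP.pure (\<phi> (z l) \<triangleright>\<^bsub>Dg\<^esub> f l) p)"
      using zf pure cl daggerD(3)[OF pure(1)]
      by (intro DP.T.finsum_cong') (auto simp: hp DP.pure_closed counit_pure DP.action_pure)
    also have "\<dots> = DP.pure (\<phi> \<triangleleft>\<^bsub>Dg\<^esub> e i) p"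
      unfolding \<phi>e using cl pure
      by (intro additive_finsum[OF D.abelian DP.abelian_tensor DP.pure_additive_left, symmetric]) auto
    also have "\<dots> = DP.pure \<phi> p"
      using pure i U.unit_closed by (simp add: DP.pure_middle)
    finally show ?case .
  qed
qed

text \<open>The left-hand side is \<open>\<phi> \<otimes> \<Sum> z\<^sub>l f\<^sub>l(p) = \<phi> \<otimes> e\<^sub>i p\<close>.\<close>

lemma comult_counit_right:
  assumes x: "x \<in> carrier DP.T"
  shows "right_action_map k A DP.T (tensor_map k A DP.T DP.T DP.T (regular_bimodule A) (\<lambda>y. y) counit (comult x)) = x"
proof -
  note m = tensor_map[OF CC.tensor_pair_axioms C_A.tensor_pair_axioms bimodule_hom_id counit_hom]
  have "balanced k A DP.T (regular_bimodule A) DP.T (\<lambda>x a. x \<triangleleft>\<^bsub>DP.T\<^esub> a)"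
    by (rule balancedI) (simp_all add: C.rsmult_closed C.rsmult_l_distr C.rsmult_r_distr C.rsmult_assoc
        C.rsmult_smult_l C.rsmult_smult_r)
  note u = C_A.tensor_lift[OF DP.abelian_tensor this, folded right_action_map_def]
  let ?h = "\<lambda>w. right_action_map k A DP.T (tensor_map k A DP.T DP.T DP.T (regular_bimodule A) (\<lambda>y. y) counit w)"
  have h: "?h \<in> additive CC.T DP.T"
    by (intro additiveI) (simp_all add: additive_closed[OF m(1)] additive_add[OF m(1)]
        additive_closed[OF u(1)] additive_add[OF u(1)])
  have hp: "?h (CC.pure s t) = s \<triangleleft>\<^bsub>DP.T\<^esub> counit t" if "s \<in> carrier DP.T" "t \<in> carrier DP.T" for s t
    using that additive_closed[OF counit_additive] by (simp add: m(2) u(2))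
  show ?thesis using x
  proof (induction rule: DP.tensor_induct)
    case (add s t)
    then show ?case
      by (simp add: additive_closed[OF comult_additive] additive_add[OF comult_additive] additive_add[OF h])
  next
    case (pure \<phi> p)
    obtain i n z f where i: "i \<in> I" "represents n z f (e i)" "e i \<triangleright>\<^bsub>P\<^esub> p = p"
      by (rule unit_system[of "{}" "{p}"]) (use pure in auto)
    note zf = representsD(1,2)[OF i(2)]
    have "?h (comult (DP.pure \<phi> p)) = (\<Oplus>\<^bsub>DP.T\<^esub>l\<in>{..<n}. ?h (CC.pure (DP.pure \<phi> (z l)) (DP.pure (f l) p)))"
      unfolding comult_pure_unit[OF i pure] by (rule additive_split_sum[OF DP.abelian_tensor h i(2) pure])
    also have "\<dots> = (\<Oplus>\<^bsub>DP.T\<^esub>l\<in>{..<n}. DP.pure \<phi> (z l \<triangleleft>\<^bsub>P\<^esub> f l p))"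
      using zf pure daggerD(3) represents_summand_closed[OF i(2) pure(2)]
      by (intro DP.T.finsum_cong') (auto simp: hp DP.pure_closed counit_pure DP.action_pure)
    also have "\<dots> = DP.pure \<phi> (\<Oplus>\<^bsub>P\<^esub>l\<in>{..<n}. z l \<triangleleft>\<^bsub>P\<^esub> f l p)"
      using represents_summand_closed[OF i(2) pure(2)] pure
      by (intro additive_finsum[OF P.abelian DP.abelian_tensor DP.pure_additive_right, symmetric]) auto
    also have "\<dots> = DP.pure \<phi> p"
      using representsD(3)[OF i(2) pure(2)] i(3) by simp
    finally show ?case .
  qed
qed

theorem comatrix_coring: "coring k A DP.T comult counit"
proof (intro coring.intro coring_axioms.intro unital_A DP.bimodule_tensor comult_hom counit_hom
    comult_coassoc comult_counit_left comult_counit_right)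
  show "left_unital A DP.T"
    unfolding left_unital_def
  proof
    show "\<one>\<^bsub>A\<^esub> \<triangleright>\<^bsub>DP.T\<^esub> x = x" if "x \<in> carrier DP.T" for x
      using that
    proof (induction rule: DP.tensor_induct)
      case (pure \<phi> p)
      have "\<one>\<^bsub>A\<^esub> \<triangleright>\<^bsub>Dg\<^esub> \<phi> = \<phi>"
        using pure by (intro dagger_eqI D.lsmult_closed) (simp_all add: dagger_apply daggerD(3))
      then show ?case using pure by (simp add: DP.action_pure)
    qed (simp add: DP.action_add)
  qed
  show "right_unital A DP.T"
    unfolding right_unital_def
  proof
    show "x \<triangleleft>\<^bsub>DP.T\<^esub> \<one>\<^bsub>A\<^esub> = x" if "x \<in> carrier DP.T" for x
      using that
    proof (induction rule: DP.tensor_induct)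
      case (pure \<phi> p)
      then show ?case using unital_P by (simp add: DP.action_pure right_unital_def)
    qed (simp add: DP.action_add)
  qed
qed

section \<open>The formula in terms of a finite dual basis\<close>

text \<open>The map of \<open>insertion_balanced\<close>, restricted along \<open>\<sigma>\<^sub>i\<close> in the first and along \<open>\<psi> \<mapsto> \<psi> \<circ> \<tau>\<^sub>i\<close> in the
  second argument.\<close>

lemma dual_part_balanced:
  assumes i: "i \<in> I" and \<phi>: "\<phi> \<in> carrier Dg" and p: "p \<in> carrier P"
  shows "balanced k A (local_part P (e i)) (dual A (local_part P (e i))) CC.T
    (\<lambda>z \<psi>. CC.pure (DP.pure \<phi> z) (DP.pure (compose (carrier P) \<psi> (local_proj P (e i))) p))"
    (is "balanced k A ?L ?D CC.T ?\<beta>")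
proof -
  interpret L: right_module k A ?L by (rule right_module_part[OF i])
  have op: "x \<oplus>\<^bsub>?L\<^esub> y = x \<oplus>\<^bsub>P\<^esub> y" "x \<triangleleft>\<^bsub>?L\<^esub> a = x \<triangleleft>\<^bsub>P\<^esub> a" "c \<odot>\<^bsub>?L\<^esub> x = c \<odot>\<^bsub>P\<^esub> x" for x y a c
    by (simp_all add: local_part_def)
  let ?\<tau> = "\<lambda>\<psi>. compose (carrier P) \<psi> (local_proj P (e i))"
  note \<tau> = dual_part_lift[OF i]
  have eL: "e i \<triangleright>\<^bsub>P\<^esub> q \<in> carrier ?L" if "q \<in> carrier P" for q
    using that by (simp add: local_part_def)
  have PL: "x \<in> carrier P" if "x \<in> carrier ?L" for x
    using that i by (simp add: local_part_iff)
  have \<tau>_add: "?\<tau> (\<psi> \<oplus>\<^bsub>?D\<^esub> \<chi>) = ?\<tau> \<psi> \<oplus>\<^bsub>Dg\<^esub> ?\<tau> \<chi>" for \<psi> \<chi>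
    using eL by (auto simp: dagger_apply L.dual_sel compose_def local_proj_def)
  have \<tau>_act: "?\<tau> (a \<triangleright>\<^bsub>?D\<^esub> \<psi>) = a \<triangleright>\<^bsub>Dg\<^esub> ?\<tau> \<psi>" for a \<psi>
    using eL by (auto simp: dagger_apply L.dual_sel compose_def local_proj_def)
  have \<tau>_smult: "?\<tau> (c \<odot>\<^bsub>?D\<^esub> \<psi>) = c \<odot>\<^bsub>Dg\<^esub> ?\<tau> \<psi>" for c \<psi>
    using eL by (auto simp: dagger_apply L.dual_sel compose_def local_proj_def)
  note b = insertion_balanced[OF \<phi> p]
  show ?thesis
    by (rule balancedI)
      (simp_all add: op PL \<tau> \<tau>_add \<tau>_act \<tau>_smult balanced_closed[OF b] balanced_add_left[OF b]
        balanced_add_right[OF b] balancedD(3,4)[OF b])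
qed

text \<open>The families \<open>z\<close> and \<open>z'\<close> are given through their tensor only, which is that of a dual basis. So the
  formula is transported from an actual dual basis along the map that
  \<open>dual_part_balanced\<close> induces on \<open>e\<^sub>i P \<otimes>\<^sub>A (e\<^sub>i P)\<^sup>*\<close>.\<close>

lemma comult_comatrix_elem:
  assumes i: "i \<in> I" and \<phi>: "\<phi> \<in> carrier (dual A (local_part P (e i)))" and p: "p \<in> carrier (local_part P (e i))"
    and z: "z \<in> {..<n} \<rightarrow> carrier (local_part P (e i))" and z': "z' \<in> {..<n} \<rightarrow> carrier (dual A (local_part P (e i)))"
    and E: "finite_dual_basis k A (local_part P (e i)) =
      tensor_sum k A (local_part P (e i)) (dual A (local_part P (e i))) n z z'"
  shows "comult (comatrix_elem k A B I e P i \<phi> p) =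
    tensor_sum k A DP.T DP.T n (\<lambda>l. comatrix_elem k A B I e P i \<phi> (z l)) (\<lambda>l. comatrix_elem k A B I e P i (z' l) p)"
proof -
  let ?L = "local_part P (e i)"
  interpret L: right_module k A ?L by (rule right_module_part[OF i])
  interpret LD: tensor_pair k A ?L "dual A ?L" by (rule L.tensor_pair_dual)
  let ?\<tau> = "\<lambda>\<psi>. compose (carrier P) \<psi> (local_proj P (e i))"
  have \<tau>\<phi>: "?\<tau> \<phi> \<in> carrier Dg" by (rule dual_part_lift[OF i \<phi>])
  have pP: "p \<in> carrier P" "e i \<triangleright>\<^bsub>P\<^esub> p = p" using p by (simp_all add: local_part_iff[OF i])
  note lift = LD.tensor_lift[OF CC.abelian_tensor dual_part_balanced[OF i \<tau>\<phi> pP(1)]]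
  let ?h = "tensor_lift k A ?L (dual A ?L) CC.T (\<lambda>z \<psi>. CC.pure (DP.pure (?\<tau> \<phi>) z) (DP.pure (?\<tau> \<psi>) p))"
  have h: "?h (tensor_sum k A ?L (dual A ?L) m u v) =
      (\<Oplus>\<^bsub>CC.T\<^esub>l\<in>{..<m}. CC.pure (DP.pure (?\<tau> \<phi>) (u l)) (DP.pure (?\<tau> (v l)) p))"
    if "u \<in> {..<m} \<rightarrow> carrier ?L" "v \<in> {..<m} \<rightarrow> carrier (dual A ?L)" for m u v
  proof -
    have "?h (tensor_sum k A ?L (dual A ?L) m u v) = (\<Oplus>\<^bsub>CC.T\<^esub>l\<in>{..<m}. ?h (LD.pure (u l) (v l)))"
      unfolding tensor_sum_def using that LD.pure_closed
      by (intro additive_finsum[OF LD.abelian_tensor CC.abelian_tensor lift(1)]) auto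
    also have "\<dots> = (\<Oplus>\<^bsub>CC.T\<^esub>l\<in>{..<m}. CC.pure (DP.pure (?\<tau> \<phi>) (u l)) (DP.pure (?\<tau> (v l)) p))"
      using that balanced_closed[OF dual_part_balanced[OF i \<tau>\<phi> pP(1)]]
      by (intro CC.T.finsum_cong') (auto simp: lift(2) Pi_iff)
    finally show ?thesis .
  qed
  obtain m u v where b: "L.dual_basis m u v"
    using L.dual_basis_exists[OF fin_gen[OF i] projective[OF i]] by blast
  then have uv: "u \<in> {..<m} \<rightarrow> carrier ?L" "v \<in> {..<m} \<rightarrow> carrier (dual A ?L)"
    by (simp_all add: L.dual_basis_def)
  have "comult (DP.pure (?\<tau> \<phi>) p) = ?h (tensor_sum k A ?L (dual A ?L) m u v)"
    unfolding h[OF uv] split_sum_def[symmetric]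
    by (rule comult_pure_unit[OF i represents_of_dual_basis[OF i b] pP(2) \<tau>\<phi> pP(1)])
  also have "tensor_sum k A ?L (dual A ?L) m u v = tensor_sum k A ?L (dual A ?L) n z z'"
    using E L.finite_dual_basis_eq[OF b] by simp
  also have "?h \<dots> = (\<Oplus>\<^bsub>CC.T\<^esub>l\<in>{..<n}. CC.pure (DP.pure (?\<tau> \<phi>) (z l)) (DP.pure (?\<tau> (z' l)) p))"
    by (rule h[OF z z'])
  also have "\<dots> = tensor_sum k A DP.T DP.T n (\<lambda>l. comatrix_elem k A B I e P i \<phi> (z l)) (\<lambda>l. comatrix_elem k A B I e P i (z' l) p)"
    unfolding tensor_sum_def
    using z z' p \<tau>\<phi> pP by (intro CC.T.finsum_cong')
      (auto simp: comatrix_elem_def local_incl_def Pi_iff local_part_iff[OF i] dual_part_lift[OF i]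
        intro!: CC.pure_closed DP.pure_closed)
  finally show ?thesis using p by (simp add: comatrix_elem_def local_incl_def)
qed

lemma counit_comatrix_elem:
  assumes i: "i \<in> I" and \<phi>: "\<phi> \<in> carrier (dual A (local_part P (e i)))" and p: "p \<in> carrier (local_part P (e i))"
  shows "counit (comatrix_elem k A B I e P i \<phi> p) = \<phi> p"
proof -
  have "p \<in> carrier P" "e i \<triangleright>\<^bsub>P\<^esub> p = p" using p by (simp_all add: local_part_iff[OF i])
  then show ?thesis
    using p dual_part_lift[OF i \<phi>]
    by (simp add: comatrix_elem_def local_incl_def counit_pure) (simp add: compose_def local_proj_def)
qed

end

theorem corollary4p14:
  fixes k :: "'k ring"
    and A :: "('k, 'a) module"
    and B :: "('k, 'b) module"
    and I :: "'i set" and e :: "'i \<Rightarrow> 'b"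
    and P :: "('k, 'b, 'a, 'p) bimodule"
  assumes "cring k"
    and "unital_algebra k A"
    and "assoc_algebra k B"
    and "idempotent_local_units B I e"
    and "bimodule k B A P" and "firm_left k B P" and "right_unital A P"
    and "\<And>i. i \<in> I \<Longrightarrow> fin_gen_right A (local_part P (e i))"
    and "\<And>i. i \<in> I \<Longrightarrow> projective_right A (local_part P (e i))"
  shows "\<exists>\<Delta> \<epsilon>. coring k A (comatrix k A B I e P) \<Delta> \<epsilon> \<and>
    (\<forall>i\<in>I. \<forall>\<phi>\<in>carrier (dual A (local_part P (e i))). \<forall>p\<in>carrier (local_part P (e i)).
      (\<forall>n z z'.
        z \<in> {..<n} \<rightarrow> carrier (local_part P (e i)) \<longrightarrow>
        z' \<in> {..<n} \<rightarrow> carrier (dual A (local_part P (e i))) \<longrightarrow>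
        finite_dual_basis k A (local_part P (e i)) =
          tensor_sum k A (local_part P (e i)) (dual A (local_part P (e i))) n z z' \<longrightarrow>
        \<Delta> (comatrix_elem k A B I e P i \<phi> p) =
          tensor_sum k A (comatrix k A B I e P) (comatrix k A B I e P) n
            (\<lambda>l. comatrix_elem k A B I e P i \<phi> (z l))
            (\<lambda>l. comatrix_elem k A B I e P i (z' l) p)) \<and>
      \<epsilon> (comatrix_elem k A B I e P i \<phi> p) = \<phi> p)"
proof -
  interpret comatrix_data k A B I e P
    by (intro comatrix_data.intro assms)
  show ?thesis
    unfolding comatrix_def
    using comatrix_coring comult_comatrix_elem counit_comatrix_elem
    by (intro exI[of _ comult] exI[of _ counit] conjI ballI allI impI)
qed

end
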